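(* For $0\le t\le 1$, the function $$\varphi(t)=\frac1N\,\mathbb{E}\log\sum_{\alpha\in\mathbb{N}^k,\ \vec\sigma\in\Sigma_N} w_\alpha \exp H_t(\vec\sigma,\alpha)$$ satisfies $$\varphi'(t)=-\frac12\,\theta(1)+\frac12\,\mathbb{E}\bigl\langle \theta(q_{\alpha\wedge\beta})\bigr\rangle-\frac12\,\mathbb{E}\bigl\langle \Delta(R_{1,2},q_{\alpha\wedge\beta})\bigr\rangle,$$ where $\langle\cdot\rangle$ denotes the Gibbs average of functions of $\bigl((\vec\sigma^1,\alpha),(\vec\sigma^2,\beta)\bigr)$ with respect to $\Gamma^{\otimes 2}$ (at the given $t$).
   Context: Setting. Let $N\ge1$, $\Sigma_N=\{-1,+1\}^N$, and for $\vec\sigma^1,\vec\sigma^2\in\Sigma_N$ let $R_{1,2}=\frac1N\sum_{i\le N}\sigma^1_i\sigma^2_i$. Let $\xi$ be a smooth convex function with $\xi(0)=0$, and let $(H_N(\vec\sigma))_{\vec\sigma\in\Sigma_N}$ be a centered Gaussian process with $\mathbb{E}H_N(\vec\sigma^1)H_N(\vec\sigma^2)=N\xi(R_{1,2})$. Put $\theta(x)=x\xi'(x)-\xi(x)$ and $\Delta(a,b)=\xi(a)-a\xi'(b)+\theta(b)$. Let $k\ge1$, $0=m_0<m_1<\dots<m_k<1$ and $0=q_0<q_1<\dots<q_k<q_{k+1}=1$. Derrida-Ruelle cascade with parameters $m_1,\dots,m_k$: $(u_{n_1})_{n_1\ge1}$ is the decreasing enumeration of a Poisson point process on $(0,\infty)$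 with intensity $x^{-1-m_1}dx$; recursively for $2\le l\le k$, for all $(n_1,\dots,n_{l-1})\in\mathbb{N}^{l-1}$, $(u_{n_1\dots n_{l-1}n_l})_{n_l\ge1}$ are (decreasing enumerations of) independent Poisson point processes with intensity $x^{-1-m_l}dx$, independent of all previously constructed processes. For $\alpha=(n_1,\dots,n_k)\in\mathbb{N}^k$, $v_\alpha=\prod_{1\le l\le k}u_{n_1\dots n_l}$ and $w_\alpha=v_\alpha/\sum_{\gamma\in\mathbb{N}^k} v_\gamma$ (the sum is a.s. finite). Gaussian process: let $z_{il}$ ($1\le i\le N$, $0\le l\le k$) be independent centered Gaussian with $\mathbb{E}z_{il}^2=\xi'(q_{l+1})-\xi'(q_l)$, and let $z_l=(z_{il})_{i\le N}$. Let $(z_{n_1})_{n_1\ge1}$ be i.i.d. copies of the column $z_1$ and, for $2\le l\le k$ and all $(n_1,\dots,n_{l-1})\in\mathbb{N}^{l-1}$, let $(z_{n_1\dots n_l})_{n_l\ge1}$ be independent sequences of i.i.d. copies of $z_l$, independent of everything constructed at earlier levels and of $z_0$. For $\alpha=(n_1,\dots,n_k)$ let $(z^\alpha_{il})$ be the matrix with columns $(z_0,z_{n_1},z_{n_1n_2},\dots,z_{n_1\dots n_k})$ (columns indexed by $l=0,\dots,k$; the column $z_0$ is common to all $\alpha$), and $s^\alpha=(s^\alpha_1,\dots,s^\alpha_N)$ with $s_i^\alpha=\sum_{0\le l\le k}z_{il}^\alpha$. The process $H_N$, the Gaussian columns and the cascade are mutually independent. For $\alpha,\beta\in\mathbb{N}^k$,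 $\alpha\wedge\beta=\min\{l\ge1:\alpha_l\ne\beta_l\}$ if $\alpha\ne\beta$, and $\alpha\wedge\beta=k+1$ if $\alpha=\beta$. For $0\le t\le1$ let $H_t(\vec\sigma,\alpha)=\sqrt t\,H_N(\vec\sigma)+\sqrt{1-t}\,s^\alpha\cdot\vec\sigma$, and let $\Gamma$ be the random Gibbs probability measure on $\Sigma_N\times\mathbb{N}^k$ with $\Gamma\{(\vec\sigma,\alpha)\}$ proportional to $w_\alpha\exp H_t(\vec\sigma,\alpha)$.
   Formalization: The formal theorem adds the hypothesis ξ'(0)=0, without which the identity fails: for N=1, ξ(x)=x the right-hand side is 0 while φ(t)=E log(2cosh(√t g)) is strictly increasing. *)

theory Defs
  imports "HOL-Probability.Probability"
begin

definition spins :: "nat \<Rightarrow> (nat \<Rightarrow> real) set" where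
  "spins N = (\<Pi>\<^sub>E i\<in>{1..N}. {-1, 1})"

definition overlap :: "nat \<Rightarrow> (nat \<Rightarrow> real) \<Rightarrow> (nat \<Rightarrow> real) \<Rightarrow> real" where
  "overlap N \<sigma>1 \<sigma>2 = (1 / real N) * (\<Sum>i\<in>{1..N}. \<sigma>1 i * \<sigma>2 i)"

definition smooth :: "(real \<Rightarrow> real) \<Rightarrow> bool" where
  "smooth f \<longleftrightarrow> (\<forall>n. (deriv ^^ n) f differentiable_on UNIV)"

definition theta :: "(real \<Rightarrow> real) \<Rightarrow> real \<Rightarrow> real" where
  "theta \<xi> x = x * deriv \<xi> x - \<xi> x"

definition Delta :: "(real \<Rightarrow> real) \<Rightarrow> real \<Rightarrow> real \<Rightarrow> real" where
  "Delta \<xi> a b = \<xi> a - a * deriv \<xi> b + theta \<xi> b"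


(* Centered Gaussian law of variance v; v = 0 gives the point mass at 0. *)
definition centered_gaussian :: "'a measure \<Rightarrow> real \<Rightarrow> ('a \<Rightarrow> real) \<Rightarrow> bool" where
  "centered_gaussian M v X \<longleftrightarrow>
     0 \<le> v \<and> X \<in> borel_measurable M \<and>
     distr M borel X = distr std_normal_distribution borel (\<lambda>x. sqrt v * x)"

definition centered_gaussian_process ::
    "'a measure \<Rightarrow> 'i set \<Rightarrow> ('i \<Rightarrow> 'a \<Rightarrow> real) \<Rightarrow> bool" where
  "centered_gaussian_process M I X \<longleftrightarrow>
     (\<forall>J c. finite J \<and> J \<subseteq> I \<longrightarrow> (\<exists>v. centered_gaussian M v (\<lambda>\<omega>. \<Sum>i\<in>J. c i * X i \<omega>)))"


(* The library's poisson_pmf is specified for positive rates only. *)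
definition poisson_distributed :: "'a measure \<Rightarrow> real \<Rightarrow> ('a \<Rightarrow> nat) \<Rightarrow> bool" where
  "poisson_distributed M r X \<longleftrightarrow>
     X \<in> measurable M (count_space UNIV) \<and>
     (if r = 0 then AE \<omega> in M. X \<omega> = 0
      else distr M (count_space UNIV) X = measure_pmf (poisson_pmf r))"

(* x is an enumeration, in decreasing order, of the points of a Poisson point process on
   the positive half-line with intensity measure mu.  Only sets of finite intensity are
   tested; on these the number of points is almost surely finite, so that "card" counts. *)
definition decreasing_poisson_process ::
    "'a measure \<Rightarrow> real measure \<Rightarrow> (nat \<Rightarrow> 'a \<Rightarrow> real) \<Rightarrow> bool" where
  "decreasing_poisson_process M \<mu> x \<longleftrightarrow>
     (\<forall>n. x n \<in> borel_measurable M) \<and>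
     (AE \<omega> in M. (\<forall>n. 0 < x n \<omega>) \<and> decseq (\<lambda>n. x n \<omega>)) \<and>
     (\<forall>A\<in>sets borel. A \<subseteq> {0<..} \<and> emeasure \<mu> A < \<infinity> \<longrightarrow>
        (AE \<omega> in M. finite {n. x n \<omega> \<in> A}) \<and>
        poisson_distributed M (measure \<mu> A) (\<lambda>\<omega>. card {n. x n \<omega> \<in> A})) \<and>
     (\<forall>\<A>. finite \<A> \<and> disjoint \<A> \<and>
        \<A> \<subseteq> {A \<in> sets borel. A \<subseteq> {0<..} \<and> emeasure \<mu> A < \<infinity>} \<longrightarrow>
        prob_space.indep_vars M (\<lambda>_. count_space UNIV) (\<lambda>A \<omega>. card {n. x n \<omega> \<in> A}) \<A>)"

definition cascade_intensity :: "real \<Rightarrow> real measure" where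
  "cascade_intensity m =
     density lborel (\<lambda>x. ennreal (x powr (- 1 - m)) * indicator {0<..} x)"


(* The families over the tree of multi-indices (n_1, ..., n_l), l \<le> k, are indexed by lists
   [n_1, ..., n_l]: u (p @ [n]) is the n-th point of the process attached to the node p, and
   z p i is the i-th entry of the Gaussian column attached to p, with z [] the column common
   to all leaves.  The numbering of children starts at 0 instead of 1. *)
definition leaves :: "nat \<Rightarrow> nat list set" where
  "leaves k = {\<alpha>. length \<alpha> = k}"

definition wedge :: "nat \<Rightarrow> nat list \<Rightarrow> nat list \<Rightarrow> nat" where
  "wedge k \<alpha> \<beta> = (if \<alpha> = \<beta> then k + 1 else Min {l\<in>{1..k}. \<alpha> ! (l - 1) \<noteq> \<beta> ! (l - 1)})"

definition cascade_v :: "nat \<Rightarrow> (nat list \<Rightarrow> 'a \<Rightarrow> real) \<Rightarrow> 'a \<Rightarrow> nat list \<Rightarrow> real" where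
  "cascade_v k u \<omega> \<alpha> = (\<Prod>l\<in>{1..k}. u (take l \<alpha>) \<omega>)"

definition cascade_w :: "nat \<Rightarrow> (nat list \<Rightarrow> 'a \<Rightarrow> real) \<Rightarrow> 'a \<Rightarrow> nat list \<Rightarrow> real" where
  "cascade_w k u \<omega> \<alpha> = cascade_v k u \<omega> \<alpha> / (\<Sum>\<^sub>\<infinity>\<gamma>\<in>leaves k. cascade_v k u \<omega> \<gamma>)"

definition tree_field ::
    "nat \<Rightarrow> (nat list \<Rightarrow> nat \<Rightarrow> 'a \<Rightarrow> real) \<Rightarrow> 'a \<Rightarrow> nat list \<Rightarrow> nat \<Rightarrow> real" where
  "tree_field k z \<omega> \<alpha> i = (\<Sum>l\<in>{0..k}. z (take l \<alpha>) i \<omega>)"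


definition generated_events :: "'a measure \<Rightarrow> 'i set \<Rightarrow> ('i \<Rightarrow> 'a \<Rightarrow> real) \<Rightarrow> 'a set set" where
  "generated_events M I X =
     sigma_sets (space M) (\<Union>i\<in>I. {X i -` B \<inter> space M | B. B \<in> sets borel})"

datatype source = Disorder | Entry "nat list" nat | Points "nat list"

definition sources :: "nat \<Rightarrow> nat \<Rightarrow> source set" where
  "sources N k = {Disorder} \<union> {Entry p i | p i. length p \<le> k \<and> i \<in> {1..N}}
     \<union> {Points p | p. length p < k}"

(* Mutual independence of the whole process H, of every single Gaussian entry z p i, and of
   every point process u (p @ [n]), n = 0, 1, ..., each taken as a whole. *)
definition independent_sources ::
    "'a measure \<Rightarrow> nat \<Rightarrow> nat \<Rightarrow> ((nat \<Rightarrow> real) \<Rightarrow> 'a \<Rightarrow> real) \<Rightarrow>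
     (nat list \<Rightarrow> nat \<Rightarrow> 'a \<Rightarrow> real) \<Rightarrow> (nat list \<Rightarrow> 'a \<Rightarrow> real) \<Rightarrow> bool" where
  "independent_sources M N k H z u \<longleftrightarrow>
     prob_space.indep_sets M
       (\<lambda>s. case s of
          Disorder \<Rightarrow> generated_events M (spins N) H
        | Entry p i \<Rightarrow> generated_events M {i} (z p)
        | Points p \<Rightarrow> generated_events M UNIV (\<lambda>n. u (p @ [n])))
       (sources N k)"


definition interp_H ::
    "nat \<Rightarrow> nat \<Rightarrow> ((nat \<Rightarrow> real) \<Rightarrow> 'a \<Rightarrow> real) \<Rightarrow> (nat list \<Rightarrow> nat \<Rightarrow> 'a \<Rightarrow> real) \<Rightarrow>
     real \<Rightarrow> 'a \<Rightarrow> (nat \<Rightarrow> real) \<Rightarrow> nat list \<Rightarrow> real" where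
  "interp_H N k H z t \<omega> \<sigma> \<alpha> =
     sqrt t * H \<sigma> \<omega> + sqrt (1 - t) * (\<Sum>i\<in>{1..N}. tree_field k z \<omega> \<alpha> i * \<sigma> i)"

definition partition_fun ::
    "nat \<Rightarrow> nat \<Rightarrow> ((nat \<Rightarrow> real) \<Rightarrow> 'a \<Rightarrow> real) \<Rightarrow> (nat list \<Rightarrow> nat \<Rightarrow> 'a \<Rightarrow> real) \<Rightarrow>
     (nat list \<Rightarrow> 'a \<Rightarrow> real) \<Rightarrow> real \<Rightarrow> 'a \<Rightarrow> real" where
  "partition_fun N k H z u t \<omega> =
     (\<Sum>\<^sub>\<infinity>(\<sigma>, \<alpha>)\<in>spins N \<times> leaves k. cascade_w k u \<omega> \<alpha> * exp (interp_H N k H z t \<omega> \<sigma> \<alpha>))"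

definition gibbs_measure ::
    "nat \<Rightarrow> nat \<Rightarrow> ((nat \<Rightarrow> real) \<Rightarrow> 'a \<Rightarrow> real) \<Rightarrow> (nat list \<Rightarrow> nat \<Rightarrow> 'a \<Rightarrow> real) \<Rightarrow>
     (nat list \<Rightarrow> 'a \<Rightarrow> real) \<Rightarrow> real \<Rightarrow> 'a \<Rightarrow> ((nat \<Rightarrow> real) \<times> nat list) measure" where
  "gibbs_measure N k H z u t \<omega> =
     point_measure (spins N \<times> leaves k)
       (\<lambda>(\<sigma>, \<alpha>). ennreal (cascade_w k u \<omega> \<alpha> * exp (interp_H N k H z t \<omega> \<sigma> \<alpha>)
                           / partition_fun N k H z u t \<omega>))"

definition gibbs_average ::
    "nat \<Rightarrow> nat \<Rightarrow> ((nat \<Rightarrow> real) \<Rightarrow> 'a \<Rightarrow> real) \<Rightarrow> (nat list \<Rightarrow> nat \<Rightarrow> 'a \<Rightarrow> real) \<Rightarrow>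
     (nat list \<Rightarrow> 'a \<Rightarrow> real) \<Rightarrow> real \<Rightarrow> 'a \<Rightarrow>
     (((nat \<Rightarrow> real) \<times> nat list) \<times> ((nat \<Rightarrow> real) \<times> nat list) \<Rightarrow> real) \<Rightarrow> real" where
  "gibbs_average N k H z u t \<omega> f =
     (\<integral>x. f x \<partial>(gibbs_measure N k H z u t \<omega> \<Otimes>\<^sub>M gibbs_measure N k H z u t \<omega>))"

definition phi ::
    "'a measure \<Rightarrow> nat \<Rightarrow> nat \<Rightarrow> ((nat \<Rightarrow> real) \<Rightarrow> 'a \<Rightarrow> real) \<Rightarrow>
     (nat list \<Rightarrow> nat \<Rightarrow> 'a \<Rightarrow> real) \<Rightarrow> (nat list \<Rightarrow> 'a \<Rightarrow> real) \<Rightarrow> real \<Rightarrow> real" where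
  "phi M N k H z u t = (1 / real N) * (\<integral>\<omega>. ln (partition_fun N k H z u t \<omega>) \<partial>M)"

end

theory Submission
  imports Defs
begin

text \<open>Differentiating \<open>log Z\<close> gives the Gibbs average of the Gaussian field
  \<open>H / (2 sqrt t) - s \<cdot> \<sigma> / (2 sqrt (1 - t))\<close>, whose covariance with the Hamiltonian is half the
  difference of the covariances of \<open>H\<close> and \<open>s \<cdot> \<sigma>\<close>. Integration by parts, with the cascade weights
  kept fixed by independence, therefore yields the average of
  \<open>N / 2 * (\<xi> 1 - \<xi>' 1 - \<xi> R + R * \<xi>' q)\<close>, which is the asserted combination of \<open>\<theta>\<close> and \<open>\<Delta>\<close>.
  This is carried out with the cavity fields switched off outside a finite set of leaves. The integrated
  identity survives the limit since \<open>log Z\<close> is dominated uniformly in \<open>t\<close> and in the truncation,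
  and the limiting slope is continuous on the closed interval, which covers the endpoints.

  That the cascade has finite total mass is obtained from fractional moments, level by level from the
  leaves: the sum over a subtree at level \<open>l\<close> has a bounded moment of every order below the exponent
  of that level, by subadditivity of \<open>x powr c\<close> for \<open>c \<le> 1\<close> and the mean number of points.\<close>

text \<open>The square roots have infinite slope at 0 and 1, so in general there is no pathwise
  derivative at the endpoints. The singular factors cancel only in the covariance of the derived
  field with the Hamiltonian, hence only after integration by parts; what remains is a bounded
  function of two replicas, and this bounded slope passes to all limits. Integration by parts is
  one-dimensional: every field is regressed on the variable to be removed, and the remainders
  together with the random weights are independent of it. Gaussianity is known only through laws of
  linear combinations, so this independence is read off from a factorising joint characteristic
  function. Switching cavity fields off, instead of dropping leaves, keeps the total weight at 1 for
  each spin configuration. This makes the lower bound on \<open>ln Z\<close> uniform: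
  \<open>1 / Z\<close> is at most the partition sum of the negated Hamiltonian once the total weight
  is at least 1. The majorant has finite mean because its Gaussian factor has the same exponential
  moment at every leaf, while the mean weights sum to 1.\<close>

subsection \<open>Independence from joint characteristic functions\<close>

lemma (in prob_space) integrable_bounded:
  fixes f :: "'a \<Rightarrow> 'b::{banach,second_countable_topology}"
  assumes "f \<in> borel_measurable M" "\<And>x. norm (f x) \<le> B"
  shows "integrable M f"
  by (rule integrable_const_bound[where B=B]) (use assms in auto)

lemma norm_prod_le_1:
  fixes f :: "'i \<Rightarrow> 'b::{real_normed_field}"
  assumes "\<And>i. i \<in> I \<Longrightarrow> norm (f i) \<le> 1"
  shows "norm (prod f I) \<le> 1"
  unfolding prod_norm[symmetric] using assms by (intro prod_le_1) auto

text \<open>Levy's uniqueness theorem for the signed measure with density \<open>f\<close>,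
  transported by \<open>V\<close>. The positive and negative parts of \<open>f\<close> have the same
  transform, and after normalisation they become densities under which \<open>V\<close> has the same
  law.\<close>

lemma (in prob_space) char_zero_real:
  fixes f V :: "'a \<Rightarrow> real"
  assumes f: "integrable M f" and V[measurable]: "V \<in> borel_measurable M"
    and 0: "\<And>r. (CLINT \<omega>|M. of_real (f \<omega>) * iexp (r * V \<omega>)) = 0"
    and B[measurable]: "B \<in> sets borel"
  shows "(LINT \<omega>|M. f \<omega> * indicator B (V \<omega>)) = 0"
proof -
  have fm[measurable]: "f \<in> borel_measurable M" using f by auto
  define p n where "p \<omega> = max 0 (f \<omega>)" and "n \<omega> = max 0 (- f \<omega>)" for \<omega>
  have pm[measurable]: "p \<in> borel_measurable M" "n \<in> borel_measurable M"
    unfolding p_def n_def by auto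
  have ip: "integrable M p" "integrable M n" unfolding p_def n_def using f by auto
  have fpn: "f \<omega> = p \<omega> - n \<omega>" and pos: "0 \<le> p \<omega>" "0 \<le> n \<omega>" for \<omega>
    unfolding p_def n_def by auto
  have ii: "integrable M (\<lambda>\<omega>. of_real (g \<omega>) * iexp (r * V \<omega>))" if "integrable M g" for g and r :: real
    by (rule Bochner_Integration.integrable_bound[of M g])
       (use that in \<open>auto simp: norm_mult\<close>)
  have eq: "(CLINT \<omega>|M. of_real (p \<omega>) * iexp (r * V \<omega>)) = (CLINT \<omega>|M. of_real (n \<omega>) * iexp (r * V \<omega>))" for r
    using 0[of r] ii[OF ip(1), of r] ii[OF ip(2), of r]
    by (simp add: fpn left_diff_distrib)
  \<comment> \<open>Frequency 0 gives equal masses, so one constant \<open>c\<close> normalises both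
    parts; if it is 0, \<open>f\<close> vanishes almost everywhere.\<close>
  have "(LINT \<omega>|M. p \<omega>) = (LINT \<omega>|M. n \<omega>)"
    using eq[of 0] by (simp only: mult_zero_left of_real_0 mult_zero_right exp_zero mult_1_right integral_complex_of_real of_real_eq_iff)
  then obtain c where c: "c = (LINT \<omega>|M. p \<omega>)" "c = (LINT \<omega>|M. n \<omega>)" by auto
  have iI: "integrable M (\<lambda>\<omega>. g \<omega> * indicator B (V \<omega>))" if "integrable M g" for g :: "'a \<Rightarrow> real"
    by (rule Bochner_Integration.integrable_bound[of M g])
       (use that in \<open>auto simp: indicator_def\<close>)
  show ?thesis
  proof (cases "c = 0")
    case True
    then have "AE \<omega> in M. p \<omega> = 0" "AE \<omega> in M. n \<omega> = 0"
      using integral_nonneg_eq_0_iff_AE[OF ip(1)] integral_nonneg_eq_0_iff_AE[OF ip(2)] c pos by auto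
    then have "AE \<omega> in M. f \<omega> * indicator B (V \<omega>) = 0" by eventually_elim (simp add: fpn)
    then show ?thesis by (subst integral_cong_AE[of _ _ "\<lambda>_. 0"]) auto
  next
    case False
    then have cp: "c > 0" using c pos by (simp add: less_le)
    define D where "D g = distr (density M (\<lambda>\<omega>. ennreal (g \<omega> / c))) borel V" for g :: "'a \<Rightarrow> real"
    have rd: "real_distribution (D g)" and ch: "char (D g) r = (CLINT \<omega>|M. of_real (g \<omega>) * iexp (r * V \<omega>)) / c"
       and me: "measure (D g) B = (LINT \<omega>|M. g \<omega> * indicator B (V \<omega>)) / c"
      if g: "integrable M g" "\<And>\<omega>. g \<omega> \<ge> 0" "c = (LINT \<omega>|M. g \<omega>)" for g r
    proof -
      have [measurable]: "g \<in> borel_measurable M" using g by auto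
      have pr: "prob_space (density M (\<lambda>\<omega>. ennreal (g \<omega> / c)))"
      proof (rule prob_spaceI)
        have "emeasure (density M (\<lambda>\<omega>. ennreal (g \<omega> / c))) (space (density M (\<lambda>\<omega>. ennreal (g \<omega> / c))))
          = (\<integral>\<^sup>+\<omega>. ennreal (g \<omega> / c) \<partial>M)"
          by (subst emeasure_density) (auto intro!: nn_integral_cong simp: indicator_def)
        also have "\<dots> = ennreal (LINT \<omega>|M. g \<omega> / c)"
          by (rule nn_integral_eq_integral) (use g cp in auto)
        also have "\<dots> = 1" using g(3) cp by simp
        finally show "emeasure (density M (\<lambda>\<omega>. ennreal (g \<omega> / c))) (space (density M (\<lambda>\<omega>. ennreal (g \<omega> / c)))) = 1" .
      qed
      then interpret P: prob_space "density M (\<lambda>\<omega>. ennreal (g \<omega> / c))" .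
      show "real_distribution (D g)" unfolding D_def by (rule P.real_distribution_distr) simp
      then interpret R: real_distribution "D g" .
      have "char (D g) r = (CLINT \<omega>|density M (\<lambda>\<omega>. ennreal (g \<omega> / c)). iexp (r * V \<omega>))"
        unfolding D_def char_def by (subst integral_distr) auto
      also have "\<dots> = (CLINT \<omega>|M. (g \<omega> / c) *\<^sub>R iexp (r * V \<omega>))"
        by (subst integral_density) (use g cp in auto)
      also have "\<dots> = (CLINT \<omega>|M. (of_real (g \<omega>) * iexp (r * V \<omega>)) / c)"
        by (simp add: scaleR_conv_of_real)
      finally show "char (D g) r = (CLINT \<omega>|M. of_real (g \<omega>) * iexp (r * V \<omega>)) / c"
        using cp by simp
      have "measure (D g) B = (LINT x|D g. indicator B x)"
        by (simp add: D_def)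
      also have "\<dots> = (LINT \<omega>|density M (\<lambda>\<omega>. ennreal (g \<omega> / c)). indicator B (V \<omega>))"
        unfolding D_def by (subst integral_distr) auto
      also have "\<dots> = (LINT \<omega>|M. (g \<omega> / c) *\<^sub>R indicator B (V \<omega>))"
        by (subst integral_density) (use g cp in auto)
      also have "\<dots> = (LINT \<omega>|M. (g \<omega> * indicator B (V \<omega>)) / c)"
        by (intro Bochner_Integration.integral_cong) auto
      finally show "measure (D g) B = (LINT \<omega>|M. g \<omega> * indicator B (V \<omega>)) / c"
        by simp
    qed
    have "D p = D n"
      by (rule Levy_uniqueness) (use rd ch ip pos c eq in \<open>auto simp: fun_eq_iff\<close>)
    then have "(LINT \<omega>|M. p \<omega> * indicator B (V \<omega>)) = (LINT \<omega>|M. n \<omega> * indicator B (V \<omega>))"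
      using me[OF ip(1) pos(1) c(1)] me[OF ip(2) pos(2) c(2)] cp by simp
    then show ?thesis using iI[OF ip(1)] iI[OF ip(2)] by (simp add: fpn left_diff_distrib)
  qed
qed

text \<open>Conjugation sends the frequency \<open>r\<close> to \<open>- r\<close>, so the conjugate
  of \<open>f\<close> annihilates all exponentials as well, and with it the real and imaginary
  parts; the real case applies to each of them.\<close>

lemma (in prob_space) char_zero_complex:
  fixes f :: "'a \<Rightarrow> complex" and V :: "'a \<Rightarrow> real"
  assumes f: "integrable M f" and V[measurable]: "V \<in> borel_measurable M"
    and 0: "\<And>r. (CLINT \<omega>|M. f \<omega> * iexp (r * V \<omega>)) = 0"
    and B[measurable]: "B \<in> sets borel"
  shows "(CLINT \<omega>|M. f \<omega> * indicator B (V \<omega>)) = 0"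
proof -
  have fm[measurable]: "f \<in> borel_measurable M" using f by auto
  have ii: "integrable M (\<lambda>\<omega>. g \<omega> * iexp (r * V \<omega>))" if "integrable M g" for g and r :: real
    by (rule Bochner_Integration.integrable_bound[of M g])
       (use that in \<open>auto simp: norm_mult\<close>)
  have cnj0: "(CLINT \<omega>|M. cnj (f \<omega>) * iexp (r * V \<omega>)) = 0" for r
  proof -
    have "(CLINT \<omega>|M. cnj (f \<omega>) * iexp (r * V \<omega>)) = (CLINT \<omega>|M. cnj (f \<omega> * iexp ((-r) * V \<omega>)))"
      by (intro Bochner_Integration.integral_cong) (auto simp: exp_cnj)
    also have "\<dots> = cnj (CLINT \<omega>|M. f \<omega> * iexp ((-r) * V \<omega>))" by (rule Bochner_Integration.integral_cnj)
    also have "\<dots> = 0" by (subst 0) simp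
    finally show ?thesis .
  qed
  have R: "(CLINT \<omega>|M. of_real (Re (f \<omega>)) * iexp (r * V \<omega>)) = 0" for r
  proof -
    have "(CLINT \<omega>|M. of_real (Re (f \<omega>)) * iexp (r * V \<omega>)) =
      (CLINT \<omega>|M. (f \<omega> * iexp (r * V \<omega>) + cnj (f \<omega>) * iexp (r * V \<omega>)) / 2)"
      by (intro Bochner_Integration.integral_cong) (auto simp: complex_add_cnj distrib_right[symmetric])
    also have "\<dots> = 0" using ii[OF f, of r] ii[of "\<lambda>x. cnj (f x)" r] f 0[of r] cnj0[of r] by simp
    finally show ?thesis .
  qed
  have I: "(CLINT \<omega>|M. of_real (Im (f \<omega>)) * iexp (r * V \<omega>)) = 0" for r
  proof -
    have "(CLINT \<omega>|M. of_real (Im (f \<omega>)) * iexp (r * V \<omega>)) =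
      (CLINT \<omega>|M. (f \<omega> * iexp (r * V \<omega>) - cnj (f \<omega>) * iexp (r * V \<omega>)) / (2 * \<i>))"
    proof (intro Bochner_Integration.integral_cong refl)
      fix \<omega>
      have "of_real (Im (f \<omega>)) = (f \<omega> - cnj (f \<omega>)) / (2 * \<i>)" by (simp add: complex_eq_iff)
      then show "of_real (Im (f \<omega>)) * iexp (r * V \<omega>) =
          (f \<omega> * iexp (r * V \<omega>) - cnj (f \<omega>) * iexp (r * V \<omega>)) / (2 * \<i>)"
        by (simp add: left_diff_distrib diff_divide_distrib)
    qed
    also have "\<dots> = 0" using ii[OF f, of r] ii[of "\<lambda>x. cnj (f x)" r] f 0[of r] cnj0[of r] by simp
    finally show ?thesis .
  qed
  have r0: "(LINT \<omega>|M. Re (f \<omega>) * indicator B (V \<omega>)) = 0"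
    by (rule char_zero_real[OF _ V R B]) (use f in auto)
  have i0: "(LINT \<omega>|M. Im (f \<omega>) * indicator B (V \<omega>)) = 0"
    by (rule char_zero_real[OF _ V I B]) (use f in auto)
  have iI: "integrable M (\<lambda>\<omega>. f \<omega> * indicator B (V \<omega>))"
    by (rule Bochner_Integration.integrable_bound[of M f]) (use f in \<open>auto simp: indicator_def\<close>)
  show ?thesis
  proof (rule complex_eqI)
    have "Re (CLINT \<omega>|M. f \<omega> * indicator B (V \<omega>)) = (LINT \<omega>|M. Re (f \<omega>) * indicator B (V \<omega>))"
      unfolding integral_Re[symmetric, OF iI]
      by (intro Bochner_Integration.integral_cong) (auto simp: indicator_def)
    then show "Re (CLINT \<omega>|M. f \<omega> * indicator B (V \<omega>)) = Re 0" using r0 by simp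
    have "Im (CLINT \<omega>|M. f \<omega> * indicator B (V \<omega>)) = (LINT \<omega>|M. Im (f \<omega>) * indicator B (V \<omega>))"
      unfolding integral_Im[symmetric, OF iI]
      by (intro Bochner_Integration.integral_cong) (auto simp: indicator_def)
    then show "Im (CLINT \<omega>|M. f \<omega> * indicator B (V \<omega>)) = Im 0" using i0 by simp
  qed
qed

text \<open>Kac's theorem; the induction replaces one exponential factor at a time by an indicator.\<close>

lemma (in prob_space) distr_pair_of_char:
  fixes X :: "'a \<Rightarrow> real" and V :: "'j \<Rightarrow> 'a \<Rightarrow> real"
  assumes J: "finite J" and X[measurable]: "X \<in> borel_measurable M"
    and V: "\<And>j. j \<in> J \<Longrightarrow> V j \<in> borel_measurable M"
    and fac: "\<And>s l. (CLINT \<omega>|M. iexp (s * X \<omega> + (\<Sum>j\<in>J. l j * V j \<omega>))) =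
       (CLINT \<omega>|M. iexp (s * X \<omega>)) * (CLINT \<omega>|M. iexp (\<Sum>j\<in>J. l j * V j \<omega>))"
  shows "distr M (borel \<Otimes>\<^sub>M (\<Pi>\<^sub>M j\<in>J. borel)) (\<lambda>\<omega>. (X \<omega>, \<lambda>j\<in>J. V j \<omega>)) =
     distr M borel X \<Otimes>\<^sub>M distr M (\<Pi>\<^sub>M j\<in>J. borel) (\<lambda>\<omega>. \<lambda>j\<in>J. V j \<omega>)"
proof -
  note V[measurable]
  have [measurable]: "(\<lambda>\<omega>. \<Sum>j\<in>J. l j * V j \<omega>) \<in> borel_measurable M" for l
    using V by auto
  \<comment> \<open>The coordinates in \<open>K\<close> already carry indicators. The exponential
    keeps all of \<open>J\<close> with arbitrary frequencies, because replacing the next coordinate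
    requires every frequency in it.\<close>
  have step: "(CLINT \<omega>|M. (iexp (s * X \<omega>) - (CLINT \<omega>|M. iexp (s * X \<omega>))) *
      (\<Prod>j\<in>K. indicator (B j) (V j \<omega>)) * iexp (\<Sum>j\<in>J. l j * V j \<omega>)) = 0"
    if "finite K" "K \<subseteq> J" "\<And>j. j \<in> K \<Longrightarrow> B j \<in> sets borel" for K s l B
    using that
  proof (induction K arbitrary: l rule: finite_induct)
    case empty
    have i: "integrable M (\<lambda>\<omega>. iexp (s * X \<omega> + (\<Sum>j\<in>J. l j * V j \<omega>)))"
      "integrable M (\<lambda>\<omega>. iexp (\<Sum>j\<in>J. l j * V j \<omega>))"
      by (rule integrable_bounded[where B=1]; simp)+
    have "(CLINT \<omega>|M. (iexp (s * X \<omega>) - (CLINT \<omega>|M. iexp (s * X \<omega>))) * iexp (\<Sum>j\<in>J. l j * V j \<omega>)) =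
      (CLINT \<omega>|M. iexp (s * X \<omega> + (\<Sum>j\<in>J. l j * V j \<omega>)) - (CLINT \<omega>|M. iexp (s * X \<omega>)) * iexp (\<Sum>j\<in>J. l j * V j \<omega>))"
      by (intro Bochner_Integration.integral_cong) (auto simp: algebra_simps exp_add)
    also have "\<dots> = 0" using i fac[of s l] by simp
    finally show ?case by simp
  next
    case (insert i K)
    have [measurable]: "(\<lambda>\<omega>. \<Prod>j\<in>K. indicator (B j) (V j \<omega>) :: complex) \<in> borel_measurable M"
      using insert.prems V by (intro borel_measurable_prod) auto
    have [measurable]: "V i \<in> borel_measurable M" "B i \<in> sets borel" using insert.prems V by auto
    let ?f = "\<lambda>\<omega>. (iexp (s * X \<omega>) - (CLINT \<omega>|M. iexp (s * X \<omega>))) *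
      (\<Prod>j\<in>K. indicator (B j) (V j \<omega>)) * iexp (\<Sum>j\<in>J. l j * V j \<omega>)"
    have "(CLINT \<omega>|M. ?f \<omega> * indicator (B i) (V i \<omega>)) = 0"
    proof (rule char_zero_complex)
      show "integrable M ?f"
      proof (rule integrable_bounded[where B="1 + cmod (CLINT \<omega>|M. iexp (s * X \<omega>))"])
        fix \<omega>
        have "norm (\<Prod>j\<in>K. indicator (B j) (V j \<omega>) :: complex) \<le> 1"
          by (rule norm_prod_le_1) (auto simp: indicator_def)
        moreover have "norm (iexp (s * X \<omega>) - (CLINT \<omega>|M. iexp (s * X \<omega>))) \<le> 1 + cmod (CLINT \<omega>|M. iexp (s * X \<omega>))"
          by (rule order_trans[OF norm_triangle_ineq4]) simp
        ultimately have "norm (iexp (s * X \<omega>) - (CLINT \<omega>|M. iexp (s * X \<omega>))) *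
            norm (\<Prod>j\<in>K. indicator (B j) (V j \<omega>) :: complex) \<le> (1 + cmod (CLINT \<omega>|M. iexp (s * X \<omega>))) * 1"
          by (intro mult_mono) auto
        then show "norm (?f \<omega>) \<le> 1 + cmod (CLINT \<omega>|M. iexp (s * X \<omega>))"
          unfolding norm_mult by (simp only: norm_exp_i_times mult_1_right)
      qed simp
      fix r
      \<comment> \<open>The extra exponential in \<open>V i\<close> is absorbed by shifting the
        frequency \<open>l i\<close> by \<open>r\<close>.\<close>
      have *: "(\<Sum>j\<in>J. (l(i := l i + r)) j * V j \<omega>) = (\<Sum>j\<in>J. l j * V j \<omega>) + r * V i \<omega>" for \<omega>
      proof -
        have "(\<Sum>j\<in>J. (l(i := l i + r)) j * V j \<omega>) = (\<Sum>j\<in>J. l j * V j \<omega> + (if j = i then r * V i \<omega> else 0))"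
          by (intro sum.cong) (auto simp: algebra_simps)
        then show ?thesis using insert.prems J by (simp add: sum.distrib)
      qed
      have "(CLINT \<omega>|M. ?f \<omega> * iexp (r * V i \<omega>)) =
        (CLINT \<omega>|M. (iexp (s * X \<omega>) - (CLINT \<omega>|M. iexp (s * X \<omega>))) *
          (\<Prod>j\<in>K. indicator (B j) (V j \<omega>)) * iexp (\<Sum>j\<in>J. (l(i := l i + r)) j * V j \<omega>))"
        by (intro Bochner_Integration.integral_cong) (auto simp: * exp_add distrib_left simp del: fun_upd_apply)
      also have "\<dots> = 0" using insert by blast
      finally show "(CLINT \<omega>|M. ?f \<omega> * iexp (r * V i \<omega>)) = 0" .
    qed simp_all
    then show ?case using insert.hyps by (simp add: mult_ac)
  qed
  have rect: "prob (X -` A \<inter> (\<Inter>j\<in>J. V j -` B j) \<inter> space M) =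
      prob (X -` A \<inter> space M) * prob ((\<Inter>j\<in>J. V j -` B j) \<inter> space M)"
    if A[measurable]: "A \<in> sets borel" and B: "\<And>j. j \<in> J \<Longrightarrow> B j \<in> sets borel" for A B
  proof -
    let ?I = "\<lambda>\<omega>. \<Prod>j\<in>J. indicator (B j) (V j \<omega>) :: real"
    have [measurable]: "?I \<in> borel_measurable M"
      using B V by (intro borel_measurable_prod) auto
    have I1: "norm (?I \<omega>) \<le> 1" for \<omega>
      by (rule norm_prod_le_1) (auto simp: indicator_def)
    have ii: "integrable M ?I" by (rule integrable_bounded[where B=1]) (use I1 in auto)
    have Ii: "?I \<omega> = indicator (\<Inter>j\<in>J. V j -` B j) \<omega>" for \<omega>
      using J by (auto simp: indicator_def prod.neutral)
    have me: "(\<Inter>j\<in>J. V j -` B j) \<inter> space M \<in> events"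
    proof -
      have "?I -` {1} \<inter> space M \<in> events" by measurable
      moreover have "?I -` {1} = (\<Inter>j\<in>J. V j -` B j)" unfolding Ii by (auto simp: indicator_def)
      ultimately show ?thesis by simp
    qed
    define c where "c = (LINT \<omega>|M. ?I \<omega>)"
    \<comment> \<open>\<open>X\<close> is the last variable to be turned into an indicator:
      \<open>step\<close> with all frequencies of \<open>V\<close> equal to 0 says that the centred
      product of indicators annihilates every exponential in \<open>X\<close>.\<close>
    have "(LINT \<omega>|M. (?I \<omega> - c) * indicator A (X \<omega>)) = 0"
    proof (rule char_zero_real)
      show "integrable M (\<lambda>x. ?I x - c)" using ii by simp
      fix s
      have i1: "integrable M (\<lambda>\<omega>. iexp (s * X \<omega>) * complex_of_real (?I \<omega>))"
        by (rule integrable_bounded[where B=1]) (use I1 in \<open>auto simp: norm_mult simp flip: of_real_prod\<close>)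
      have i2: "integrable M (\<lambda>\<omega>. iexp (s * X \<omega>))"
        by (rule integrable_bounded[where B=1]) auto
      have "(CLINT \<omega>|M. iexp (s * X \<omega>) * of_real (?I \<omega>) - (CLINT \<omega>|M. iexp (s * X \<omega>)) * of_real (?I \<omega>)) = 0"
      proof -
        have "(CLINT \<omega>|M. (iexp (s * X \<omega>) - (CLINT \<omega>|M. iexp (s * X \<omega>))) *
          (\<Prod>j\<in>J. indicator (B j) (V j \<omega>)) * iexp (\<Sum>j\<in>J. 0 * V j \<omega>)) = 0"
          by (rule step) (use J B in auto)
        then show ?thesis by (simp add: left_diff_distrib of_real_indicator)
      qed
      then have e: "(CLINT \<omega>|M. iexp (s * X \<omega>) * of_real (?I \<omega>)) = (CLINT \<omega>|M. iexp (s * X \<omega>)) * of_real c"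
        using i1 ii unfolding c_def
        by (subst (asm) Bochner_Integration.integral_diff) (auto simp del: of_real_prod)
      have "(CLINT \<omega>|M. of_real (?I \<omega> - c) * iexp (s * X \<omega>)) =
        (CLINT \<omega>|M. iexp (s * X \<omega>) * of_real (?I \<omega>) - iexp (s * X \<omega>) * of_real c)"
        by (intro Bochner_Integration.integral_cong) (auto simp: algebra_simps)
      also have "\<dots> = 0" using i1 i2 e by (subst Bochner_Integration.integral_diff) (auto simp del: of_real_prod)
      finally show "(CLINT \<omega>|M. of_real (?I \<omega> - c) * iexp (s * X \<omega>)) = 0" .
    qed simp_all
    moreover have "integrable M (\<lambda>\<omega>. ?I \<omega> * indicator A (X \<omega>))"
    proof (rule integrable_bounded[where B=1])
      show "(\<lambda>\<omega>. ?I \<omega> * indicator A (X \<omega>)) \<in> borel_measurable M" by measurable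
      show "norm (?I \<omega> * indicator A (X \<omega>)) \<le> 1" for \<omega>
        using I1[of \<omega>] by (cases "X \<omega> \<in> A") auto
    qed
    moreover have "integrable M (\<lambda>\<omega>. c * indicator A (X \<omega>))"
      by (rule integrable_bounded[where B="\<bar>c\<bar>"]) (auto simp: indicator_def)
    ultimately have "(LINT \<omega>|M. ?I \<omega> * indicator A (X \<omega>)) = c * (LINT \<omega>|M. indicator A (X \<omega>))"
      by (simp add: left_diff_distrib)
    moreover have "(LINT \<omega>|M. ?I \<omega> * indicator A (X \<omega>)) = 
        (LINT \<omega>|M. indicator (X -` A \<inter> (\<Inter>j\<in>J. V j -` B j) \<inter> space M) \<omega>)"
      unfolding Ii by (intro Bochner_Integration.integral_cong) (auto simp: indicator_def)
    moreover have "(LINT \<omega>|M. indicator A (X \<omega>) :: real) = (LINT \<omega>|M. indicator (X -` A \<inter> space M) \<omega>)"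
      by (intro Bochner_Integration.integral_cong) (auto simp: indicator_def)
    moreover have "c = (LINT \<omega>|M. indicator ((\<Inter>j\<in>J. V j -` B j) \<inter> space M) \<omega>)"
      unfolding c_def Ii by (intro Bochner_Integration.integral_cong) (auto simp: indicator_def)
    moreover have "X -` A \<inter> (\<Inter>j\<in>J. V j -` B j) \<inter> space M \<subseteq> space M" 
      "X -` A \<inter> (\<Inter>j\<in>J. V j -` B j) \<inter> space M = (X -` A \<inter> space M) \<inter> ((\<Inter>j\<in>J. V j -` B j) \<inter> space M)" by auto
    ultimately show ?thesis using me
      by (simp add: Int_absorb1 mult.commute del: vimage_INT)
  qed
  let ?V = "\<lambda>\<omega>. \<lambda>j\<in>J. V j \<omega>"
  let ?P = "\<Pi>\<^sub>M j\<in>J. (borel :: real measure)"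
  have mV[measurable]: "?V \<in> measurable M ?P" by (intro measurable_restrict V)
  \<comment> \<open>Boxes in the \<open>V\<close> coordinates are closed under intersection and
    generate the product sigma-algebra, so independence on boxes extends to all events.\<close>
  define E1 where "E1 = {X -` A \<inter> space M | A. A \<in> sets borel}"
  define E2 where "E2 = {?V -` A \<inter> space M | A. A \<in> prod_algebra J (\<lambda>_. borel :: real measure)}"
  have pa: "A \<in> prod_algebra J (\<lambda>_. borel :: real measure) \<longleftrightarrow> (\<exists>B. (\<forall>j\<in>J. B j \<in> sets borel) \<and> A = Pi\<^sub>E J B)" for A
    unfolding prod_algebra_eq_finite[OF J] by auto
  have ind: "indep_set E1 E2"
  proof (rule indep_setI)
    show "E1 \<subseteq> events" unfolding E1_def by auto
    show "E2 \<subseteq> events" unfolding E2_def using measurable_sets[OF mV]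
      by (auto simp: sets_PiM intro: sigma_sets.Basic)
    fix a b assume "a \<in> E1" "b \<in> E2"
    then obtain A B where A: "A \<in> sets borel" "a = X -` A \<inter> space M"
      and B: "\<forall>j\<in>J. B j \<in> sets borel" "b = ?V -` (Pi\<^sub>E J B) \<inter> space M"
      unfolding E1_def E2_def pa by auto
    have "b = (\<Inter>j\<in>J. V j -` B j) \<inter> space M" unfolding B by (auto simp: PiE_iff)
    moreover have "a \<inter> b = X -` A \<inter> (\<Inter>j\<in>J. V j -` B j) \<inter> space M"
      unfolding calculation A by auto
    ultimately show "prob (a \<inter> b) = prob a * prob b" using rect[OF A(1), of B] B(1) unfolding A(2) by metis
  qed
  have I2: "Int_stable E2"
    unfolding Int_stable_def
  proof (intro ballI)
    fix a b assume "a \<in> E2" "b \<in> E2"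
    then obtain A B where "A \<in> prod_algebra J (\<lambda>_. borel :: real measure)" "a = ?V -` A \<inter> space M"
      "B \<in> prod_algebra J (\<lambda>_. borel :: real measure)" "b = ?V -` B \<inter> space M"
      unfolding E2_def by auto
    then show "a \<inter> b \<in> E2"
      unfolding E2_def using Int_stableD[OF Int_stable_prod_algebra[of J "\<lambda>_. borel :: real measure"], of A B]
      by (intro CollectI exI[of _ "A \<inter> B"]) auto
  qed
  have I1: "Int_stable E1"
    unfolding Int_stable_def E1_def
  proof safe
    fix A B :: "real set" assume "A \<in> sets borel" "B \<in> sets borel"
    then show "\<exists>C. X -` A \<inter> space M \<inter> (X -` B \<inter> space M) = X -` C \<inter> space M \<and> C \<in> sets borel"
      by (intro exI[of _ "A \<inter> B"]) auto
  qed
  have "indep_set (sigma_sets (space M) E1) (sigma_sets (space M) E2)"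
    by (rule indep_set_sigma_sets[OF ind I1 I2])
  moreover have "sigma_sets (space M) {?V -` A \<inter> space M | A. A \<in> sets ?P} = sigma_sets (space M) E2"
  proof -
    have "{?V -` A \<inter> space M | A. A \<in> sets ?P} = sigma_sets (space M) E2"
      unfolding E2_def sets_PiM
      by (rule sigma_sets_vimage_commute) auto
    moreover have "sigma_sets (space M) (sigma_sets (space M) E2) = sigma_sets (space M) E2"
      by (rule sigma_sets_sigma_sets_eq) (auto simp: E2_def)
    ultimately show ?thesis by simp
  qed
  ultimately have ind2: "indep_set (sigma_sets (space M) E1) (sigma_sets (space M) {?V -` A \<inter> space M | A. A \<in> sets ?P})"
    by simp
  show ?thesis
  proof (rule pair_measure_eqI[symmetric])
    show "sigma_finite_measure (distr M borel X)"
      by (intro prob_space_imp_sigma_finite prob_space_distr) simp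
    show "sigma_finite_measure (distr M ?P ?V)"
      by (intro prob_space_imp_sigma_finite prob_space_distr) simp
    show "sets (distr M borel X \<Otimes>\<^sub>M distr M ?P ?V) = sets (distr M (borel \<Otimes>\<^sub>M ?P) (\<lambda>\<omega>. (X \<omega>, ?V \<omega>)))"
      by (simp cong: sets_pair_measure_cong)
    fix A B assume "A \<in> sets (distr M borel X)" "B \<in> sets (distr M ?P ?V)"
    then have A[measurable]: "A \<in> sets borel" and B[measurable]: "B \<in> sets ?P" by auto
    have "prob ((X -` A \<inter> space M) \<inter> (?V -` B \<inter> space M)) = prob (X -` A \<inter> space M) * prob (?V -` B \<inter> space M)"
      by (rule indep_setD[OF ind2]) (use A B in \<open>auto simp: E1_def intro!: sigma_sets.Basic\<close>)
    moreover have "(\<lambda>\<omega>. (X \<omega>, ?V \<omega>)) -` (A \<times> B) \<inter> space M = (X -` A \<inter> space M) \<inter> (?V -` B \<inter> space M)"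
      by auto
    moreover have "(\<lambda>\<omega>. (X \<omega>, ?V \<omega>)) \<in> M \<rightarrow>\<^sub>M borel \<Otimes>\<^sub>M ?P" by measurable
    ultimately show "emeasure (distr M borel X) A * emeasure (distr M ?P ?V) B =
       emeasure (distr M (borel \<Otimes>\<^sub>M ?P) (\<lambda>\<omega>. (X \<omega>, ?V \<omega>))) (A \<times> B)"
      by (simp add: emeasure_distr emeasure_eq_measure ennreal_mult'')
  qed
qed

subsection \<open>Gaussian integration by parts\<close>

text \<open>Integrate the derivative of \<open>std_normal_density x * f x\<close> over the line; the
  boundary terms vanish because \<open>f\<close> is bounded.\<close>

lemma std_normal_ibp:
  fixes f f' :: "real \<Rightarrow> real"
  assumes f: "\<And>x. (f has_real_derivative f' x) (at x)" and c: "continuous_on UNIV f'"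
    and b: "\<And>x. \<bar>f x\<bar> \<le> B" "\<And>x. \<bar>f' x\<bar> \<le> B'"
  shows "(LINT x|std_normal_distribution. x * f x) = (LINT x|std_normal_distribution. f' x)"
proof -
  have [measurable]: "f \<in> borel_measurable borel"
    using f by (intro borel_measurable_continuous_onI) (auto intro!: continuous_at_imp_continuous_on DERIV_isCont)
  have [measurable]: "f' \<in> borel_measurable borel"
    using c by (intro borel_measurable_continuous_onI)
  have i1: "integrable lborel (\<lambda>x. std_normal_density x * (x * f x))"
  proof (rule Bochner_Integration.integrable_bound)
    show "integrable lborel (\<lambda>x. B * (std_normal_density x * \<bar>x\<bar>^1))"
      using integrable_std_normal_moment_abs[of 1] by simp
    have "\<bar>std_normal_density x * (x * f x)\<bar> \<le> std_normal_density x * (\<bar>x\<bar> * B)" for x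
      unfolding abs_mult using b(1)[of x] by (auto intro!: mult_left_mono)
    then show "AE x in lborel. norm (std_normal_density x * (x * f x)) \<le> norm (B * (std_normal_density x * \<bar>x\<bar>^1))"
      by (intro AE_I2) (simp add: mult_ac order_trans[OF _ abs_ge_self])
  qed simp
  have i2: "integrable lborel (\<lambda>x. std_normal_density x * f' x)"
    by (rule Bochner_Integration.integrable_bound[of _ "\<lambda>x. B' * std_normal_density x"])
       (use b in \<open>auto simp: abs_mult mult.commute intro!: mult_right_mono order_trans[OF _ abs_ge_self]\<close>)
  have d: "((\<lambda>x. std_normal_density x * f x) has_real_derivative
      (std_normal_density x * f' x - std_normal_density x * (x * f x))) (at x)" for x
  proof -
    have "(std_normal_density has_real_derivative - (x * std_normal_density x)) (at x)"
    proof -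
      have "((\<lambda>x. c * exp (- x\<^sup>2 / 2)) has_real_derivative - (x * (c * exp (- x\<^sup>2 / 2)))) (at x)" for c :: real
        by (auto intro!: derivative_eq_intros)
      then show ?thesis unfolding std_normal_density_def by blast
    qed
    from DERIV_mult[OF this f] show ?thesis by (simp add: algebra_simps)
  qed
  have lim0: "(std_normal_density \<longlongrightarrow> 0) at_top" "(std_normal_density \<longlongrightarrow> 0) at_bot"
  proof -
    have "filterlim (\<lambda>x::real. x^2 / 2) at_top at_top"
    proof (rule filterlim_at_top_mono[OF filterlim_ident])
      have "x \<le> x^2 / 2" if "2 \<le> x" for x :: real using mult_right_mono[OF that, of x] that by (simp add: power2_eq_square)
      then show "eventually (\<lambda>x::real. x \<le> x^2 / 2) at_top" by (rule eventually_mono[OF eventually_ge_at_top[of 2]])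
    qed
    then have t: "((\<lambda>x::real. exp (- (x^2 / 2))) \<longlongrightarrow> 0) at_top"
      by (intro filterlim_compose[OF exp_at_bot]) (simp add: filterlim_uminus_at_bot)
    moreover from t have "((\<lambda>x::real. exp (- (x^2 / 2))) \<longlongrightarrow> 0) at_bot"
      by (simp add: filterlim_at_bot_mirror)
    ultimately show "(std_normal_density \<longlongrightarrow> 0) at_top" "(std_normal_density \<longlongrightarrow> 0) at_bot"
      unfolding std_normal_density_def by (simp_all add: tendsto_divide_zero)
  qed
  have lim: "((\<lambda>x. std_normal_density x * f x) \<longlongrightarrow> 0) F" if "(std_normal_density \<longlongrightarrow> 0) F" for F
    by (rule Lim_null_comparison[where g="\<lambda>x. std_normal_density x * B"])
       (use b tendsto_mult_right[OF that, of B] in \<open>auto simp: abs_mult intro!: always_eventually mult_left_mono\<close>)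
  have "(LBINT x=-\<infinity>..\<infinity>. std_normal_density x * f' x - std_normal_density x * (x * f x)) = 0 - 0"
  proof (rule interval_integral_FTC_integrable[where F="\<lambda>x. std_normal_density x * f x"])
    show "((\<lambda>x. std_normal_density x * f x) has_vector_derivative
      (std_normal_density x * f' x - std_normal_density x * (x * f x))) (at x)" for x
      using d has_real_derivative_iff_has_vector_derivative by blast
    have "continuous_on UNIV f" using f by (auto intro!: continuous_at_imp_continuous_on DERIV_isCont)
    then have "continuous_on UNIV (\<lambda>x. std_normal_density x * f' x - std_normal_density x * (x * f x))"
      unfolding std_normal_density_def using c by (intro continuous_intros) auto
    then show "isCont (\<lambda>x. std_normal_density x * f' x - std_normal_density x * (x * f x)) x" for x
      by (simp add: continuous_on_eq_continuous_at)
    show "set_integrable lborel (einterval (-\<infinity>) \<infinity>) (\<lambda>x. std_normal_density x * f' x - std_normal_density x * (x * f x))"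
      using i1 i2 by (simp add: set_integrable_def einterval_def)
    show "(((\<lambda>x. std_normal_density x * f x) \<circ> real_of_ereal) \<longlongrightarrow> 0) (at_right (-\<infinity>))"
      using lim[OF lim0(2)] by (simp add: ereal_tendsto_simps)
    show "(((\<lambda>x. std_normal_density x * f x) \<circ> real_of_ereal) \<longlongrightarrow> 0) (at_left \<infinity>)"
      using lim[OF lim0(1)] by (simp add: ereal_tendsto_simps)
  qed simp
  then have "(LINT x|lborel. std_normal_density x * f' x) = (LINT x|lborel. std_normal_density x * (x * f x))"
    using i1 i2 by (simp add: interval_lebesgue_integral_def einterval_def set_lebesgue_integral_def)
  then show ?thesis
    by (simp add: integral_density mult.commute mult.left_commute)
qed

text \<open>The mean value inequality on the whole interval bounds every difference quotient by
  \<open>B\<close>, so dominated convergence applies along each sequence tending to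
  \<open>t\<close>.\<close>

lemma (in prob_space) has_derivative_expectation:
  fixes F F' :: "real \<Rightarrow> 'a \<Rightarrow> real"
  assumes t: "a < t" "t < b"
    and F: "\<And>s. s \<in> {a<..<b} \<Longrightarrow> integrable M (F s)"
    and F'm: "F' t \<in> borel_measurable M"
    and D: "\<And>s \<omega>. s \<in> {a<..<b} \<Longrightarrow> ((\<lambda>s. F s \<omega>) has_real_derivative F' s \<omega>) (at s)"
    and B: "integrable M B" "\<And>s \<omega>. s \<in> {a<..<b} \<Longrightarrow> \<bar>F' s \<omega>\<bar> \<le> B \<omega>"
  shows "((\<lambda>s. LINT \<omega>|M. F s \<omega>) has_real_derivative (LINT \<omega>|M. F' t \<omega>)) (at t)"
proof -
  have "((\<lambda>s. ((LINT \<omega>|M. F s \<omega>) - (LINT \<omega>|M. F t \<omega>)) / (s - t)) \<longlongrightarrow> (LINT \<omega>|M. F' t \<omega>)) (at t within {a<..<b})"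
  proof (rule tendsto_at_iff_sequentially[THEN iffD2], intro allI impI)
    fix X assume X: "\<forall>i. X i \<in> {a<..<b} - {t}" "X \<longlonglongrightarrow> t"
    have e: "((LINT \<omega>|M. F (X i) \<omega>) - (LINT \<omega>|M. F t \<omega>)) / (X i - t) = (LINT \<omega>|M. (F (X i) \<omega> - F t \<omega>) / (X i - t))" for i
      using F[of "X i"] F[of t] X(1) t by (auto simp: Bochner_Integration.integral_diff)
    have "(\<lambda>i. (LINT \<omega>|M. (F (X i) \<omega> - F t \<omega>) / (X i - t))) \<longlonglongrightarrow> (LINT \<omega>|M. F' t \<omega>)"
    proof (rule integral_dominated_convergence[where w=B])
      show "(\<lambda>\<omega>. (F (X i) \<omega> - F t \<omega>) / (X i - t)) \<in> borel_measurable M" for i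
        using F[of "X i"] F[of t] X(1) t by auto
      show "AE \<omega> in M. (\<lambda>i. (F (X i) \<omega> - F t \<omega>) / (X i - t)) \<longlonglongrightarrow> F' t \<omega>"
      proof (intro AE_I2)
        fix \<omega>
        have "((\<lambda>s. (F s \<omega> - F t \<omega>) / (s - t)) \<longlongrightarrow> F' t \<omega>) (at t)"
          using D[of t \<omega>] t by (simp add: has_field_derivative_iff)
        then show "(\<lambda>i. (F (X i) \<omega> - F t \<omega>) / (X i - t)) \<longlonglongrightarrow> F' t \<omega>"
          using X by (auto simp: tendsto_at_iff_sequentially o_def)
      qed
      show "AE \<omega> in M. norm ((F (X i) \<omega> - F t \<omega>) / (X i - t)) \<le> B \<omega>" for i
      proof (intro AE_I2)
        fix \<omega>
        have "norm (F (X i) \<omega> - F t \<omega>) \<le> B \<omega> * norm (X i - t)"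
        proof (rule field_differentiable_bound[where S="{a<..<b}" and f'="\<lambda>s. F' s \<omega>"])
          show "((\<lambda>s. F s \<omega>) has_field_derivative F' s \<omega>) (at s within {a<..<b})" if "s \<in> {a<..<b}" for s
            using D[OF that] has_field_derivative_at_within by blast
        qed (use X t B in auto)
        then show "norm ((F (X i) \<omega> - F t \<omega>) / (X i - t)) \<le> B \<omega>"
          using X(1) by (auto simp: divide_simps)
      qed
    qed (use B F'm in auto)
    then show "((\<lambda>s. ((LINT \<omega>|M. F s \<omega>) - (LINT \<omega>|M. F t \<omega>)) / (s - t)) \<circ> X) \<longlonglongrightarrow> (LINT \<omega>|M. F' t \<omega>)"
      by (simp add: o_def e)
  qed
  then show ?thesis
    using t by (simp add: has_field_derivative_iff at_within_open[of t "{a<..<b}"])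
qed

lemma (in prob_space) centered_gaussianD:
  assumes "centered_gaussian M v X"
  shows "0 \<le> v" "X \<in> borel_measurable M"
    and centered_gaussian_char: "\<And>s. (CLINT \<omega>|M. iexp (s * X \<omega>)) = of_real (exp (- (v * s\<^sup>2) / 2))"
    and centered_gaussian_integral: "\<And>f :: real \<Rightarrow> real. f \<in> borel_measurable borel \<Longrightarrow>
       (LINT \<omega>|M. f (X \<omega>)) = (LINT x|std_normal_distribution. f (sqrt v * x))"
    and centered_gaussian_nn_integral: "\<And>f :: real \<Rightarrow> ennreal. f \<in> borel_measurable borel \<Longrightarrow>
       (\<integral>\<^sup>+\<omega>. f (X \<omega>) \<partial>M) = (\<integral>\<^sup>+x. f (sqrt v * x) \<partial>std_normal_distribution)"
    and centered_gaussian_square: "integrable M (\<lambda>\<omega>. (X \<omega>)\<^sup>2)" "(LINT \<omega>|M. (X \<omega>)\<^sup>2) = v"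
    and centered_gaussian_mean: "integrable M X" "(LINT \<omega>|M. X \<omega>) = 0"
proof -
  show v: "0 \<le> v" and X[measurable]: "X \<in> borel_measurable M" using assms unfolding centered_gaussian_def by auto
  have d: "distr M borel X = distr std_normal_distribution borel (\<lambda>x. sqrt v * x)"
    using assms unfolding centered_gaussian_def by auto
  have tr: "(LINT \<omega>|M. f (X \<omega>)) = (LINT x|std_normal_distribution. f (sqrt v * x))"
    if [measurable]: "f \<in> borel_measurable borel" for f :: "real \<Rightarrow> 'b::{banach,second_countable_topology}"
  proof -
    have "(LINT \<omega>|M. f (X \<omega>)) = (LINT x|distr M borel X. f x)" by (subst integral_distr) auto
    also have "\<dots> = (LINT x|std_normal_distribution. f (sqrt v * x))" unfolding d by (subst integral_distr) auto
    finally show ?thesis .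
  qed
  show "(LINT \<omega>|M. f (X \<omega>)) = (LINT x|std_normal_distribution. f (sqrt v * x))"
    if [measurable]: "f \<in> borel_measurable borel" for f :: "real \<Rightarrow> real" by (rule tr) simp
  show nn: "(\<integral>\<^sup>+\<omega>. f (X \<omega>) \<partial>M) = (\<integral>\<^sup>+x. f (sqrt v * x) \<partial>std_normal_distribution)"
    if [measurable]: "f \<in> borel_measurable borel" for f :: "real \<Rightarrow> ennreal"
  proof -
    have "(\<integral>\<^sup>+\<omega>. f (X \<omega>) \<partial>M) = (\<integral>\<^sup>+x. f x \<partial>distr M borel X)" by (subst nn_integral_distr) auto
    also have "\<dots> = (\<integral>\<^sup>+x. f (sqrt v * x) \<partial>std_normal_distribution)" unfolding d by (subst nn_integral_distr) auto
    finally show ?thesis .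
  qed
  have ii: "integrable M (\<lambda>\<omega>. f (X \<omega>)) \<longleftrightarrow> integrable std_normal_distribution (\<lambda>x. f (sqrt v * x))"
    if [measurable]: "f \<in> borel_measurable borel" for f :: "real \<Rightarrow> real"
  proof -
    have "integrable M (\<lambda>\<omega>. f (X \<omega>)) \<longleftrightarrow> integrable (distr M borel X) f" by (subst integrable_distr_eq) auto
    also have "\<dots> \<longleftrightarrow> integrable std_normal_distribution (\<lambda>x. f (sqrt v * x))" unfolding d by (subst integrable_distr_eq) auto
    finally show ?thesis .
  qed
  show "(CLINT \<omega>|M. iexp (s * X \<omega>)) = of_real (exp (- (v * s\<^sup>2) / 2))" for s
  proof -
    have "(CLINT \<omega>|M. iexp (s * X \<omega>)) = (CLINT x|std_normal_distribution. iexp (s * (sqrt v * x)))"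
      by (rule tr) simp
    also have "\<dots> = char std_normal_distribution (s * sqrt v)" unfolding char_def by (simp add: mult.assoc)
    also have "\<dots> = of_real (exp (- (v * s\<^sup>2) / 2))"
      unfolding char_std_normal_distribution using v by (simp add: power_mult_distrib mult.commute)
    finally show ?thesis .
  qed
  show "integrable M (\<lambda>\<omega>. (X \<omega>)\<^sup>2)"
    by (subst ii) (use integrable_std_normal_distribution_moment[of 2] in \<open>auto simp: power_mult_distrib\<close>)
  show "(LINT \<omega>|M. (X \<omega>)\<^sup>2) = v"
    by (subst tr) (use v std_normal_distribution_even_moments(1)[of 1] in \<open>auto simp: power_mult_distrib\<close>)
  show "integrable M X"
    using ii[of "\<lambda>x. x"] integrable_std_normal_distribution_moment[of 1] by auto
  show "(LINT \<omega>|M. X \<omega>) = 0"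
    using tr[of "\<lambda>x. x"] integral_std_normal_distribution_moment_odd[of 1] by auto
qed

lemma (in prob_space) centered_gaussian_charI:
  assumes [measurable]: "X \<in> borel_measurable M" and v: "0 \<le> v"
    and ch: "\<And>s. char (distr M borel X) s = of_real (exp (- (v * s\<^sup>2) / 2))"
  shows "centered_gaussian M v X"
proof -
  interpret S: prob_space std_normal_distribution by (intro prob_space_normal_density) auto
  have "distr M borel X = distr std_normal_distribution borel (\<lambda>x. sqrt v * x)"
  proof (rule Levy_uniqueness)
    show "real_distribution (distr M borel X)" by (rule real_distribution_distr) simp
    show "real_distribution (distr std_normal_distribution borel (\<lambda>x. sqrt v * x))"
      by (rule S.real_distribution_distr) simp
    show "char (distr M borel X) = char (distr std_normal_distribution borel (\<lambda>x. sqrt v * x))"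
    proof
      fix s
      have "char (distr std_normal_distribution borel (\<lambda>x. sqrt v * x)) s = char std_normal_distribution (s * sqrt v)"
        unfolding char_def by (subst integral_distr) (auto simp: mult.assoc)
      also have "\<dots> = of_real (exp (- (v * s\<^sup>2) / 2))"
        unfolding char_std_normal_distribution using v by (simp add: power_mult_distrib mult.commute)
      finally show "char (distr M borel X) s = char (distr std_normal_distribution borel (\<lambda>x. sqrt v * x)) s"
        using ch by simp
    qed
  qed
  then show ?thesis using v unfolding centered_gaussian_def by auto
qed

lemma (in prob_space) char_distr_eq:
  "X \<in> borel_measurable M \<Longrightarrow> char (distr M borel X) s = (CLINT \<omega>|M. iexp (s * X \<omega>))"
  unfolding char_def by (subst integral_distr) auto

text \<open>Completing the square turns the integrand into \<open>exp (c\<^sup>2 / 2)\<close> times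
  the normal density of mean \<open>c\<close>.\<close>

lemma nn_integral_exp_std_normal:
  "(\<integral>\<^sup>+x. ennreal (exp (c * x)) \<partial>std_normal_distribution) = ennreal (exp (c\<^sup>2 / 2))"
proof -
  have "(\<integral>\<^sup>+x. ennreal (exp (c * x)) \<partial>std_normal_distribution) =
    (\<integral>\<^sup>+x. ennreal (std_normal_density x) * ennreal (exp (c * x)) \<partial>lborel)"
    by (subst nn_integral_density) auto
  also have "\<dots> = (\<integral>\<^sup>+x. ennreal (exp (c\<^sup>2 / 2)) * ennreal (normal_density c 1 x) \<partial>lborel)"
  proof (intro nn_integral_cong)
    fix x :: real
    have "std_normal_density x * exp (c * x) = exp (c\<^sup>2 / 2) * normal_density c 1 x"
      unfolding std_normal_density_def normal_density_def
      by (simp add: exp_add[symmetric] field_simps power2_eq_square)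
    then show "ennreal (std_normal_density x) * ennreal (exp (c * x)) = ennreal (exp (c\<^sup>2 / 2)) * ennreal (normal_density c 1 x)"
      by (simp add: ennreal_mult[symmetric])
  qed
  also have "\<dots> = ennreal (exp (c\<^sup>2 / 2)) * (\<integral>\<^sup>+x. ennreal (normal_density c 1 x) \<partial>lborel)"
    by (rule nn_integral_cmult) simp
  also have "(\<integral>\<^sup>+x. ennreal (normal_density c 1 x) \<partial>lborel) = 1"
    using nn_integral_eq_integral[of lborel "normal_density c 1"] by simp
  finally show ?thesis by simp
qed

subsection \<open>The interpolation with finitely many weights\<close>

text \<open>The factorisation \<open>fac\<close> makes \<open>X\<close> independent of the vector
  \<open>V\<close>. Fubini then freezes the vector and leaves the one-dimensional formula.\<close>

lemma (in prob_space) gaussian_ibp: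
  fixes f f' :: "real \<Rightarrow> ('j \<Rightarrow> real) \<Rightarrow> real" and V :: "'j \<Rightarrow> 'a \<Rightarrow> real"
  assumes X: "centered_gaussian M v X" and J: "finite J"
    and V: "\<And>j. j \<in> J \<Longrightarrow> V j \<in> borel_measurable M"
    and fac: "\<And>s l. (CLINT \<omega>|M. iexp (s * X \<omega> + (\<Sum>j\<in>J. l j * V j \<omega>))) =
       (CLINT \<omega>|M. iexp (s * X \<omega>)) * (CLINT \<omega>|M. iexp (\<Sum>j\<in>J. l j * V j \<omega>))"
    and fm[measurable]: "(\<lambda>(x, w). f x w) \<in> borel_measurable (borel \<Otimes>\<^sub>M (\<Pi>\<^sub>M j\<in>J. borel))"
    and f'm[measurable]: "(\<lambda>(x, w). f' x w) \<in> borel_measurable (borel \<Otimes>\<^sub>M (\<Pi>\<^sub>M j\<in>J. borel))"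
    and D: "\<And>x w. ((\<lambda>x. f x w) has_real_derivative f' x w) (at x)"
    and c: "\<And>w. continuous_on UNIV (\<lambda>x. f' x w)"
    and b: "\<And>x w. \<bar>f x w\<bar> \<le> B" "\<And>x w. \<bar>f' x w\<bar> \<le> B'"
  shows "(LINT \<omega>|M. X \<omega> * f (X \<omega>) (\<lambda>j\<in>J. V j \<omega>)) = v * (LINT \<omega>|M. f' (X \<omega>) (\<lambda>j\<in>J. V j \<omega>))"
proof -
  note V[measurable]
  have Xm[measurable]: "X \<in> borel_measurable M" and v: "0 \<le> v" using centered_gaussianD[OF X] by auto
  let ?P = "\<Pi>\<^sub>M j\<in>J. (borel :: real measure)"
  let ?V = "\<lambda>\<omega>. \<lambda>j\<in>J. V j \<omega>"
  have mV[measurable]: "?V \<in> measurable M ?P" by (intro measurable_restrict V)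
  let ?X = "distr M borel X" and ?W = "distr M ?P ?V"
  have pair: "distr M (borel \<Otimes>\<^sub>M ?P) (\<lambda>\<omega>. (X \<omega>, ?V \<omega>)) = ?X \<Otimes>\<^sub>M ?W"
    by (rule distr_pair_of_char) (use J V fac in auto)
  interpret X: prob_space ?X by (rule prob_space_distr) simp
  interpret W: prob_space ?W by (rule prob_space_distr) simp
  interpret XW: pair_prob_space ?X ?W ..
  have tr: "(LINT \<omega>|M. g (X \<omega>) (?V \<omega>)) = (\<integral>w. (\<integral>x. g x w \<partial>?X) \<partial>?W)"
    if g[measurable]: "(\<lambda>(x, w). g x w) \<in> borel_measurable (borel \<Otimes>\<^sub>M ?P)"
      and i: "integrable M (\<lambda>\<omega>. g (X \<omega>) (?V \<omega>))" for g :: "real \<Rightarrow> ('j \<Rightarrow> real) \<Rightarrow> real"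
  proof -
    have "(LINT \<omega>|M. g (X \<omega>) (?V \<omega>)) = (LINT z|distr M (borel \<Otimes>\<^sub>M ?P) (\<lambda>\<omega>. (X \<omega>, ?V \<omega>)). (\<lambda>(x,w). g x w) z)"
      by (subst integral_distr) auto
    also have "\<dots> = (\<integral>z. (\<lambda>(x,w). g x w) z \<partial>(?X \<Otimes>\<^sub>M ?W))" unfolding pair ..
    also have "\<dots> = (\<integral>w. (\<integral>x. g x w \<partial>?X) \<partial>?W)"
    proof (rule XW.integral_snd[symmetric])
      have "integrable (distr M (borel \<Otimes>\<^sub>M ?P) (\<lambda>\<omega>. (X \<omega>, ?V \<omega>))) (\<lambda>(x,w). g x w)"
        by (subst integrable_distr_eq) (use i in auto)
      then show "integrable (?X \<Otimes>\<^sub>M ?W) (\<lambda>(x, y). g x y)" unfolding pair .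
    qed
    finally show ?thesis .
  qed
  have "(LINT \<omega>|M. X \<omega> * f (X \<omega>) (?V \<omega>)) = (\<integral>w. (\<integral>x. x * f x w \<partial>?X) \<partial>?W)"
  proof (rule tr)
    show "(\<lambda>(x, w). x * f x w) \<in> borel_measurable (borel \<Otimes>\<^sub>M ?P)" by measurable
    show "integrable M (\<lambda>\<omega>. X \<omega> * f (X \<omega>) (?V \<omega>))"
    proof (rule Bochner_Integration.integrable_bound)
      show "integrable M (\<lambda>\<omega>. B * X \<omega>)" using centered_gaussian_mean[OF X] by simp
      show "AE \<omega> in M. norm (X \<omega> * f (X \<omega>) (?V \<omega>)) \<le> norm (B * X \<omega>)"
      proof (intro AE_I2)
        fix \<omega>
        have "\<bar>f (X \<omega>) (?V \<omega>)\<bar> * \<bar>X \<omega>\<bar> \<le> \<bar>B\<bar> * \<bar>X \<omega>\<bar>"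
          using b(1)[of "X \<omega>" "?V \<omega>"] by (intro mult_right_mono) auto
        then show "norm (X \<omega> * f (X \<omega>) (?V \<omega>)) \<le> norm (B * X \<omega>)" by (simp add: abs_mult mult.commute)
      qed
    qed measurable
  qed
  also have "\<dots> = (\<integral>w. v * (\<integral>x. f' x w \<partial>?X) \<partial>?W)"
  proof (intro Bochner_Integration.integral_cong refl)
    fix w assume "w \<in> space ?W"
    then have w[measurable]: "w \<in> space ?P" by simp
    have m[measurable]: "(\<lambda>x. f x w) \<in> borel_measurable borel" "(\<lambda>x. f' x w) \<in> borel_measurable borel"
      using measurable_Pair1[OF fm w] measurable_Pair1[OF f'm w] by auto
    have "(\<integral>x. x * f x w \<partial>?X) = (LINT \<omega>|M. X \<omega> * f (X \<omega>) w)" by (subst integral_distr) auto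
    also have "\<dots> = (LINT x|std_normal_distribution. (sqrt v * x) * f (sqrt v * x) w)"
      by (subst centered_gaussian_integral[OF X]) auto
    \<comment> \<open>One factor \<open>sqrt v\<close> comes from \<open>X\<close>, a second one
      from the chain rule; together they give the variance \<open>v\<close>.\<close>
    also have "\<dots> = (LINT x|std_normal_distribution. x * (sqrt v * f (sqrt v * x) w))"
      by (simp add: mult_ac)
    also have "\<dots> = (LINT x|std_normal_distribution. v * f' (sqrt v * x) w)"
    proof (rule std_normal_ibp)
      fix x
      have "((\<lambda>x. f (sqrt v * x) w) has_real_derivative f' (sqrt v * x) w * sqrt v) (at x)"
        by (rule DERIV_chain2[OF D]) (auto intro!: derivative_eq_intros)
      then show "((\<lambda>x. sqrt v * f (sqrt v * x) w) has_real_derivative v * f' (sqrt v * x) w) (at x)"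
        by (rule DERIV_cong[OF DERIV_cmult[where c="sqrt v"]]) (use v in simp)
      show "\<bar>sqrt v * f (sqrt v * x) w\<bar> \<le> sqrt v * B" "\<bar>v * f' (sqrt v * x) w\<bar> \<le> v * B'"
        using b v by (auto simp: abs_mult intro!: mult_left_mono)
    next
      show "continuous_on UNIV (\<lambda>x. v * f' (sqrt v * x) w)"
        by (intro continuous_intros continuous_on_compose2[OF c]) auto
    qed
    also have "\<dots> = v * (LINT \<omega>|M. f' (X \<omega>) w)"
      by (subst centered_gaussian_integral[OF X]) auto
    also have "(LINT \<omega>|M. f' (X \<omega>) w) = (\<integral>x. f' x w \<partial>?X)" by (subst integral_distr) auto
    finally show "(\<integral>x. x * f x w \<partial>?X) = v * (\<integral>x. f' x w \<partial>?X)" .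
  qed
  also have "\<dots> = v * (\<integral>w. (\<integral>x. f' x w \<partial>?X) \<partial>?W)" by simp
  also have "(\<integral>w. (\<integral>x. f' x w \<partial>?X) \<partial>?W) = (LINT \<omega>|M. f' (X \<omega>) (?V \<omega>))"
    by (rule tr[symmetric]) (auto intro!: integrable_bounded[where B=B'] b)
  finally show ?thesis .
qed

section \<open>Gibbs weights on a finite set and their derivatives\<close>

definition gibbs_weight :: "'b set \<Rightarrow> ('b \<Rightarrow> real) \<Rightarrow> ('b \<Rightarrow> real) \<Rightarrow> 'b \<Rightarrow> real" where
  "gibbs_weight A w h a = w a * exp (h a) / (\<Sum>b\<in>A. w b * exp (h b))"

text \<open>All weights may vanish. Division by zero then makes every Gibbs weight 0, hence an
  inequality for their sum instead of an equation.\<close>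

lemma gibbs_weight_bounds:
  assumes "finite A" "\<And>a. a \<in> A \<Longrightarrow> 0 \<le> w a"
  shows "a \<in> A \<Longrightarrow> 0 \<le> gibbs_weight A w h a" "a \<in> A \<Longrightarrow> gibbs_weight A w h a \<le> 1"
    "(\<Sum>a\<in>A. gibbs_weight A w h a) \<le> 1"
proof -
  let ?Z = "\<Sum>b\<in>A. w b * exp (h b)"
  have Z: "0 \<le> ?Z" using assms by (auto intro!: sum_nonneg)
  show n: "0 \<le> gibbs_weight A w h a" if "a \<in> A" for a
    using that Z assms unfolding gibbs_weight_def by auto
  show s: "(\<Sum>a\<in>A. gibbs_weight A w h a) \<le> 1"
    unfolding gibbs_weight_def sum_divide_distrib[symmetric] by simp
  show "gibbs_weight A w h a \<le> 1" if "a \<in> A"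
    using member_le_sum[OF that _ assms(1), of "gibbs_weight A w h"] n s by (meson DiffD1 order_trans)
qed

lemma sum_weights_zero:
  assumes "finite A" "\<And>a. a \<in> A \<Longrightarrow> 0 \<le> w a" "(\<Sum>b\<in>A. w b * exp (h b :: real)) = 0" "a \<in> A"
  shows "w a = 0"
  using assms by (subst (asm) sum_nonneg_eq_0_iff) auto

text \<open>The logarithmic derivative is the slope \<open>h' a\<close> minus its Gibbs mean. If the
  normaliser vanishes at \<open>x\<close>, all weights vanish, so the function is identically 0 and
  the formula persists.\<close>

lemma has_derivative_gibbs_weight:
  assumes A: "finite A" and w: "\<And>a. a \<in> A \<Longrightarrow> 0 \<le> w a" and a: "a \<in> A"
    and h: "\<And>b. b \<in> A \<Longrightarrow> ((\<lambda>x. h x b) has_real_derivative h' b) (at x)"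
  shows "((\<lambda>x. gibbs_weight A w (h x) a) has_real_derivative
      gibbs_weight A w (h x) a * (h' a - (\<Sum>b\<in>A. h' b * gibbs_weight A w (h x) b))) (at x)"
proof (cases "(\<Sum>b\<in>A. w b * exp (h x b)) = 0")
  case True
  then have "w b = 0" if "b \<in> A" for b using sum_weights_zero[OF A w True that] by simp
  then show ?thesis using a unfolding gibbs_weight_def by simp
next
  case False
  define Z where "Z x = (\<Sum>b\<in>A. w b * exp (h x b))" for x
  have Z: "(Z has_real_derivative (\<Sum>b\<in>A. w b * (exp (h x b) * h' b))) (at x)"
    unfolding Z_def[abs_def] by (auto intro!: derivative_eq_intros h sum.cong simp: mult_ac)
  have N: "((\<lambda>x. w a * exp (h x a)) has_real_derivative w a * (exp (h x a) * h' a)) (at x)"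
    by (auto intro!: derivative_eq_intros h a)
  have S: "(\<Sum>b\<in>A. h' b * (w b * exp (h x b) / Z x)) = (\<Sum>b\<in>A. w b * (exp (h x b) * h' b)) / Z x"
    unfolding sum_divide_distrib by (intro sum.cong refl) (simp add: mult_ac)
  have Zx: "Z x \<noteq> 0" using False unfolding Z_def .
  have "((\<lambda>x. w a * exp (h x a) / Z x) has_real_derivative
      w a * exp (h x a) / Z x * (h' a - (\<Sum>b\<in>A. h' b * (w b * exp (h x b) / Z x)))) (at x)"
    unfolding S by (rule DERIV_cong[OF DERIV_divide[OF N Z Zx]]) (use Zx in \<open>simp add: field_simps\<close>)
  then show ?thesis unfolding gibbs_weight_def Z_def .
qed

text \<open>For vanishing weights the logarithm is the constant \<open>ln 0\<close> and all Gibbs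
  weights are 0, so both sides still agree.\<close>

lemma has_derivative_ln_weights:
  assumes A: "finite A" and w: "\<And>a. a \<in> A \<Longrightarrow> 0 \<le> w a"
    and h: "\<And>b. b \<in> A \<Longrightarrow> ((\<lambda>x. h x b) has_real_derivative h' b) (at x)"
  shows "((\<lambda>x. ln (\<Sum>b\<in>A. w b * exp (h x b))) has_real_derivative
      (\<Sum>b\<in>A. h' b * gibbs_weight A w (h x) b)) (at x)"
proof (cases "(\<Sum>b\<in>A. w b * exp (h x b)) = 0")
  case True
  then have "w b = 0" if "b \<in> A" for b using sum_weights_zero[OF A w True that] by simp
  then show ?thesis unfolding gibbs_weight_def by simp
next
  case False
  moreover have "0 \<le> (\<Sum>b\<in>A. w b * exp (h x b))" using w by (auto intro!: sum_nonneg)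
  ultimately have "0 < (\<Sum>b\<in>A. w b * exp (h x b))" by simp
  then show ?thesis unfolding gibbs_weight_def
    by (auto intro!: derivative_eq_intros h simp: sum_divide_distrib sum_distrib_left mult_ac)
qed

section \<open>Integration by parts in a linear space of Gaussian variables\<close>

locale gaussian_space = prob_space M for M :: "'a measure" +
  fixes G :: "('a \<Rightarrow> real) set"
  assumes zero: "(\<lambda>\<omega>. 0) \<in> G"
    and lin: "\<And>c L1 L2. L1 \<in> G \<Longrightarrow> L2 \<in> G \<Longrightarrow> (\<lambda>\<omega>. c * L1 \<omega> + L2 \<omega>) \<in> G"
    and gauss: "\<And>L. L \<in> G \<Longrightarrow> \<exists>v. centered_gaussian M v L"
begin

lemma centered: "L \<in> G \<Longrightarrow> centered_gaussian M (LINT \<omega>|M. (L \<omega>)\<^sup>2) L"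
  using gauss centered_gaussian_square(2) by blast

lemma G_measurable[measurable_dest]: "L \<in> G \<Longrightarrow> L \<in> borel_measurable M"
  using gauss centered_gaussianD by blast

lemma G_integrable: "L \<in> G \<Longrightarrow> integrable M L"
  using gauss centered_gaussian_mean by blast

lemma G_mult: "L \<in> G \<Longrightarrow> (\<lambda>\<omega>. c * L \<omega>) \<in> G"
  using lin[OF _ zero, of L c] by simp

lemma G_sum: "finite I \<Longrightarrow> (\<And>i. i \<in> I \<Longrightarrow> f i \<in> G) \<Longrightarrow> (\<lambda>\<omega>. \<Sum>i\<in>I. c i * f i \<omega>) \<in> G"
  by (induction I rule: finite_induct) (auto intro!: lin zero)

lemma G_prod_integrable: "L1 \<in> G \<Longrightarrow> L2 \<in> G \<Longrightarrow> integrable M (\<lambda>\<omega>. L1 \<omega> * L2 \<omega>)"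
proof (rule Bochner_Integration.integrable_bound)
  assume L: "L1 \<in> G" "L2 \<in> G"
  note [measurable] = G_measurable[OF L(1)] G_measurable[OF L(2)]
  show "integrable M (\<lambda>\<omega>. (L1 \<omega>)\<^sup>2 + (L2 \<omega>)\<^sup>2)"
    using centered_gaussian_square(1)[OF centered[OF L(1)]] centered_gaussian_square(1)[OF centered[OF L(2)]] by simp
  have "\<bar>x * y\<bar> \<le> x\<^sup>2 + y\<^sup>2" for x y :: real
  proof -
    have "2 * (\<bar>x\<bar> * \<bar>y\<bar>) \<le> x\<^sup>2 + y\<^sup>2" using sum_squares_bound[of "\<bar>x\<bar>" "\<bar>y\<bar>"] by simp
    moreover have "0 \<le> \<bar>x\<bar> * \<bar>y\<bar>" by simp
    ultimately show ?thesis unfolding abs_mult by linarith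
  qed
  then show "AE \<omega> in M. norm (L1 \<omega> * L2 \<omega>) \<le> norm ((L1 \<omega>)\<^sup>2 + (L2 \<omega>)\<^sup>2)" by auto
  show "(\<lambda>\<omega>. L1 \<omega> * L2 \<omega>) \<in> borel_measurable M" by measurable
qed

end

text \<open>Independence of the weights from the Gaussian space is phrased by characteristic
  functions, the form in which \<open>gaussian_ibp\<close> asks for it.\<close>

locale gaussian_weights = gaussian_space M G for M :: "'a measure" and G +
  fixes A :: "'b set" and W :: "'b \<Rightarrow> 'a \<Rightarrow> real"
  assumes A: "finite A" and W[measurable]: "\<And>a. a \<in> A \<Longrightarrow> W a \<in> borel_measurable M"
    and W0: "\<And>a \<omega>. a \<in> A \<Longrightarrow> 0 \<le> W a \<omega>"
    and ind: "\<And>L l. L \<in> G \<Longrightarrow> (CLINT \<omega>|M. iexp (L \<omega> + (\<Sum>a\<in>A. l a * W a \<omega>))) =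
       (CLINT \<omega>|M. iexp (L \<omega>)) * (CLINT \<omega>|M. iexp (\<Sum>a\<in>A. l a * W a \<omega>))"
begin

text \<open>Regression on \<open>X\<close>: write \<open>h b\<close> as \<open>d b * X + R b\<close>
  with \<open>R b\<close> uncorrelated with \<open>X\<close>. Then \<open>X\<close> is independent
  of the remainders and weights jointly, and the Gibbs weight is a function of \<open>X\<close> with
  these as parameters; its derivative in \<open>X\<close> times the variance of \<open>X\<close> is
  the integrand on the right.\<close>

lemma gibbs_ibp:
  assumes X: "X \<in> G" and h: "\<And>b. b \<in> A \<Longrightarrow> h b \<in> G" and a: "a \<in> A"
  defines "p \<equiv> \<lambda>b \<omega>. gibbs_weight A (\<lambda>b. W b \<omega>) (\<lambda>b. h b \<omega>) b"
  defines "c \<equiv> \<lambda>b. LINT \<omega>|M. X \<omega> * h b \<omega>"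
  shows "(LINT \<omega>|M. X \<omega> * p a \<omega>) = (LINT \<omega>|M. p a \<omega> * (c a - (\<Sum>b\<in>A. c b * p b \<omega>)))"
proof -
  have Xm[measurable]: "X \<in> borel_measurable M" using X by (rule G_measurable)
  have hm[measurable]: "h b \<in> borel_measurable M" if "b \<in> A" for b using h[OF that] by (rule G_measurable)
  have pm[measurable]: "p b \<in> borel_measurable M" if "b \<in> A" for b
    using that unfolding p_def gibbs_weight_def by measurable
  define v where "v = (LINT \<omega>|M. (X \<omega>)\<^sup>2)"
  have X': "centered_gaussian M v X" unfolding v_def using X by (rule centered)
  show ?thesis
  proof (cases "v = 0")
    \<comment> \<open>With variance 0, \<open>X\<close> is almost surely 0, so all covariances
      \<open>c b\<close> and both sides vanish.\<close>
    case True
    then have "AE \<omega> in M. (X \<omega>)\<^sup>2 = 0"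
      unfolding v_def by (subst integral_nonneg_eq_0_iff_AE[symmetric]) (use centered_gaussian_square(1)[OF X'] in auto)
    then have X0: "AE \<omega> in M. X \<omega> = 0" by simp
    then have "c b = 0" if "b \<in> A" for b
      unfolding c_def using that by (subst integral_cong_AE[of _ _ "\<lambda>_. 0"]) auto
    moreover have "(LINT \<omega>|M. X \<omega> * p a \<omega>) = 0"
      using X0 a by (subst integral_cong_AE[of _ _ "\<lambda>_. 0"]) auto
    ultimately show ?thesis using a by simp
  next
    case False
    then have v: "v > 0" using centered_gaussianD(1)[OF X'] by simp
    define d where "d b = c b / v" for b
    define R where "R b \<omega> = - d b * X \<omega> + h b \<omega>" for b \<omega>
    have R: "R b \<in> G" if "b \<in> A" for b
      using lin[OF X h[OF that], of "- d b"] unfolding R_def[abs_def] by simp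
    define V where "V = case_sum R W"
    let ?J = "A <+> A"
    have Vm: "V j \<in> borel_measurable M" if "j \<in> ?J" for j
      using that R G_measurable W unfolding V_def by auto
    have VJ: "(\<Sum>j\<in>?J. l j * V j \<omega>) = (\<Sum>b\<in>A. l (Inl b) * R b \<omega>) + (\<Sum>b\<in>A. l (Inr b) * W b \<omega>)" for l \<omega>
      using A by (subst sum.Plus) (auto simp: V_def)
    have fac: "(CLINT \<omega>|M. iexp (s * X \<omega> + (\<Sum>j\<in>?J. l j * V j \<omega>))) =
       (CLINT \<omega>|M. iexp (s * X \<omega>)) * (CLINT \<omega>|M. iexp (\<Sum>j\<in>?J. l j * V j \<omega>))" for s l
    proof -
      \<comment> \<open>\<open>U\<close> is the Gaussian part. It is uncorrelated with
        \<open>X\<close>, so variances add and the characteristic function of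
        \<open>s * X + U\<close> factorises; \<open>T\<close>, the part in the weights, is separated
        by \<open>ind\<close>.\<close>
      define U where "U \<omega> = (\<Sum>b\<in>A. l (Inl b) * R b \<omega>)" for \<omega>
      define T where "T \<omega> = (\<Sum>b\<in>A. l (Inr b) * W b \<omega>)" for \<omega>
      have U: "U \<in> G" unfolding U_def[abs_def] using A R by (rule G_sum)
      have L: "(\<lambda>\<omega>. s * X \<omega> + U \<omega>) \<in> G" using X U by (rule lin)
      have XR: "(LINT \<omega>|M. X \<omega> * R b \<omega>) = 0" if "b \<in> A" for b
      proof -
        have "(LINT \<omega>|M. X \<omega> * R b \<omega>) = (LINT \<omega>|M. X \<omega> * h b \<omega> - d b * (X \<omega>)\<^sup>2)"
          by (intro Bochner_Integration.integral_cong) (auto simp: R_def algebra_simps power2_eq_square)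
        also have "\<dots> = c b - d b * v"
          using G_prod_integrable[OF X h[OF that]] centered_gaussian_square(1)[OF X'] unfolding c_def v_def by simp
        finally show ?thesis using v by (simp add: d_def)
      qed
      have XU: "(LINT \<omega>|M. X \<omega> * U \<omega>) = 0"
      proof -
        have "(LINT \<omega>|M. X \<omega> * U \<omega>) = (LINT \<omega>|M. (\<Sum>b\<in>A. l (Inl b) * (X \<omega> * R b \<omega>)))"
          by (intro Bochner_Integration.integral_cong) (auto simp: U_def sum_distrib_left mult_ac)
        also have "\<dots> = (\<Sum>b\<in>A. l (Inl b) * (LINT \<omega>|M. X \<omega> * R b \<omega>))"
          using G_prod_integrable[OF X R] by (subst Bochner_Integration.integral_sum) auto
        finally show ?thesis using XR by simp
      qed
      define u where "u = (LINT \<omega>|M. (U \<omega>)\<^sup>2)"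
      have "(LINT \<omega>|M. (s * X \<omega> + U \<omega>)\<^sup>2) = (LINT \<omega>|M. s\<^sup>2 * (X \<omega>)\<^sup>2 + (U \<omega>)\<^sup>2 + 2 * s * (X \<omega> * U \<omega>))"
        by (intro Bochner_Integration.integral_cong) (auto simp: power2_eq_square algebra_simps)
      also have "\<dots> = s\<^sup>2 * v + u"
        using centered_gaussian_square(1)[OF X'] centered_gaussian_square(1)[OF centered[OF U]] G_prod_integrable[OF X U] XU
        unfolding v_def u_def by simp
      finally have var: "(LINT \<omega>|M. (s * X \<omega> + U \<omega>)\<^sup>2) = s\<^sup>2 * v + u" .
      have "(CLINT \<omega>|M. iexp (s * X \<omega> + U \<omega>)) = (CLINT \<omega>|M. iexp (s * X \<omega>)) * (CLINT \<omega>|M. iexp (U \<omega>))"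
        using centered_gaussian_char[OF centered[OF L], of 1] centered_gaussian_char[OF X', of s]
          centered_gaussian_char[OF centered[OF U], of 1]
        by (simp add: var u_def[symmetric] exp_add[symmetric] diff_divide_distrib mult.commute[of _ v] flip: of_real_mult)
      then have "(CLINT \<omega>|M. iexp (s * X \<omega> + U \<omega> + T \<omega>)) = (CLINT \<omega>|M. iexp (s * X \<omega>)) * (CLINT \<omega>|M. iexp (U \<omega> + T \<omega>))"
        using ind[OF L, of "\<lambda>b. l (Inr b)"] ind[OF U, of "\<lambda>b. l (Inr b)"] unfolding T_def by (simp add: mult.assoc)
      then show ?thesis unfolding VJ U_def T_def by (simp add: add.assoc)
    qed
    \<comment> \<open>The absolute value keeps the weights nonnegative for arbitrary parameters
      \<open>w\<close>, where the derivative and the bounds must hold; on the values of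
      \<open>W\<close> it changes nothing.\<close>
    define q where "q b x w = gibbs_weight A (\<lambda>b. \<bar>w (Inr b)\<bar>) (\<lambda>b. d b * x + w (Inl b)) b" for b x and w :: "'b + 'b \<Rightarrow> real"
    define q' where "q' x w = q a x w * (d a - (\<Sum>b\<in>A. d b * q b x w))" for x w
    have qb: "0 \<le> q b x w" "q b x w \<le> 1" if "b \<in> A" for b x w
      unfolding q_def using gibbs_weight_bounds[OF A, of "\<lambda>b. \<bar>w (Inr b)\<bar>"] that by auto
    have comp[measurable]: "(\<lambda>z. snd z j) \<in> borel_measurable (borel \<Otimes>\<^sub>M (\<Pi>\<^sub>M j\<in>?J. borel))"
      if "j \<in> ?J" for j
      by (rule measurable_compose[OF measurable_snd measurable_component_singleton[OF that]])
    have qm[measurable]: "(\<lambda>z. q b (fst z) (snd z)) \<in> borel_measurable (borel \<Otimes>\<^sub>M (\<Pi>\<^sub>M j\<in>?J. borel))" if "b \<in> A" for b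
    proof -
      have em: "(\<lambda>z. exp (d b * fst z + snd z (Inl b))) \<in> borel_measurable (borel \<Otimes>\<^sub>M (\<Pi>\<^sub>M j\<in>?J. borel))"
        if "b \<in> A" for b
        using comp[OF InlI[OF that]] by measurable
      show ?thesis
        unfolding q_def gibbs_weight_def using that
        by (intro borel_measurable_divide borel_measurable_sum borel_measurable_times borel_measurable_abs comp em) auto
    qed
    have e: "q b (X \<omega>) (\<lambda>j\<in>?J. V j \<omega>) = p b \<omega>" if "b \<in> A" for b \<omega>
      unfolding q_def p_def gibbs_weight_def using that W0
      by (auto simp: V_def R_def InlI InrI intro!: arg_cong2[where f="(/)"] sum.cong)
    have D: "((\<lambda>x. q b x w) has_real_derivative q b x w * (d b - (\<Sum>b\<in>A. d b * q b x w))) (at x)" if "b \<in> A" for x w b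
      unfolding q_def using A that
      by (intro has_derivative_gibbs_weight) (auto intro!: derivative_eq_intros)
    have "(LINT \<omega>|M. X \<omega> * q a (X \<omega>) (\<lambda>j\<in>?J. V j \<omega>)) = v * (LINT \<omega>|M. q' (X \<omega>) (\<lambda>j\<in>?J. V j \<omega>))"
    proof (rule gaussian_ibp[OF X' _ Vm fac])
      show "finite ?J" using A by simp
      show "(\<lambda>(x, w). q a x w) \<in> borel_measurable (borel \<Otimes>\<^sub>M (\<Pi>\<^sub>M j\<in>?J. borel))"
        using qm[OF a] by (simp add: case_prod_beta')
      show "(\<lambda>(x, w). q' x w) \<in> borel_measurable (borel \<Otimes>\<^sub>M (\<Pi>\<^sub>M j\<in>?J. borel))"
        unfolding q'_def case_prod_beta' using a qm
        by (intro borel_measurable_times borel_measurable_diff borel_measurable_sum borel_measurable_const) auto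
      show "((\<lambda>x. q a x w) has_real_derivative q' x w) (at x)" for x w
        unfolding q'_def using D[OF a] by simp
      have cq: "continuous_on UNIV (\<lambda>x. q b x w)" if "b \<in> A" for b w
        using D[OF that] by (auto intro!: continuous_at_imp_continuous_on DERIV_isCont)
      show "continuous_on UNIV (\<lambda>x. q' x w)" for w
        unfolding q'_def by (intro continuous_intros cq a)
      show "\<bar>q a x w\<bar> \<le> 1" for x w using qb[OF a, of x w] by simp
      show "\<bar>q' x w\<bar> \<le> \<bar>d a\<bar> + (\<Sum>b\<in>A. \<bar>d b\<bar>)" for x w
      proof -
        have "\<bar>\<Sum>b\<in>A. d b * q b x w\<bar> \<le> (\<Sum>b\<in>A. \<bar>d b\<bar>)"
          by (rule order_trans[OF sum_abs]) (auto intro!: sum_mono mult_left_le simp: abs_mult qb)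
        then have "\<bar>d a - (\<Sum>b\<in>A. d b * q b x w)\<bar> \<le> \<bar>d a\<bar> + (\<Sum>b\<in>A. \<bar>d b\<bar>)" by linarith
        then have "q a x w * \<bar>d a - (\<Sum>b\<in>A. d b * q b x w)\<bar> \<le> 1 * (\<bar>d a\<bar> + (\<Sum>b\<in>A. \<bar>d b\<bar>))"
          using qb[OF a] by (intro mult_mono) auto
        then show ?thesis unfolding q'_def abs_mult using qb(1)[OF a] by simp
      qed
    qed
    then have "(LINT \<omega>|M. X \<omega> * p a \<omega>) = (LINT \<omega>|M. v * (p a \<omega> * (d a - (\<Sum>b\<in>A. d b * p b \<omega>))))"
      using a by (simp add: q'_def e cong: sum.cong)
    also have "\<dots> = (LINT \<omega>|M. p a \<omega> * (c a - (\<Sum>b\<in>A. c b * p b \<omega>)))"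
      using v by (intro Bochner_Integration.integral_cong refl)
        (simp add: d_def algebra_simps sum_distrib_left)
    finally show ?thesis .
  qed
qed

text \<open>In the covariance of the pathwise derivative \<open>h'\<close> with \<open>h\<close>,
  the factors \<open>1 / sqrt t\<close> and \<open>sqrt t\<close> cancel (likewise for
  \<open>1 - t\<close>) and the mixed terms are 0, which leaves \<open>D a b / 2\<close>. Applying
  \<open>gibbs_ibp\<close> to each \<open>h' t a\<close> thus removes the singular factors.\<close>

lemma has_derivative_expectation_ln:
  assumes X: "\<And>a. a \<in> A \<Longrightarrow> X a \<in> G" and Y: "\<And>a. a \<in> A \<Longrightarrow> Y a \<in> G"
    and XY: "\<And>a b. a \<in> A \<Longrightarrow> b \<in> A \<Longrightarrow> (LINT \<omega>|M. X a \<omega> * Y b \<omega>) = 0"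
    and D: "\<And>a b. a \<in> A \<Longrightarrow> b \<in> A \<Longrightarrow> D a b = (LINT \<omega>|M. X a \<omega> * X b \<omega>) - (LINT \<omega>|M. Y a \<omega> * Y b \<omega>)"
    and t: "0 < t" "t < 1"
  defines "h \<equiv> \<lambda>t a \<omega>. sqrt t * X a \<omega> + sqrt (1 - t) * Y a \<omega>"
  defines "p \<equiv> \<lambda>a \<omega>. gibbs_weight A (\<lambda>b. W b \<omega>) (\<lambda>b. h t b \<omega>) a"
  assumes int: "\<And>t. 0 < t \<Longrightarrow> t < 1 \<Longrightarrow> integrable M (\<lambda>\<omega>. ln (\<Sum>a\<in>A. W a \<omega> * exp (h t a \<omega>)))"
  shows "((\<lambda>t. LINT \<omega>|M. ln (\<Sum>a\<in>A. W a \<omega> * exp (h t a \<omega>))) has_real_derivative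
      (LINT \<omega>|M. (1 / 2) * (\<Sum>a\<in>A. p a \<omega> * (D a a - (\<Sum>b\<in>A. D a b * p b \<omega>))))) (at t)"
proof -
  define h' where "h' s a \<omega> = X a \<omega> / (2 * sqrt s) - Y a \<omega> / (2 * sqrt (1 - s))" for s a \<omega>
  have Xm[measurable]: "X b \<in> borel_measurable M" if "b \<in> A" for b using X[OF that] by (rule G_measurable)
  have Ym[measurable]: "Y b \<in> borel_measurable M" if "b \<in> A" for b using Y[OF that] by (rule G_measurable)
  have hG: "h s a \<in> G" if "a \<in> A" for s a
    unfolding h_def by (intro lin G_mult X Y that)
  have h'G: "h' s a \<in> G" if "a \<in> A" for s a
    unfolding h'_def using lin[OF X[OF that] G_mult[OF Y[OF that], of "-1 / (2 * sqrt (1 - s))"], of "1 / (2 * sqrt s)"]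
    by (simp add: divide_simps)
  have hd: "((\<lambda>s. h s a \<omega>) has_real_derivative h' s a \<omega>) (at s)" if "0 < s" "s < 1" for s a \<omega>
    unfolding h_def h'_def using that
    by (auto intro!: derivative_eq_intros simp: divide_simps)
  have pm[measurable]: "p b \<in> borel_measurable M" if "b \<in> A" for b
    using that unfolding p_def h_def gibbs_weight_def by measurable
  have pb: "0 \<le> p a \<omega>" "p a \<omega> \<le> 1" if "a \<in> A" for a \<omega>
    unfolding p_def using gibbs_weight_bounds[OF A, of "\<lambda>b. W b \<omega>"] that W0 by auto
  have der: "((\<lambda>t. LINT \<omega>|M. ln (\<Sum>a\<in>A. W a \<omega> * exp (h t a \<omega>))) has_real_derivative
      (LINT \<omega>|M. (\<Sum>a\<in>A. h' t a \<omega> * gibbs_weight A (\<lambda>b. W b \<omega>) (\<lambda>b. h t b \<omega>) a))) (at t)"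
  \<comment> \<open>On this interval \<open>s\<close> exceeds \<open>t / 2\<close> and
    \<open>1 - s\<close> exceeds \<open>(1 - t) / 2\<close>, so the inverse square roots stay
    bounded.\<close>
  proof (rule has_derivative_expectation[where a="t/2" and b="(1+t)/2"
      and F'="\<lambda>t \<omega>. (\<Sum>a\<in>A. h' t a \<omega> * gibbs_weight A (\<lambda>b. W b \<omega>) (\<lambda>b. h t b \<omega>) a)"])
    show "t / 2 < t" "t < (1 + t) / 2" using t by auto
    show "integrable M (\<lambda>\<omega>. ln (\<Sum>a\<in>A. W a \<omega> * exp (h s a \<omega>)))" if "s \<in> {t / 2<..<(1 + t) / 2}" for s
      using that t by (intro int) auto
    show "(\<lambda>\<omega>. \<Sum>a\<in>A. h' t a \<omega> * gibbs_weight A (\<lambda>b. W b \<omega>) (\<lambda>b. h t b \<omega>) a) \<in> borel_measurable M"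
      using pm G_measurable[OF h'G] unfolding p_def by (intro borel_measurable_sum borel_measurable_times) auto
    show "integrable M (\<lambda>\<omega>. \<Sum>a\<in>A. \<bar>X a \<omega>\<bar> / (2 * sqrt (t / 2)) + \<bar>Y a \<omega>\<bar> / (2 * sqrt ((1 - t) / 2)))"
      by (intro Bochner_Integration.integrable_sum Bochner_Integration.integrable_add integrable_divide integrable_abs G_integrable X Y)
  next
    fix s \<omega> assume s: "s \<in> {t / 2<..<(1 + t) / 2}"
    then have s01: "0 < s" "s < 1" using t by auto
    show "((\<lambda>s. ln (\<Sum>a\<in>A. W a \<omega> * exp (h s a \<omega>))) has_real_derivative
         (\<Sum>a\<in>A. h' s a \<omega> * gibbs_weight A (\<lambda>b. W b \<omega>) (\<lambda>b. h s b \<omega>) a)) (at s)"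
      using A W0 hd[OF s01] by (intro has_derivative_ln_weights) auto
    have g: "\<bar>gibbs_weight A (\<lambda>b. W b \<omega>) (\<lambda>b. h s b \<omega>) a\<bar> \<le> 1" if "a \<in> A" for a
      using gibbs_weight_bounds(1,2)[OF A, of "\<lambda>b. W b \<omega>" a "\<lambda>b. h s b \<omega>"] that W0 by auto
    have "\<bar>h' s a \<omega>\<bar> \<le> \<bar>X a \<omega>\<bar> / (2 * sqrt (t / 2)) + \<bar>Y a \<omega>\<bar> / (2 * sqrt ((1 - t) / 2))" for a
    proof -
      have 1: "sqrt (t/2) \<le> sqrt s" "sqrt ((1-t)/2) \<le> sqrt (1 - s)" "0 < sqrt (t/2)" "0 < sqrt ((1-t)/2)" using s t by auto
      have "\<bar>h' s a \<omega>\<bar> \<le> \<bar>X a \<omega>\<bar> / (2 * sqrt s) + \<bar>Y a \<omega>\<bar> / (2 * sqrt (1 - s))"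
        unfolding h'_def using s01 by (auto intro!: order_trans[OF abs_triangle_ineq4])
      also have "\<dots> \<le> \<bar>X a \<omega>\<bar> / (2 * sqrt (t / 2)) + \<bar>Y a \<omega>\<bar> / (2 * sqrt ((1 - t) / 2))"
        using 1 by (intro add_mono divide_left_mono mult_pos_pos mult_left_mono) auto
      finally show ?thesis .
    qed
    then have "\<bar>h' s a \<omega> * gibbs_weight A (\<lambda>b. W b \<omega>) (\<lambda>b. h s b \<omega>) a\<bar> \<le>
        \<bar>X a \<omega>\<bar> / (2 * sqrt (t / 2)) + \<bar>Y a \<omega>\<bar> / (2 * sqrt ((1 - t) / 2))" if "a \<in> A" for a
      unfolding abs_mult by (rule order_trans[OF mult_left_le[OF g[OF that] abs_ge_zero]])
    then show "\<bar>\<Sum>a\<in>A. h' s a \<omega> * gibbs_weight A (\<lambda>b. W b \<omega>) (\<lambda>b. h s b \<omega>) a\<bar> \<le>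
        (\<Sum>a\<in>A. \<bar>X a \<omega>\<bar> / (2 * sqrt (t / 2)) + \<bar>Y a \<omega>\<bar> / (2 * sqrt ((1 - t) / 2)))"
      by (intro order_trans[OF sum_abs] sum_mono)
  qed
  have cov: "(LINT \<omega>|M. h' t a \<omega> * h t b \<omega>) = D a b / 2" if ab: "a \<in> A" "b \<in> A" for a b
  proof -
    have ints: "integrable M (\<lambda>\<omega>. X a \<omega> * X b \<omega>)" "integrable M (\<lambda>\<omega>. X a \<omega> * Y b \<omega>)"
      "integrable M (\<lambda>\<omega>. Y a \<omega> * X b \<omega>)" "integrable M (\<lambda>\<omega>. Y a \<omega> * Y b \<omega>)"
      using ab X Y G_prod_integrable by auto
    have YX: "(LINT \<omega>|M. Y a \<omega> * X b \<omega>) = 0" using XY[OF ab(2,1)] by (simp add: mult.commute)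
    have "(LINT \<omega>|M. h' t a \<omega> * h t b \<omega>) = (LINT \<omega>|M. (1/2) * (X a \<omega> * X b \<omega>) +
       (sqrt (1 - t) / (2 * sqrt t)) * (X a \<omega> * Y b \<omega>) - (sqrt t / (2 * sqrt (1 - t))) * (Y a \<omega> * X b \<omega>)
       - (1/2) * (Y a \<omega> * Y b \<omega>))"
    proof (intro Bochner_Integration.integral_cong refl)
      have alg: "(x / (2 * r) - y / (2 * r')) * (r * x' + r' * y') =
          (1/2) * (x * x') + (r' / (2 * r)) * (x * y') - (r / (2 * r')) * (y * x') - (1/2) * (y * y')"
        if "r \<noteq> 0" "r' \<noteq> 0" for r r' x x' y y' :: real
        using that by (simp add: field_simps)
      show "h' t a \<omega> * h t b \<omega> = (1/2) * (X a \<omega> * X b \<omega>) +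
         (sqrt (1 - t) / (2 * sqrt t)) * (X a \<omega> * Y b \<omega>) - (sqrt t / (2 * sqrt (1 - t))) * (Y a \<omega> * X b \<omega>)
         - (1/2) * (Y a \<omega> * Y b \<omega>)" for \<omega>
        unfolding h_def h'_def by (rule alg) (use t in auto)
    qed
    also have "\<dots> = D a b / 2"
      using ints XY[OF ab] YX D[OF ab] by (simp add: diff_divide_distrib)
    finally show ?thesis .
  qed
  have ia: "integrable M (\<lambda>\<omega>. h' t a \<omega> * p a \<omega>)" if "a \<in> A" for a
  proof (rule Bochner_Integration.integrable_bound)
    show "integrable M (h' t a)" using h'G[OF that] by (rule G_integrable)
    show "(\<lambda>\<omega>. h' t a \<omega> * p a \<omega>) \<in> borel_measurable M"
      using that G_measurable[OF h'G[OF that]] pm[OF that] by measurable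
    show "AE \<omega> in M. norm (h' t a \<omega> * p a \<omega>) \<le> norm (h' t a \<omega>)"
      using pb[OF that] by (auto simp: abs_mult intro!: mult_left_le)
  qed
  have ib: "integrable M (\<lambda>\<omega>. p a \<omega> * (D a a / 2 - (\<Sum>b\<in>A. D a b / 2 * p b \<omega>)))" if "a \<in> A" for a
  proof (rule integrable_bounded[where B="\<bar>D a a / 2\<bar> + (\<Sum>b\<in>A. \<bar>D a b / 2\<bar>)"])
    show "(\<lambda>\<omega>. p a \<omega> * (D a a / 2 - (\<Sum>b\<in>A. D a b / 2 * p b \<omega>))) \<in> borel_measurable M"
      using that pm by (intro borel_measurable_times borel_measurable_diff borel_measurable_sum borel_measurable_const) auto
    fix \<omega>
    have "\<bar>\<Sum>b\<in>A. D a b / 2 * p b \<omega>\<bar> \<le> (\<Sum>b\<in>A. \<bar>D a b / 2\<bar>)"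
      by (rule order_trans[OF sum_abs]) (auto intro!: sum_mono mult_left_le simp: abs_mult pb)
    then have "\<bar>D a a / 2 - (\<Sum>b\<in>A. D a b / 2 * p b \<omega>)\<bar> \<le> \<bar>D a a / 2\<bar> + (\<Sum>b\<in>A. \<bar>D a b / 2\<bar>)" by linarith
    then have "p a \<omega> * \<bar>D a a / 2 - (\<Sum>b\<in>A. D a b / 2 * p b \<omega>)\<bar> \<le> 1 * (\<bar>D a a / 2\<bar> + (\<Sum>b\<in>A. \<bar>D a b / 2\<bar>))"
      using pb[OF that] by (intro mult_mono) auto
    then show "norm (p a \<omega> * (D a a / 2 - (\<Sum>b\<in>A. D a b / 2 * p b \<omega>))) \<le> \<bar>D a a / 2\<bar> + (\<Sum>b\<in>A. \<bar>D a b / 2\<bar>)"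
      using pb(1)[OF that] by (simp add: abs_mult)
  qed
  have "(LINT \<omega>|M. (\<Sum>a\<in>A. h' t a \<omega> * p a \<omega>)) = (\<Sum>a\<in>A. LINT \<omega>|M. h' t a \<omega> * p a \<omega>)"
    using ia by (rule Bochner_Integration.integral_sum)
  also have "\<dots> = (\<Sum>a\<in>A. LINT \<omega>|M. p a \<omega> * (D a a / 2 - (\<Sum>b\<in>A. D a b / 2 * p b \<omega>)))"
  proof (intro sum.cong refl)
    fix a assume a: "a \<in> A"
    show "(LINT \<omega>|M. h' t a \<omega> * p a \<omega>) = (LINT \<omega>|M. p a \<omega> * (D a a / 2 - (\<Sum>b\<in>A. D a b / 2 * p b \<omega>)))"
      using gibbs_ibp[where X="h' t a" and h="\<lambda>b. h t b", OF h'G[OF a] hG a] a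
      unfolding p_def by (simp add: cov cong: sum.cong)
  qed
  also have "\<dots> = (LINT \<omega>|M. (\<Sum>a\<in>A. p a \<omega> * (D a a / 2 - (\<Sum>b\<in>A. D a b / 2 * p b \<omega>))))"
    using ib by (rule Bochner_Integration.integral_sum[symmetric])
  also have "\<dots> = (LINT \<omega>|M. (1 / 2) * (\<Sum>a\<in>A. p a \<omega> * (D a a - (\<Sum>b\<in>A. D a b * p b \<omega>))))"
    by (intro Bochner_Integration.integral_cong refl)
       (simp add: sum_distrib_left right_diff_distrib mult_ac sum_divide_distrib diff_divide_distrib)
  finally have e: "(LINT \<omega>|M. (\<Sum>a\<in>A. h' t a \<omega> * p a \<omega>)) =
      (LINT \<omega>|M. (1 / 2) * (\<Sum>a\<in>A. p a \<omega> * (D a a - (\<Sum>b\<in>A. D a b * p b \<omega>))))" .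
  show ?thesis
    by (rule DERIV_cong[OF der]) (use e in \<open>simp only: p_def\<close>)
qed

end

subsection \<open>Independence of the sources\<close>

definition source_events ::
    "'a measure \<Rightarrow> nat \<Rightarrow> ((nat \<Rightarrow> real) \<Rightarrow> 'a \<Rightarrow> real) \<Rightarrow>
     (nat list \<Rightarrow> nat \<Rightarrow> 'a \<Rightarrow> real) \<Rightarrow> (nat list \<Rightarrow> 'a \<Rightarrow> real) \<Rightarrow> source \<Rightarrow> 'a set set" where
  "source_events M N H z u s = (case s of
     Disorder \<Rightarrow> generated_events M (spins N) H
   | Entry p i \<Rightarrow> generated_events M {i} (z p)
   | Points p \<Rightarrow> generated_events M UNIV (\<lambda>n. u (p @ [n])))"

text \<open>A measure space only in order to carry a sigma-algebra: measurability with respect to it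
  expresses that a function depends on the sources in \<open>P\<close> alone.\<close>

definition events_algebra :: "'a measure \<Rightarrow> ('i \<Rightarrow> 'a set set) \<Rightarrow> 'i set \<Rightarrow> 'a measure" where
  "events_algebra M E P = sigma (space M) (\<Union>i\<in>P. E i)"

lemma events_algebra_simps:
  assumes "\<And>i. i \<in> P \<Longrightarrow> E i \<subseteq> Pow (space M)"
  shows "space (events_algebra M E P) = space M"
    and "sets (events_algebra M E P) = sigma_sets (space M) (\<Union>i\<in>P. E i)"
  unfolding events_algebra_def using assms
  by (auto intro!: space_measure_of sets_measure_of)

text \<open>Grouping principle: intersection-stable independent families may be collected into
  disjoint groups, and the generated sigma-algebras remain independent.\<close>

lemma (in prob_space) indep_vars_of_sources:
  assumes ind: "indep_sets E I" and E: "\<And>i. i \<in> I \<Longrightarrow> Int_stable (E i)"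
    and P: "\<And>j. j \<in> J \<Longrightarrow> P j \<subseteq> I" "disjoint_family_on P J"
    and f: "\<And>j. j \<in> J \<Longrightarrow> f j \<in> measurable (events_algebra M E (P j)) (L j)"
  shows "indep_vars L f J"
proof -
  have Ee: "E i \<subseteq> events" if "i \<in> I" for i using ind that unfolding indep_sets_def by auto
  have sp: "space (events_algebra M E (P j)) = space M"
    "sets (events_algebra M E (P j)) = sigma_sets (space M) (\<Union>i\<in>P j. E i)" if "j \<in> J" for j
    using Ee P(1)[OF that] sets.space_closed
    by (intro events_algebra_simps; blast)+
  have sub: "sigma_sets (space M) (\<Union>i\<in>P j. E i) \<subseteq> events" if "j \<in> J" for j
    using Ee P(1)[OF that] by (intro sets.sigma_sets_subset) blast
  have "indep_sets (\<lambda>j. sigma_sets (space M) (\<Union>i\<in>P j. E i)) J"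
    by (rule indep_sets_collect_sigma)
       (use P E in \<open>auto intro!: indep_sets_mono_index[OF _ ind]\<close>)
  then have "indep_sets (\<lambda>j. {f j -` A \<inter> space M |A. A \<in> sets (L j)}) J"
    by (rule indep_sets_mono_sets) (use measurable_sets[OF f] sp in auto)
  moreover have "random_variable (L j) (f j)" if "j \<in> J" for j
  proof (rule measurableI)
    show "f j x \<in> space (L j)" if "x \<in> space M" for x
      using measurable_space[OF f[OF \<open>j \<in> J\<close>]] sp[OF \<open>j \<in> J\<close>] that by auto
    show "f j -` A \<inter> space M \<in> events" if "A \<in> sets (L j)" for A
      using measurable_sets[OF f[OF \<open>j \<in> J\<close>] that] sp[OF \<open>j \<in> J\<close>] sub[OF \<open>j \<in> J\<close>] by auto
  qed
  ultimately show ?thesis unfolding indep_vars_def2 by auto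
qed

lemma generated_events_Pow: "generated_events M I X \<subseteq> Pow (space M)"
  unfolding generated_events_def
  by (intro subsetI PowI sigma_sets_into_sp[rotated]) auto

lemma source_events_Pow: "source_events M N H z u s \<subseteq> Pow (space M)"
  unfolding source_events_def by (cases s) (simp_all add: generated_events_Pow)

lemma Int_stable_generated_events: "Int_stable (generated_events M I X)"
  unfolding generated_events_def
proof (rule Int_stableI)
  let ?S = "sigma_sets (space M) (\<Union>i\<in>I. {X i -` B \<inter> space M |B. B \<in> sets borel})"
  interpret sigma_algebra "space M" ?S by (rule sigma_algebra_sigma_sets) auto
  show "a \<inter> b \<in> ?S" if "a \<in> ?S" "b \<in> ?S" for a b using that by (rule Int)
qed

lemma Int_stable_source_events: "Int_stable (source_events M N H z u s)"
  unfolding source_events_def by (cases s) (simp_all add: Int_stable_generated_events)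

lemma measurable_source:
  fixes M :: "'a measure" and N :: nat and H :: "(nat \<Rightarrow> real) \<Rightarrow> 'a \<Rightarrow> real"
    and z :: "nat list \<Rightarrow> nat \<Rightarrow> 'a \<Rightarrow> real" and u :: "nat list \<Rightarrow> 'a \<Rightarrow> real"
  defines "alg \<equiv> events_algebra M (source_events M N H z u)"
  shows "Disorder \<in> P \<Longrightarrow> \<sigma> \<in> spins N \<Longrightarrow> H \<sigma> \<in> borel_measurable (alg P)"
    and "Entry p i \<in> P \<Longrightarrow> z p i \<in> borel_measurable (alg P)"
    and "Points p \<in> P \<Longrightarrow> u (p @ [n]) \<in> borel_measurable (alg P)"
proof -
  note alg = events_algebra_simps[of P "source_events M N H z u" M, OF source_events_Pow, folded alg_def]
  have *: "X \<in> borel_measurable (alg P)" if "s \<in> P" "\<And>B. B \<in> sets borel \<Longrightarrow> X -` B \<inter> space M \<in> source_events M N H z u s"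
    for X :: "'a \<Rightarrow> real" and s
    by (rule measurableI) (use that in \<open>auto simp: alg intro!: sigma_sets.Basic\<close>)
  show "Disorder \<in> P \<Longrightarrow> \<sigma> \<in> spins N \<Longrightarrow> H \<sigma> \<in> borel_measurable (alg P)"
    by (rule *[of Disorder]) (auto simp: source_events_def generated_events_def intro!: sigma_sets.Basic)
  show "Entry p i \<in> P \<Longrightarrow> z p i \<in> borel_measurable (alg P)"
    by (rule *[of "Entry p i"]) (auto simp: source_events_def generated_events_def intro!: sigma_sets.Basic)
  show "Points p \<in> P \<Longrightarrow> u (p @ [n]) \<in> borel_measurable (alg P)"
    by (rule *[of "Points p"]) (auto simp: source_events_def generated_events_def intro!: sigma_sets.Basic)
qed

subsection \<open>Poisson processes and moments of the cascade\<close>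

text \<open>On the unit interval \<open>x \<le> x powr c\<close>. Apply this to the shares
  \<open>a / (a + b)\<close> and \<open>b / (a + b)\<close>, which add up to 1.\<close>

lemma powr_add_le:
  fixes a b c :: real
  assumes "0 \<le> a" "0 \<le> b" "0 < c" "c \<le> 1"
  shows "(a + b) powr c \<le> a powr c + b powr c"
proof (cases "a + b = 0")
  case False
  then have s: "a + b > 0" using assms by simp
  have *: "x / (a + b) \<le> (x / (a + b)) powr c" if "0 \<le> x" "x \<le> a + b" for x
  proof (cases "x = 0")
    case False
    then have "(x / (a + b)) powr 1 \<le> (x / (a + b)) powr c"
      using that s assms by (intro powr_mono') auto
    then show ?thesis using that s False by simp
  qed simp
  have "1 = a / (a + b) + b / (a + b)" using s by (simp add: add_divide_distrib[symmetric])
  also have "\<dots> \<le> (a / (a + b)) powr c + (b / (a + b)) powr c"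
    using assms by (intro add_mono *) auto
  also have "\<dots> = (a powr c + b powr c) / (a + b) powr c"
    using assms s by (simp add: powr_divide add_divide_distrib)
  finally show ?thesis using s by (simp add: le_divide_eq)
qed (use assms in auto)

lemma powr_sum_le:
  fixes a :: "'i \<Rightarrow> real"
  assumes "finite F" "\<And>i. i \<in> F \<Longrightarrow> 0 \<le> a i" "0 < c" "c \<le> 1"
  shows "(\<Sum>i\<in>F. a i) powr c \<le> (\<Sum>i\<in>F. a i powr c)"
  using assms
proof (induction F rule: finite_induct)
  case (insert i F)
  have "(\<Sum>i\<in>insert i F. a i) powr c \<le> a i powr c + (\<Sum>i\<in>F. a i) powr c"
    using insert by (auto intro!: powr_add_le sum_nonneg)
  then show ?case using insert by fastforce
qed simp

lemma ennreal_le_suminf: "f i \<le> (\<Sum>j. f j)" for f :: "nat \<Rightarrow> ennreal"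
  using sum_le_suminf[OF summableI, of "{i}" f] by simp

lemma nn_integral_poisson_pmf:
  assumes "0 < r"
  shows "(\<integral>\<^sup>+n. ennreal (real n) \<partial>measure_pmf (poisson_pmf r)) = ennreal r"
proof -
  have "(\<lambda>n. r ^ n / fact n) sums exp r"
    using exp_converges[of r] by (simp add: divide_inverse mult.commute)
  then have s: "(\<lambda>n. (r * exp (- r)) * (r ^ n / fact n)) sums ((r * exp (- r)) * exp r)"
    by (rule sums_mult)
  define g where "g n = real n * pmf (poisson_pmf r) n" for n
  have "g (Suc n) = (r * exp (- r)) * (r ^ n / fact n)" for n
    unfolding g_def using assms by (simp add: field_simps del: of_nat_Suc)
  moreover have "(r * exp (- r)) * exp r = r" by (simp add: exp_minus)
  ultimately have "(\<lambda>n. g (Suc n)) sums r" using s by (simp only:)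
  then have gs: "g sums r" by (subst (asm) sums_Suc_iff) (simp add: g_def)
  have "(\<integral>\<^sup>+n. ennreal (real n) \<partial>measure_pmf (poisson_pmf r)) = (\<integral>\<^sup>+n. ennreal (g n) \<partial>count_space UNIV)"
    unfolding nn_integral_measure_pmf g_def by (simp add: ennreal_mult[symmetric] mult.commute)
  also have "\<dots> = (\<Sum>n. ennreal (g n))" by (rule nn_integral_count_space_nat)
  also have "\<dots> = ennreal r"
    by (rule suminf_ennreal_eq[OF _ gs]) (auto simp: g_def assms less_imp_le)
  finally show ?thesis .
qed

text \<open>Summing the probabilities gives the expected number of points in \<open>A\<close>, which
  is a Poisson mean. Intensity 0 is separate because the count is then only specified to vanish
  almost surely.\<close>

lemma (in prob_space) poisson_process_mean:
  assumes x: "decreasing_poisson_process M \<mu> x"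
    and A[measurable]: "A \<in> sets borel" and A0: "A \<subseteq> {0<..}" and fin: "emeasure \<mu> A < \<infinity>"
  shows "(\<Sum>n. \<integral>\<^sup>+\<omega>. indicator A (x n \<omega>) \<partial>M) = emeasure \<mu> A"
proof -
  have xm[measurable]: "x n \<in> borel_measurable M" for n
    using x unfolding decreasing_poisson_process_def by auto
  define C where "C \<omega> = card {n. x n \<omega> \<in> A}" for \<omega>
  have F: "AE \<omega> in M. finite {n. x n \<omega> \<in> A}" and P: "poisson_distributed M (measure \<mu> A) C"
    using x A A0 fin unfolding decreasing_poisson_process_def C_def[abs_def] by auto
  have Cm[measurable]: "C \<in> measurable M (count_space UNIV)" using P unfolding poisson_distributed_def by auto
  have "(\<Sum>n. \<integral>\<^sup>+\<omega>. indicator A (x n \<omega>) \<partial>M) = (\<integral>\<^sup>+\<omega>. (\<Sum>n. indicator A (x n \<omega>)) \<partial>M)"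
    by (rule nn_integral_suminf[symmetric]) measurable
  also have "\<dots> = (\<integral>\<^sup>+\<omega>. ennreal (real (C \<omega>)) \<partial>M)"
  proof (rule nn_integral_cong_AE)
    show "AE \<omega> in M. (\<Sum>n. indicator A (x n \<omega>)) = ennreal (real (C \<omega>))"
      using F
    proof eventually_elim
      case (elim \<omega>)
      have "(\<Sum>n. indicator A (x n \<omega>) :: ennreal) = (\<Sum>n\<in>{n. x n \<omega> \<in> A}. indicator A (x n \<omega>))"
        using elim by (rule suminf_finite) auto
      also have "\<dots> = (\<Sum>n\<in>{n. x n \<omega> \<in> A}. 1)" by (intro sum.cong) auto
      finally show ?case by (simp add: C_def ennreal_of_nat_eq_real_of_nat)
    qed
  qed
  also have "\<dots> = ennreal (measure \<mu> A)"
  proof (cases "measure \<mu> A = 0")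
    case True
    then have "AE \<omega> in M. C \<omega> = 0" using P unfolding poisson_distributed_def by auto
    then have "(\<integral>\<^sup>+\<omega>. ennreal (real (C \<omega>)) \<partial>M) = (\<integral>\<^sup>+\<omega>. 0 \<partial>M)"
      by (intro nn_integral_cong_AE) auto
    then show ?thesis using True by simp
  next
    case False
    then have "distr M (count_space UNIV) C = measure_pmf (poisson_pmf (measure \<mu> A))"
      using P unfolding poisson_distributed_def by auto
    moreover have "(\<integral>\<^sup>+\<omega>. ennreal (real (C \<omega>)) \<partial>M) = (\<integral>\<^sup>+n. ennreal (real n) \<partial>distr M (count_space UNIV) C)"
      by (subst nn_integral_distr) auto
    ultimately show ?thesis using False nn_integral_poisson_pmf[of "measure \<mu> A"] by (simp add: less_le)
  qed
  also have "\<dots> = emeasure \<mu> A" using fin by (simp add: emeasure_eq_ennreal_measure less_top)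
  finally show ?thesis .
qed

text \<open>For \<open>-1 \<le> m\<close> the density is nonincreasing, so its value at the left
  endpoint bounds it on the interval.\<close>

lemma emeasure_cascade_intensity_le:
  assumes "0 < a" "a \<le> b" "-1 \<le> m"
  shows "emeasure (cascade_intensity m) {a<..b} \<le> ennreal ((b - a) * a powr (- 1 - m))"
proof -
  have "emeasure (cascade_intensity m) {a<..b} =
      (\<integral>\<^sup>+x. ennreal (x powr (- 1 - m)) * indicator {0<..} x * indicator {a<..b} x \<partial>lborel)"
    unfolding cascade_intensity_def by (subst emeasure_density) auto
  also have "\<dots> \<le> (\<integral>\<^sup>+x. ennreal (a powr (- 1 - m)) * indicator {a<..b} x \<partial>lborel)"
    using assms by (intro nn_integral_mono) (auto simp: indicator_def intro!: ennreal_leI powr_mono2')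
  also have "\<dots> = ennreal (a powr (- 1 - m)) * ennreal (b - a)"
    using assms by (subst nn_integral_cmult_indicator) auto
  also have "\<dots> = ennreal ((b - a) * a powr (- 1 - m))"
    using assms by (subst ennreal_mult[symmetric]) (auto simp: mult.commute)
  finally show ?thesis .
qed

text \<open>An upper bound in the spirit of Campbell's formula: \<open>f\<close> is dominated by a
  sum of multiples of interval indicators, for which expected counts suffice. The absolute values
  are there because points are positive only almost surely.\<close>

lemma (in prob_space) poisson_process_sum_le:
  assumes x: "decreasing_poisson_process M (cascade_intensity m) x" and m: "-1 \<le> m"
    and f[measurable]: "f \<in> borel_measurable borel"
    and ab: "\<And>j. 0 < a j" "\<And>j. a j \<le> b j"
    and fle: "\<And>y. 0 < y \<Longrightarrow> f y \<le> (\<Sum>j. ennreal (c j) * indicator {a j<..b j} y)"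
    and c: "\<And>j. 0 \<le> c j" and s: "summable (\<lambda>j::nat. c j * ((b j - a j) * a j powr (- 1 - m)))"
  shows "(\<Sum>n. \<integral>\<^sup>+\<omega>. f \<bar>x n \<omega>\<bar> \<partial>M) \<le> ennreal (\<Sum>j. c j * ((b j - a j) * a j powr (- 1 - m)))"
proof -
  have xm[measurable]: "x n \<in> borel_measurable M" for n
    using x unfolding decreasing_poisson_process_def by auto
  have pos: "AE \<omega> in M. \<forall>n. 0 < x n \<omega>"
    using x unfolding decreasing_poisson_process_def by auto
  have "(\<Sum>n. \<integral>\<^sup>+\<omega>. f \<bar>x n \<omega>\<bar> \<partial>M) \<le> (\<Sum>n. \<integral>\<^sup>+\<omega>. (\<Sum>j. ennreal (c j) * indicator {a j<..b j} (x n \<omega>)) \<partial>M)"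
  proof (intro suminf_le summableI nn_integral_mono_AE)
    show "AE \<omega> in M. f \<bar>x n \<omega>\<bar> \<le> (\<Sum>j. ennreal (c j) * indicator {a j<..b j} (x n \<omega>))" for n
      using pos by eventually_elim (use fle in \<open>auto simp: abs_of_pos\<close>)
  qed
  also have "\<dots> = (\<Sum>n. \<Sum>j. ennreal (c j) * (\<integral>\<^sup>+\<omega>. indicator {a j<..b j} (x n \<omega>) \<partial>M))"
    by (intro suminf_cong) (simp add: nn_integral_suminf nn_integral_cmult)
  also have "\<dots> = (\<Sum>j. \<Sum>n. ennreal (c j) * (\<integral>\<^sup>+\<omega>. indicator {a j<..b j} (x n \<omega>) \<partial>M))"
    unfolding nn_integral_count_space_nat[symmetric]
    by (rule pair_sigma_finite.Fubini')
       (auto intro!: pair_sigma_finite.intro sigma_finite_measure_count_space)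
  also have "\<dots> = (\<Sum>j. ennreal (c j) * (\<Sum>n. \<integral>\<^sup>+\<omega>. indicator {a j<..b j} (x n \<omega>) \<partial>M))"
    by (intro suminf_cong) (simp add: ennreal_suminf_cmult)
  also have "\<dots> \<le> (\<Sum>j. ennreal (c j * ((b j - a j) * a j powr (- 1 - m))))"
  proof (intro suminf_le summableI)
    fix j
    have le: "emeasure (cascade_intensity m) {a j<..b j} \<le> ennreal ((b j - a j) * a j powr (- 1 - m))"
      using ab m by (intro emeasure_cascade_intensity_le) auto
    have "(\<Sum>n. \<integral>\<^sup>+\<omega>. indicator {a j<..b j} (x n \<omega>) \<partial>M) = emeasure (cascade_intensity m) {a j<..b j}"
      using ab(1)[of j] le by (intro poisson_process_mean[OF x]) (auto simp: le_less_trans)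
    then show "ennreal (c j) * (\<Sum>n. \<integral>\<^sup>+\<omega>. indicator {a j<..b j} (x n \<omega>) \<partial>M) \<le>
        ennreal (c j * ((b j - a j) * a j powr (- 1 - m)))"
      using le c ab by (subst ennreal_mult) (auto intro!: mult_left_mono)
  qed
  also have "\<dots> = ennreal (\<Sum>j. c j * ((b j - a j) * a j powr (- 1 - m)))"
    using s c ab by (intro suminf_ennreal_eq summable_sums) auto
  finally show ?thesis .
qed

text \<open>Dyadic decomposition of the unit interval. On the block ending at
  \<open>2 powr (- j)\<close> the function is at most \<open>2 powr (- j * c)\<close> and the
  intensity at most \<open>2 powr ((j + 1) * m)\<close>, so the block sums are geometric with ratio
  \<open>2 powr (m - c)\<close>.\<close>

lemma (in prob_space) poisson_process_small_points:
  assumes x: "decreasing_poisson_process M (cascade_intensity m) x" and m: "0 \<le> m" "m < c"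
  shows "(\<Sum>n. \<integral>\<^sup>+\<omega>. ennreal (if \<bar>x n \<omega>\<bar> \<le> 1 then \<bar>x n \<omega>\<bar> powr c else 0) \<partial>M) \<le>
     ennreal (\<Sum>j. 2 powr m * (2 powr (m - c)) ^ j)"
proof -
  let ?a = "\<lambda>j. 2 powr (- real (Suc j))" and ?b = "\<lambda>j. 2 powr (- real j)"
  let ?c = "\<lambda>j. 2 powr (- real j * c)"
  have e: "?c j * ((?b j - ?a j) * ?a j powr (- 1 - m)) = 2 powr m * (2 powr (m - c)) ^ j" for j
  proof -
    have "?b j = 2 * ?a j" by (simp add: powr_add[symmetric] powr_mult_base)
    then have "(?b j - ?a j) = ?a j" by simp
    then have "?c j * ((?b j - ?a j) * ?a j powr (- 1 - m)) =
        2 powr (- real j * c + (- real (Suc j) + (- real (Suc j)) * (- 1 - m)))"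
      by (simp only: powr_powr powr_add)
    also have "- real j * c + (- real (Suc j) + (- real (Suc j)) * (- 1 - m)) = m + real j * (m - c)"
      by (simp add: algebra_simps)
    also have "2 powr (m + real j * (m - c)) = 2 powr m * (2 powr (m - c)) ^ j"
      unfolding powr_add mult.commute[of "real j"] powr_powr[symmetric] by (simp add: powr_realpow)
    finally show ?thesis .
  qed
  have "(2::real) powr (m - c) < 1" using m by (simp add: powr_less_one)
  then have sm: "summable (\<lambda>j. 2 powr m * (2 powr (m - c)) ^ j)"
    by (intro summable_mult summable_geometric) auto
  show ?thesis
    unfolding e[symmetric]
  proof (rule poisson_process_sum_le[OF x, where f="\<lambda>y. ennreal (if y \<le> 1 then y powr c else 0)" and c="?c"])
    fix y :: real assume y: "0 < y"
    show "ennreal (if y \<le> 1 then y powr c else 0) \<le> (\<Sum>j. ennreal (?c j) * indicator {?a j<..?b j} y)"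
    proof (cases "y \<le> 1")
      case True
      \<comment> \<open>The blocks are open on the left and closed on the right, so the index is the
        floor of \<open>- log 2 y\<close>.\<close>
      define j where "j = nat \<lfloor>- log 2 y\<rfloor>"
      have l: "0 \<le> - log 2 y" using True y by simp
      then have j: "real j \<le> - log 2 y" "- log 2 y < real (Suc j)"
        unfolding j_def by linarith+
      have yy: "y = 2 powr (log 2 y)" using y by simp
      have in1: "?a j < y" "y \<le> ?b j" using j by (subst yy, simp)+
      have "y powr c \<le> ?b j powr c" using in1 y m by (intro powr_mono2) auto
      also have "\<dots> = ?c j" by (simp add: powr_powr)
      finally have "ennreal (if y \<le> 1 then y powr c else 0) \<le> ennreal (?c j) * indicator {?a j<..?b j} y"
        using True in1 by (auto intro: ennreal_leI)
      also have "\<dots> \<le> (\<Sum>j. ennreal (?c j) * indicator {?a j<..?b j} y)"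
        by (rule ennreal_le_suminf)
      finally show ?thesis .
    qed simp
  qed (use m sm e in auto)
qed

text \<open>The same blocks beyond 1: starting at \<open>2 powr j\<close>, the function is at most
  \<open>2 powr ((j + 1) * b)\<close> and the intensity at most \<open>2 powr (- j * m)\<close>, so
  the ratio is \<open>2 powr (b - m)\<close>.\<close>

lemma (in prob_space) poisson_process_large_points:
  assumes x: "decreasing_poisson_process M (cascade_intensity m) x" and m: "0 \<le> b" "b < m"
  shows "(\<Sum>n. \<integral>\<^sup>+\<omega>. ennreal (if \<bar>x n \<omega>\<bar> \<le> 1 then 0 else \<bar>x n \<omega>\<bar> powr b) \<partial>M) \<le>
     ennreal (\<Sum>j. 2 powr b * (2 powr (b - m)) ^ j)"
proof -
  let ?a = "\<lambda>j. 2 powr (real j)" and ?b = "\<lambda>j. 2 powr (real (Suc j))"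
  let ?c = "\<lambda>j. 2 powr (real (Suc j) * b)"
  have e: "?c j * ((?b j - ?a j) * ?a j powr (- 1 - m)) = 2 powr b * (2 powr (b - m)) ^ j" for j
  proof -
    have "?b j = 2 * ?a j" by (simp add: powr_add)
    then have "(?b j - ?a j) = ?a j" by simp
    then have "?c j * ((?b j - ?a j) * ?a j powr (- 1 - m)) =
        2 powr (real (Suc j) * b + (real j + real j * (- 1 - m)))"
      by (simp only: powr_powr powr_add)
    also have "real (Suc j) * b + (real j + real j * (- 1 - m)) = b + real j * (b - m)"
      by (simp add: algebra_simps)
    also have "2 powr (b + real j * (b - m)) = 2 powr b * (2 powr (b - m)) ^ j"
      unfolding powr_add mult.commute[of "real j"] powr_powr[symmetric] by (simp add: powr_realpow)
    finally show ?thesis .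
  qed
  have "(2::real) powr (b - m) < 1" using m by (simp add: powr_less_one)
  then have sm: "summable (\<lambda>j. 2 powr b * (2 powr (b - m)) ^ j)"
    by (intro summable_mult summable_geometric) auto
  show ?thesis
    unfolding e[symmetric]
  proof (rule poisson_process_sum_le[OF x, where f="\<lambda>y. ennreal (if y \<le> 1 then 0 else y powr b)" and c="?c"])
    fix y :: real assume y: "0 < y"
    show "ennreal (if y \<le> 1 then 0 else y powr b) \<le> (\<Sum>j. ennreal (?c j) * indicator {?a j<..?b j} y)"
    proof (cases "y \<le> 1")
      case False
      \<comment> \<open>With blocks closed on the right, the index below a positive logarithm is its
        ceiling minus 1, not its floor.\<close>
      define j where "j = nat (\<lceil>log 2 y\<rceil> - 1)"
      have l: "0 < log 2 y" using False by simp
      then have j: "real j < log 2 y" "log 2 y \<le> real (Suc j)"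
        unfolding j_def by linarith+
      have yy: "y = 2 powr (log 2 y)" using y by simp
      have in1: "?a j < y" "y \<le> ?b j" using j by (subst yy, simp)+
      have "y powr b \<le> ?b j powr b" using in1 y m by (intro powr_mono2) auto
      also have "\<dots> = ?c j" by (simp add: powr_powr)
      finally have "ennreal (if y \<le> 1 then 0 else y powr b) \<le> ennreal (?c j) * indicator {?a j<..?b j} y"
        using False in1 by (auto intro: ennreal_leI)
      also have "\<dots> \<le> (\<Sum>j. ennreal (?c j) * indicator {?a j<..?b j} y)"
        by (rule ennreal_le_suminf)
      finally show ?thesis .
    qed simp
  qed (use m sm e in auto)
qed

section \<open>The model and fractional moments of the subtree sums\<close>

locale interpolation_model = prob_space M for M :: "'a measure" +
  fixes N k :: nat and \<xi> :: "real \<Rightarrow> real" and m q :: "nat \<Rightarrow> real"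
    and H :: "(nat \<Rightarrow> real) \<Rightarrow> 'a \<Rightarrow> real"
    and z :: "nat list \<Rightarrow> nat \<Rightarrow> 'a \<Rightarrow> real" and u :: "nat list \<Rightarrow> 'a \<Rightarrow> real"
  assumes N: "N \<ge> 1" and k: "k \<ge> 1"
    and \<xi>'0: "deriv \<xi> 0 = 0"
    and m0: "m 0 = 0" and m_less: "\<And>l. l < k \<Longrightarrow> m l < m (l + 1)" and mk: "m k < 1"
    and q0: "q 0 = 0" and q1: "q (k + 1) = 1"
    and H_gaussian: "centered_gaussian_process M (spins N) H"
    and H_cov: "\<And>\<sigma>1 \<sigma>2. \<sigma>1 \<in> spins N \<Longrightarrow> \<sigma>2 \<in> spins N \<Longrightarrow>
           (\<integral>\<omega>. H \<sigma>1 \<omega> * H \<sigma>2 \<omega> \<partial>M) = real N * \<xi> (overlap N \<sigma>1 \<sigma>2)"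
    and z_gaussian: "\<And>p i. length p \<le> k \<Longrightarrow> i \<in> {1..N} \<Longrightarrow>
           centered_gaussian M (deriv \<xi> (q (length p + 1)) - deriv \<xi> (q (length p))) (z p i)"
    and u_poisson: "\<And>p. length p < k \<Longrightarrow>
           decreasing_poisson_process M (cascade_intensity (m (length p + 1))) (\<lambda>n. u (p @ [n]))"
    and sources: "independent_sources M N k H z u"
begin

abbreviation alg :: "source set \<Rightarrow> 'a measure" where
  "alg \<equiv> events_algebra M (source_events M N H z u)"

lemma indep_source_events: "indep_sets (source_events M N H z u) (sources N k)"
  using sources unfolding independent_sources_def source_events_def[abs_def] .

lemma indep_vars_model:
  assumes "\<And>j. j \<in> J \<Longrightarrow> P j \<subseteq> sources N k" "disjoint_family_on P J"
    and "\<And>j. j \<in> J \<Longrightarrow> f j \<in> measurable (alg (P j)) (L j)"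
  shows "indep_vars L f J"
  using indep_source_events Int_stable_source_events assms by (rule indep_vars_of_sources)

lemma nn_integral_indep:
  fixes f g :: "'a \<Rightarrow> ennreal"
  assumes "P \<subseteq> sources N k" "Q \<subseteq> sources N k" "P \<inter> Q = {}"
    and f: "f \<in> borel_measurable (alg P)" and g: "g \<in> borel_measurable (alg Q)"
  shows "(\<integral>\<^sup>+\<omega>. f \<omega> * g \<omega> \<partial>M) = (\<integral>\<^sup>+\<omega>. f \<omega> \<partial>M) * (\<integral>\<^sup>+\<omega>. g \<omega> \<partial>M)"
proof -
  have "indep_vars (\<lambda>_. borel) (\<lambda>b. if b then f else g) (UNIV :: bool set)"
    by (rule indep_vars_model[where P="\<lambda>b. if b then P else Q"])
       (use assms in \<open>auto simp: disjoint_family_on_def\<close>)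
  from indep_vars_nn_integral[OF _ this] show ?thesis
    by (simp add: UNIV_bool mult.commute)
qed

lemma measurable_alg_mono: "P \<subseteq> Q \<Longrightarrow> f \<in> measurable (alg P) L \<Longrightarrow> f \<in> measurable (alg Q) L"
  unfolding measurable_def events_algebra_simps[OF source_events_Pow]
  by (auto intro: sigma_sets_mono'[THEN subsetD, rotated])

lemma measurable_algD:
  assumes "P \<subseteq> sources N k" "f \<in> measurable (alg P) L" shows "f \<in> measurable M L"
proof -
  \<comment> \<open>Independence of a one-element family contains measurability with respect to
    \<open>M\<close>.\<close>
  have "indep_vars (\<lambda>_. L) (\<lambda>_. f) {()}"
    using assms by (intro indep_vars_model[where P="\<lambda>_. P"]) (auto simp: disjoint_family_on_def)
  then show ?thesis unfolding indep_vars_def2 by simp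
qed

lemma m_bounds: "l \<le> k \<Longrightarrow> 0 \<le> m l" "l \<le> k \<Longrightarrow> m l < 1" "1 \<le> l \<Longrightarrow> l \<le> k \<Longrightarrow> 0 < m l"
proof -
  have mono: "m i \<le> m j" if "i \<le> j" "j \<le> k" for i j
    using that by (induction j rule: dec_induct) (auto intro: order_trans[OF _ less_imp_le[OF m_less[simplified]]])
  show "l \<le> k \<Longrightarrow> 0 \<le> m l" "l \<le> k \<Longrightarrow> m l < 1"
    using mono[of 0 l] mono[of l k] m0 mk by auto
  show "1 \<le> l \<Longrightarrow> l \<le> k \<Longrightarrow> 0 < m l"
    using mono[of 1 l] m_less[of 0] m0 k by auto
qed

text \<open>Mass of the subtree of depth \<open>d\<close> below \<open>p\<close>, with only the
  first \<open>K\<close> children kept at every node. Absolute values make it nonnegative and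
  monotone in \<open>K\<close> at every \<omega>, whereas the points are positive only almost
  surely.\<close>

primrec subtree_sum :: "nat \<Rightarrow> nat \<Rightarrow> nat list \<Rightarrow> 'a \<Rightarrow> real" where
  "subtree_sum K 0 p \<omega> = 1"
| "subtree_sum K (Suc d) p \<omega> = (\<Sum>n<K. \<bar>u (p @ [n]) \<omega>\<bar> * subtree_sum K d (p @ [n]) \<omega>)"

lemma subtree_sum_nonneg: "0 \<le> subtree_sum K d p \<omega>"
  by (induction d arbitrary: p) (auto intro!: sum_nonneg)

lemma subtree_sum_mono: "K \<le> K' \<Longrightarrow> subtree_sum K d p \<omega> \<le> subtree_sum K' d p \<omega>"
proof (induction d arbitrary: p)
  case (Suc d)
  have "(\<Sum>n<K. \<bar>u (p @ [n]) \<omega>\<bar> * subtree_sum K d (p @ [n]) \<omega>) \<le> (\<Sum>n<K. \<bar>u (p @ [n]) \<omega>\<bar> * subtree_sum K' d (p @ [n]) \<omega>)"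
    using Suc by (intro sum_mono mult_left_mono) auto
  also have "\<dots> \<le> (\<Sum>n<K'. \<bar>u (p @ [n]) \<omega>\<bar> * subtree_sum K' d (p @ [n]) \<omega>)"
    using Suc.prems by (intro sum_mono2) (auto intro!: mult_nonneg_nonneg subtree_sum_nonneg)
  finally show ?case by simp
qed simp

text \<open>Only the point processes at \<open>p\<close> and below enter. Hence the subtree sum at a
  child is independent of the process attached to its parent, which lets moments factorise.\<close>

lemma subtree_sum_measurable:
  assumes "length p + d \<le> k"
  shows "subtree_sum K d p \<in> borel_measurable (alg {Points (p @ r) | r. length (p @ r) < k})"
  using assms
proof (induction d arbitrary: p)
  case (Suc d)
  have "u (p @ [n]) \<in> borel_measurable (alg {Points (p @ r) | r. length (p @ r) < k})" for n
    using Suc.prems by (intro measurable_source(3)) (auto intro!: exI[of _ "[]"])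
  moreover have "subtree_sum K d (p @ [n]) \<in> borel_measurable (alg {Points (p @ r) | r. length (p @ r) < k})" for n
    by (rule measurable_alg_mono[OF _ Suc.IH]) (use Suc.prems in auto)
  ultimately show ?case unfolding subtree_sum.simps[abs_def] by (intro borel_measurable_sum borel_measurable_times borel_measurable_abs)
next
  case 0
  have "subtree_sum K 0 p = (\<lambda>_. 1)" by auto
  then show ?case by simp
qed

text \<open>Splitting at 1 allows the use of different exponents on either side of the critical
  exponent \<open>m\<^sub>l\<close>: above it for the small points, below it for the finitely many large ones.\<close>

lemma subtree_sum_moment:
  fixes p0 :: "nat list"
  assumes "length p0 + d = k" "0 < b" "d > 0 \<Longrightarrow> b < m (length p0 + 1)"
  shows "\<exists>C<\<infinity>. \<forall>K p. length p = length p0 \<longrightarrow> (\<integral>\<^sup>+\<omega>. ennreal (subtree_sum K d p \<omega> powr b) \<partial>M) \<le> C"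
  using assms
proof (induction d arbitrary: p0 b)
  case 0
  show ?case by (intro exI[of _ 1]) (simp add: emeasure_space_1)
next
  case (Suc d)
  define l where "l = length p0"
  have lk: "l + Suc d = k" using Suc.prems(1) by (simp add: l_def)
  define m1 where "m1 = m (l + 1)"
  have b: "0 < b" "b < m1" using Suc.prems by (auto simp: m1_def l_def)
  have m1: "0 < m1" "m1 < 1" using m_bounds[of "l + 1"] lk by (auto simp: m1_def)
  \<comment> \<open>\<open>c\<close> must exceed \<open>m1\<close> for the small points to be
    summable, stay below the exponent of the next level for the induction hypothesis, and be at most
    1 for subadditivity. At \<open>d = 0\<close> the subtree sum is 1 and \<open>c = 1\<close> will
    do.\<close>
  obtain c where c: "m1 < c" "c \<le> 1" "d > 0 \<Longrightarrow> c < m (l + 2)"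
  proof (cases "d = 0")
    case True then show ?thesis using that[of 1] m1 by auto
  next
    case False
    then have "m1 < m (l + 2)" "m (l + 2) < 1"
      using m_less[of "l + 1"] m_bounds(2)[of "l + 2"] lk by (auto simp: m1_def)
    then show ?thesis using that[of "(m1 + m (l + 2)) / 2"] by (auto simp: field_simps)
  qed
  have IH: "\<exists>C<\<infinity>. \<forall>K p. length p = l + 1 \<longrightarrow> (\<integral>\<^sup>+\<omega>. ennreal (subtree_sum K d p \<omega> powr e) \<partial>M) \<le> C"
    if "0 < e" "e \<le> c" for e
  proof -
    \<comment> \<open>Only the length of a node matters, so the child with number 0 stands for its
      whole level.\<close>
    have "e < m (length (p0 @ [0]) + 1)" if "d > 0" using c(3)[OF that] \<open>e \<le> c\<close> by (simp add: l_def)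
    then have "\<exists>C<\<infinity>. \<forall>K p. length p = length (p0 @ [0]) \<longrightarrow> (\<integral>\<^sup>+\<omega>. ennreal (subtree_sum K d p \<omega> powr e) \<partial>M) \<le> C"
      using lk by (intro Suc.IH \<open>0 < e\<close>) (auto simp: l_def)
    then show ?thesis by (simp add: l_def)
  qed
  obtain C1 where C1: "C1 < \<infinity>" "\<And>K p. length p = l + 1 \<Longrightarrow> (\<integral>\<^sup>+\<omega>. ennreal (subtree_sum K d p \<omega> powr c) \<partial>M) \<le> C1"
    using IH[of c] c m1 by auto
  obtain C2 where C2: "C2 < \<infinity>" "\<And>K p. length p = l + 1 \<Longrightarrow> (\<integral>\<^sup>+\<omega>. ennreal (subtree_sum K d p \<omega> powr b) \<partial>M) \<le> C2"
    using IH[of b] b c by auto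
  define f where "f y = (if y \<le> 1 then y powr c else 0)" for y :: real
  define g where "g y = (if y \<le> 1 then 0 else y powr b)" for y :: real
  have [measurable]: "f \<in> borel_measurable borel" "g \<in> borel_measurable borel"
    unfolding f_def g_def by measurable
  define F where "F = ennreal (\<Sum>j. 2 powr m1 * (2 powr (m1 - c)) ^ j)"
  define G where "G = ennreal (\<Sum>j. 2 powr b * (2 powr (b - m1)) ^ j)"
  have bound: "(\<integral>\<^sup>+\<omega>. ennreal (subtree_sum K (Suc d) p \<omega> powr b) \<partial>M) \<le> 1 + F * C1 + G * C2"
    if p: "length p = l" for K p
  proof -
    let ?u = "\<lambda>n \<omega>. \<bar>u (p @ [n]) \<omega>\<bar>" and ?S = "\<lambda>n \<omega>. subtree_sum K d (p @ [n]) \<omega>"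
    let ?P = "{Points p}" and ?Q = "\<lambda>n. {Points ((p @ [n]) @ r) | r. length ((p @ [n]) @ r) < k}"
    have um: "u (p @ [n]) \<in> borel_measurable (alg ?P)" for n by (rule measurable_source) simp
    have Sm: "?S n \<in> borel_measurable (alg (?Q n))" for n
      by (rule subtree_sum_measurable) (use p lk in auto)
    have PQ: "?P \<subseteq> sources N k" "?Q n \<subseteq> sources N k" "?P \<inter> ?Q n = {}" for n
      using p lk by (auto simp: sources_def)
    note [measurable] = measurable_algD[OF PQ(1) um] measurable_algD[OF PQ(2) Sm]
    have pt: "subtree_sum K (Suc d) p \<omega> powr b \<le>
        1 + (\<Sum>n<K. f (?u n \<omega>) * ?S n \<omega> powr c) + (\<Sum>n<K. g (?u n \<omega>) * ?S n \<omega> powr b)" for \<omega>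
    proof -
      \<comment> \<open>\<open>A\<close> collects the points of size at most 1 and \<open>B\<close>
        the larger ones; \<open>A\<close> is raised to the power \<open>c\<close>, \<open>B\<close>
        to the power \<open>b\<close>.\<close>
      define A where "A = (\<Sum>n<K. if ?u n \<omega> \<le> 1 then ?u n \<omega> * ?S n \<omega> else 0)"
      define B where "B = (\<Sum>n<K. if ?u n \<omega> \<le> 1 then 0 else ?u n \<omega> * ?S n \<omega>)"
      have A0: "0 \<le> A" and B0: "0 \<le> B" unfolding A_def B_def
        by (auto intro!: sum_nonneg mult_nonneg_nonneg subtree_sum_nonneg)
      have "subtree_sum K (Suc d) p \<omega> = A + B"
        unfolding A_def B_def sum.distrib[symmetric] by (auto intro!: sum.cong)
      then have 1: "subtree_sum K (Suc d) p \<omega> powr b \<le> A powr b + B powr b"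
        using A0 B0 b m1 by (simp del: subtree_sum.simps add: powr_add_le)
      \<comment> \<open>Since \<open>b < c\<close>, the lower power is dominated by the higher one
        except on the unit interval, where it is at most 1.\<close>
      have 2: "A powr b \<le> 1 + A powr c"
      proof (cases "A \<le> 1")
        case True then have "A powr b \<le> 1" using A0 b by (intro powr_le1) auto
        then show ?thesis using powr_ge_zero[of A c] by linarith
      next
        case False then have "A powr b \<le> A powr c" using b c by (intro powr_mono) auto
        then show ?thesis by simp
      qed
      have "A powr c \<le> (\<Sum>n<K. (if ?u n \<omega> \<le> 1 then ?u n \<omega> * ?S n \<omega> else 0) powr c)"
        unfolding A_def using c m1 by (intro powr_sum_le) (auto intro!: mult_nonneg_nonneg subtree_sum_nonneg)
      also have "\<dots> = (\<Sum>n<K. f (?u n \<omega>) * ?S n \<omega> powr c)"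
        by (intro sum.cong) (auto simp: f_def powr_mult subtree_sum_nonneg)
      finally have 3: "A powr c \<le> (\<Sum>n<K. f (?u n \<omega>) * ?S n \<omega> powr c)" .
      have "B powr b \<le> (\<Sum>n<K. (if ?u n \<omega> \<le> 1 then 0 else ?u n \<omega> * ?S n \<omega>) powr b)"
        unfolding B_def using b m1 by (intro powr_sum_le) (auto intro!: mult_nonneg_nonneg subtree_sum_nonneg)
      also have "\<dots> = (\<Sum>n<K. g (?u n \<omega>) * ?S n \<omega> powr b)"
        by (intro sum.cong) (auto simp: g_def powr_mult subtree_sum_nonneg)
      finally show ?thesis using 1 2 3 by linarith
    qed
    have fg0: "0 \<le> f y" "0 \<le> g y" for y by (auto simp: f_def g_def)
    have e: "(\<integral>\<^sup>+\<omega>. ennreal (\<phi> (?u n \<omega>) * ?S n \<omega> powr e) \<partial>M) \<le> (\<integral>\<^sup>+\<omega>. ennreal (\<phi> (?u n \<omega>)) \<partial>M) * C"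
      if \<phi>[measurable]: "\<phi> \<in> borel_measurable borel" and \<phi>0: "\<And>y. 0 \<le> \<phi> y"
        and C: "(\<integral>\<^sup>+\<omega>. ennreal (?S n \<omega> powr e) \<partial>M) \<le> C" for \<phi> e C n
    proof -
      have "(\<integral>\<^sup>+\<omega>. ennreal (\<phi> (?u n \<omega>) * ?S n \<omega> powr e) \<partial>M) = (\<integral>\<^sup>+\<omega>. ennreal (\<phi> (?u n \<omega>)) * ennreal (?S n \<omega> powr e) \<partial>M)"
        using \<phi>0 by (simp add: ennreal_mult)
      also have "\<dots> = (\<integral>\<^sup>+\<omega>. ennreal (\<phi> (?u n \<omega>)) \<partial>M) * (\<integral>\<^sup>+\<omega>. ennreal (?S n \<omega> powr e) \<partial>M)"
      proof (rule nn_integral_indep[OF PQ])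
        show "(\<lambda>\<omega>. ennreal (\<phi> (?u n \<omega>))) \<in> borel_measurable (alg ?P)" using um[of n] by measurable
        show "(\<lambda>\<omega>. ennreal (?S n \<omega> powr e)) \<in> borel_measurable (alg (?Q n))" using Sm[of n] by measurable
      qed
      also have "\<dots> \<le> (\<integral>\<^sup>+\<omega>. ennreal (\<phi> (?u n \<omega>)) \<partial>M) * C" by (intro mult_left_mono C) simp
      finally show ?thesis .
    qed
    have pp: "decreasing_poisson_process M (cascade_intensity m1) (\<lambda>n. u (p @ [n]))"
      using u_poisson[of p] p lk by (simp add: m1_def)
    have sF: "(\<Sum>n<K. \<integral>\<^sup>+\<omega>. ennreal (f (?u n \<omega>)) \<partial>M) \<le> F"
    proof -
      have "(\<Sum>n<K. \<integral>\<^sup>+\<omega>. ennreal (f (?u n \<omega>)) \<partial>M) \<le> (\<Sum>n. \<integral>\<^sup>+\<omega>. ennreal (f (?u n \<omega>)) \<partial>M)"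
        by (rule sum_le_suminf[OF summableI]) auto
      also have "\<dots> \<le> F"
        unfolding F_def f_def using m1 b c by (intro poisson_process_small_points[OF pp]) auto
      finally show ?thesis .
    qed
    have sG: "(\<Sum>n<K. \<integral>\<^sup>+\<omega>. ennreal (g (?u n \<omega>)) \<partial>M) \<le> G"
    proof -
      have "(\<Sum>n<K. \<integral>\<^sup>+\<omega>. ennreal (g (?u n \<omega>)) \<partial>M) \<le> (\<Sum>n. \<integral>\<^sup>+\<omega>. ennreal (g (?u n \<omega>)) \<partial>M)"
        by (rule sum_le_suminf[OF summableI]) auto
      also have "\<dots> \<le> G"
        unfolding G_def g_def using m1 b c by (intro poisson_process_large_points[OF pp]) auto
      finally show ?thesis .
    qed
    have "(\<integral>\<^sup>+\<omega>. ennreal (subtree_sum K (Suc d) p \<omega> powr b) \<partial>M) \<le>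
      (\<integral>\<^sup>+\<omega>. 1 + (\<Sum>n<K. ennreal (f (?u n \<omega>) * ?S n \<omega> powr c)) + (\<Sum>n<K. ennreal (g (?u n \<omega>) * ?S n \<omega> powr b)) \<partial>M)"
    proof (intro nn_integral_mono)
      fix \<omega>
      have "ennreal (subtree_sum K (Suc d) p \<omega> powr b) \<le>
        ennreal (1 + (\<Sum>n<K. f (?u n \<omega>) * ?S n \<omega> powr c) + (\<Sum>n<K. g (?u n \<omega>) * ?S n \<omega> powr b))"
        by (intro ennreal_leI pt)
      also have "\<dots> = 1 + (\<Sum>n<K. ennreal (f (?u n \<omega>) * ?S n \<omega> powr c)) + (\<Sum>n<K. ennreal (g (?u n \<omega>) * ?S n \<omega> powr b))"
        by (subst (1 2) sum_ennreal) (simp_all add: fg0 sum_nonneg)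
      finally show "ennreal (subtree_sum K (Suc d) p \<omega> powr b) \<le> \<dots>" .
    qed
    also have "\<dots> = 1 + (\<Sum>n<K. \<integral>\<^sup>+\<omega>. ennreal (f (?u n \<omega>) * ?S n \<omega> powr c) \<partial>M) + (\<Sum>n<K. \<integral>\<^sup>+\<omega>. ennreal (g (?u n \<omega>) * ?S n \<omega> powr b) \<partial>M)"
      by (simp add: nn_integral_add nn_integral_sum emeasure_space_1)
    also have "\<dots> \<le> 1 + (\<Sum>n<K. (\<integral>\<^sup>+\<omega>. ennreal (f (?u n \<omega>)) \<partial>M) * C1) + (\<Sum>n<K. (\<integral>\<^sup>+\<omega>. ennreal (g (?u n \<omega>)) \<partial>M) * C2)"
    proof (intro add_mono order_refl sum_mono)
      have S: "(\<integral>\<^sup>+\<omega>. ennreal (?S n \<omega> powr c) \<partial>M) \<le> C1" "(\<integral>\<^sup>+\<omega>. ennreal (?S n \<omega> powr b) \<partial>M) \<le> C2" for n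
        using p by (auto intro!: C1 C2)
      show "(\<integral>\<^sup>+\<omega>. ennreal (f (?u n \<omega>) * ?S n \<omega> powr c) \<partial>M) \<le> (\<integral>\<^sup>+\<omega>. ennreal (f (?u n \<omega>)) \<partial>M) * C1" for n
        by (rule e) (use fg0 S in auto)
      show "(\<integral>\<^sup>+\<omega>. ennreal (g (?u n \<omega>) * ?S n \<omega> powr b) \<partial>M) \<le> (\<integral>\<^sup>+\<omega>. ennreal (g (?u n \<omega>)) \<partial>M) * C2" for n
        by (rule e) (use fg0 S in auto)
    qed
    also have "\<dots> \<le> 1 + F * C1 + G * C2"
      unfolding sum_distrib_right[symmetric] by (intro add_mono order_refl mult_right_mono sF sG) auto
    finally show ?thesis .
  qed
  have "1 + F * C1 + G * C2 < \<infinity>" using C1(1) C2(1) by (simp add: F_def G_def ennreal_mult_less_top)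
  then show ?case using bound by (intro exI[of _ "1 + F * C1 + G * C2"]) (simp add: l_def)
qed

text \<open>Unrolling the recursion yields a sum over paths. At the root with \<open>d = k\<close>
  this is the sum of the absolute values of \<open>cascade_v\<close> over a finite box of leaves,
  and such boxes exhaust all leaves.\<close>

lemma subtree_sum_eq:
  "subtree_sum K d p \<omega> = (\<Sum>\<beta>\<in>{\<beta>. length \<beta> = d \<and> set \<beta> \<subseteq> {..<K}}. \<Prod>l\<in>{1..d}. \<bar>u (p @ take l \<beta>) \<omega>\<bar>)"
proof (induction d arbitrary: p)
  case 0
  have "{\<beta> :: nat list. length \<beta> = 0 \<and> set \<beta> \<subseteq> {..<K}} = {[]}" by auto
  then show ?case by simp
next
  case (Suc d)
  let ?B = "\<lambda>d. {\<beta>. length \<beta> = d \<and> set \<beta> \<subseteq> {..<K}}"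
  have B: "?B (Suc d) = (\<lambda>(n, \<beta>). n # \<beta>) ` ({..<K} \<times> ?B d)"
    by (auto simp: length_Suc_conv image_iff)
  have inj: "inj_on (\<lambda>(n, \<beta>). n # \<beta>) ({..<K} \<times> ?B d)" by (auto simp: inj_on_def)
  have pr: "(\<Prod>l\<in>{1..Suc d}. \<bar>u (p @ take l (n # \<beta>)) \<omega>\<bar>) = \<bar>u (p @ [n]) \<omega>\<bar> * (\<Prod>l\<in>{1..d}. \<bar>u ((p @ [n]) @ take l \<beta>) \<omega>\<bar>)" for n \<beta>
    by (subst prod.atLeast_Suc_atMost) (simp_all add: prod.atLeast_Suc_atMost_Suc_shift del: prod.cl_ivl_Suc)
  have "(\<Sum>\<beta>\<in>?B (Suc d). \<Prod>l\<in>{1..Suc d}. \<bar>u (p @ take l \<beta>) \<omega>\<bar>) =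
    (\<Sum>(n, \<beta>)\<in>{..<K} \<times> ?B d. \<bar>u (p @ [n]) \<omega>\<bar> * (\<Prod>l\<in>{1..d}. \<bar>u ((p @ [n]) @ take l \<beta>) \<omega>\<bar>))"
    unfolding B sum.reindex[OF inj] by (intro sum.cong refl) (simp only: o_def split_beta pr)
  also have "\<dots> = subtree_sum K (Suc d) p \<omega>"
    unfolding subtree_sum.simps Suc.IH sum_distrib_left sum.cartesian_product ..
  finally show ?case ..
qed

end

section \<open>Almost sure summability and normalisation of the cascade\<close>

context interpolation_model
begin

lemma countable_leaves: "countable (leaves k)"
  by (rule countableI_type)

text \<open>The moment of order \<open>b\<close> of the sums over boxes is bounded uniformly in
  \<open>K\<close>. By monotone convergence their supremum is almost surely finite, and every finite
  set of leaves lies in some box.\<close>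

lemma cascade_v_summable: "AE \<omega> in M. (cascade_v k u \<omega>) summable_on leaves k"
proof -
  define b where "b = m 1 / 2"
  have b: "0 < b" "b < m 1" using m_bounds(3)[of 1] k by (auto simp: b_def)
  obtain C where C: "C < \<infinity>" "\<And>K. (\<integral>\<^sup>+\<omega>. ennreal (subtree_sum K k [] \<omega> powr b) \<partial>M) \<le> C"
  proof -
    have "\<exists>C<\<infinity>. \<forall>K p. length p = length ([] :: nat list) \<longrightarrow> (\<integral>\<^sup>+\<omega>. ennreal (subtree_sum K k p \<omega> powr b) \<partial>M) \<le> C"
      by (rule subtree_sum_moment) (use b in simp_all)
    then show ?thesis using that by (metis list.size(3))
  qed
  have Q: "{Points ([] @ r) | r. length ([] @ r) < k} \<subseteq> sources N k" by (auto simp: sources_def)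
  have [measurable]: "subtree_sum K k [] \<in> borel_measurable M" for K
    by (rule measurable_algD[OF Q subtree_sum_measurable]) simp
  have "(\<integral>\<^sup>+\<omega>. (SUP K. ennreal (subtree_sum K k [] \<omega> powr b)) \<partial>M) = (SUP K. \<integral>\<^sup>+\<omega>. ennreal (subtree_sum K k [] \<omega> powr b) \<partial>M)"
  proof (rule nn_integral_monotone_convergence_SUP)
    show "incseq (\<lambda>K \<omega>. ennreal (subtree_sum K k [] \<omega> powr b))"
      unfolding incseq_def le_fun_def
      using b by (intro allI impI ennreal_leI powr_mono2 subtree_sum_mono subtree_sum_nonneg) simp
  qed measurable
  also have "\<dots> \<le> C" by (intro SUP_least C)
  finally have "(\<integral>\<^sup>+\<omega>. (SUP K. ennreal (subtree_sum K k [] \<omega> powr b)) \<partial>M) \<noteq> \<infinity>" using C(1) by auto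
  then have "AE \<omega> in M. (SUP K. ennreal (subtree_sum K k [] \<omega> powr b)) \<noteq> \<infinity>"
    by (intro nn_integral_PInf_AE) auto
  then show ?thesis
  proof eventually_elim
    case (elim \<omega>)
    define S where "S = (SUP K. ennreal (subtree_sum K k [] \<omega> powr b))"
    define B where "B = enn2real S"
    have "ennreal (subtree_sum K k [] \<omega> powr b) \<le> S" for K
      unfolding S_def by (rule SUP_upper) simp
    moreover have "ennreal B = S"
      unfolding B_def using elim by (subst ennreal_enn2real) (simp_all add: less_top S_def[symmetric])
    ultimately have "ennreal (subtree_sum K k [] \<omega> powr b) \<le> ennreal B" for K by simp
    then have B: "subtree_sum K k [] \<omega> powr b \<le> B" for K by (simp add: B_def)
    have bd: "subtree_sum K k [] \<omega> \<le> B powr (1 / b)" for K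
    proof -
      have "subtree_sum K k [] \<omega> = (subtree_sum K k [] \<omega> powr b) powr (1 / b)"
        using b subtree_sum_nonneg[of K k "[]" \<omega>] by (simp add: powr_powr)
      also have "\<dots> \<le> B powr (1 / b)"
        using b by (intro powr_mono2 B) auto
      finally show ?thesis .
    qed
    have "(\<lambda>\<alpha>. \<bar>cascade_v k u \<omega> \<alpha>\<bar>) summable_on leaves k"
    proof (rule nonneg_bdd_above_summable_on)
      show "bdd_above (sum (\<lambda>\<alpha>. \<bar>cascade_v k u \<omega> \<alpha>\<bar>) ` {F. F \<subseteq> leaves k \<and> finite F})"
      proof (rule bdd_aboveI2)
        fix F assume "F \<in> {F. F \<subseteq> leaves k \<and> finite F}"
        then have F: "F \<subseteq> leaves k" "finite F" by auto
        have "finite (\<Union>\<alpha>\<in>F. set \<alpha>)" using F by auto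
        then obtain K where K: "(\<Union>\<alpha>\<in>F. set \<alpha>) \<subseteq> {..<K}" using finite_nat_iff_bounded by blast
        have fin: "finite {\<beta>. length \<beta> = k \<and> set \<beta> \<subseteq> {..<K}}"
          using finite_lists_length_eq[of "{..<K}" k] by (rule back_subst) auto
        have "(\<Sum>\<alpha>\<in>F. \<bar>cascade_v k u \<omega> \<alpha>\<bar>) \<le> (\<Sum>\<alpha>\<in>{\<beta>. length \<beta> = k \<and> set \<beta> \<subseteq> {..<K}}. \<bar>cascade_v k u \<omega> \<alpha>\<bar>)"
          using F K by (intro sum_mono2 fin) (auto simp: leaves_def)
        also have "\<dots> = subtree_sum K k [] \<omega>"
          unfolding subtree_sum_eq[of K k "[]" \<omega>] by (simp only: cascade_v_def abs_prod append_Nil)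
        finally show "(\<Sum>\<alpha>\<in>F. \<bar>cascade_v k u \<omega> \<alpha>\<bar>) \<le> B powr (1 / b)" using bd[of K] by linarith
      qed
    qed simp
    then show ?case by (subst summable_on_iff_abs_summable_on_real) simp
  qed
qed

lemma cascade_v_pos: "AE \<omega> in M. \<forall>\<alpha>\<in>leaves k. 0 < cascade_v k u \<omega> \<alpha>"
proof -
  have "AE \<omega> in M. \<forall>p\<in>{p. length p < k}. \<forall>n. 0 < u (p @ [n]) \<omega>"
    by (subst AE_ball_countable)
       (use u_poisson in \<open>auto simp: decreasing_poisson_process_def\<close>)
  then show ?thesis
  proof eventually_elim
    case (elim \<omega>)
    have "0 < u (take l \<alpha>) \<omega>" if "\<alpha> \<in> leaves k" "l \<in> {1..k}" for \<alpha> l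
    proof -
      have "take l \<alpha> = take (l - 1) \<alpha> @ [\<alpha> ! (l - 1)]"
        using that take_Suc_conv_app_nth[of "l - 1" \<alpha>] by (auto simp: leaves_def)
      then show ?thesis using elim that by (auto simp: leaves_def)
    qed
    then show ?case unfolding cascade_v_def by (auto intro!: prod_pos)
  qed
qed

text \<open>Summability together with one positive term makes the normaliser positive, so the
  division in \<open>cascade_w\<close> is genuine and the weights add up to 1.\<close>

lemma cascade_w:
  "AE \<omega> in M. (\<forall>\<alpha>\<in>leaves k. 0 < cascade_w k u \<omega> \<alpha>) \<and> (cascade_w k u \<omega> has_sum 1) (leaves k)"
  using cascade_v_pos cascade_v_summable
proof eventually_elim
  case (elim \<omega>)
  let ?S = "\<Sum>\<^sub>\<infinity>\<gamma>\<in>leaves k. cascade_v k u \<omega> \<gamma>"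
  have r: "replicate k 0 \<in> leaves k" by (simp add: leaves_def)
  have "0 < ?S"
  proof -
    have "cascade_v k u \<omega> (replicate k 0) = (\<Sum>\<^sub>\<infinity>\<gamma>\<in>{replicate k 0}. cascade_v k u \<omega> \<gamma>)" by simp
    also have "\<dots> \<le> ?S"
      using elim r by (intro infsum_mono2) (auto intro: less_imp_le)
    finally show ?thesis using elim(1) r by (meson less_le_trans)
  qed
  moreover have "((\<lambda>\<alpha>. cascade_v k u \<omega> \<alpha> * inverse ?S) has_sum ?S * inverse ?S) (leaves k)"
    using elim(2) by (intro has_sum_cmult_left) (simp add: has_sum_infsum)
  ultimately show ?case using elim(1)
    unfolding cascade_w_def[abs_def] by (auto simp: divide_inverse)
qed

end

subsection \<open>The Gaussian fields and their covariances\<close>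

lemma (in prob_space) centered_gaussian_cmult:
  assumes X: "centered_gaussian M v X"
  shows "centered_gaussian M (c\<^sup>2 * v) (\<lambda>\<omega>. c * X \<omega>)"
proof (rule centered_gaussian_charI)
  have [measurable]: "X \<in> borel_measurable M" using centered_gaussianD[OF X] by auto
  show "(\<lambda>\<omega>. c * X \<omega>) \<in> borel_measurable M" by measurable
  show "0 \<le> c\<^sup>2 * v" using centered_gaussianD[OF X] by auto
  show "char (distr M borel (\<lambda>\<omega>. c * X \<omega>)) s = of_real (exp (- (c\<^sup>2 * v * s\<^sup>2) / 2))" for s
    using centered_gaussian_char[OF X, of "s * c"]
    by (simp add: char_distr_eq power_mult_distrib mult_ac)
qed

lemma (in prob_space) centered_gaussian_indep_sum:
  assumes J: "finite J" and ind: "indep_vars (\<lambda>_. borel) T J"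
    and T: "\<And>j. j \<in> J \<Longrightarrow> centered_gaussian M (v j) (T j)"
  shows "centered_gaussian M (\<Sum>j\<in>J. v j) (\<lambda>\<omega>. \<Sum>j\<in>J. T j \<omega>)"
proof (rule centered_gaussian_charI)
  show "(\<lambda>\<omega>. \<Sum>j\<in>J. T j \<omega>) \<in> borel_measurable M"
    using T centered_gaussianD(2) by (intro borel_measurable_sum) blast
  show "0 \<le> (\<Sum>j\<in>J. v j)" using T centered_gaussianD(1) by (intro sum_nonneg) blast
  fix s
  have "char (distr M borel (\<lambda>\<omega>. \<Sum>j\<in>J. T j \<omega>)) s = (\<Prod>j\<in>J. char (distr M borel (T j)) s)"
    using ind by (rule char_distr_sum)
  also have "\<dots> = (\<Prod>j\<in>J. of_real (exp (- (v j * s\<^sup>2) / 2)))"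
    using centered_gaussian_char[OF T] centered_gaussianD(2)[OF T]
    by (intro prod.cong refl) (simp add: char_distr_eq)
  also have "\<dots> = of_real (exp (\<Sum>j\<in>J. - (v j * s\<^sup>2) / 2))"
    unfolding of_real_prod[symmetric] exp_sum[OF J] ..
  also have "(\<Sum>j\<in>J. - (v j * s\<^sup>2) / 2) = - ((\<Sum>j\<in>J. v j) * s\<^sup>2) / 2"
    by (simp add: sum_distrib_right sum_negf sum_divide_distrib)
  finally show "char (distr M borel (\<lambda>\<omega>. \<Sum>j\<in>J. T j \<omega>)) s = of_real (exp (- ((\<Sum>j\<in>J. v j) * s\<^sup>2) / 2))" .
qed

text \<open>\<open>wedge\<close> counts coordinates from 1, so the common nodes on the paths to
  \<alpha> and \<beta> are exactly those of level below \<open>wedge\<close>, the root included. The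
  value \<open>k + 1\<close> for equal leaves fits this reading.\<close>

lemma take_eq_iff_wedge:
  assumes "\<alpha> \<in> leaves k" "\<beta> \<in> leaves k" "l \<le> k"
  shows "take l \<alpha> = take l \<beta> \<longleftrightarrow> l < wedge k \<alpha> \<beta>"
proof (cases "\<alpha> = \<beta>")
  case True
  then show ?thesis using assms by (simp add: wedge_def)
next
  case False
  let ?S = "{l\<in>{1..k}. \<alpha> ! (l - 1) \<noteq> \<beta> ! (l - 1)}"
  have len: "length \<alpha> = k" "length \<beta> = k" using assms by (auto simp: leaves_def)
  then obtain i where "i < k" "\<alpha> ! i \<noteq> \<beta> ! i" using False by (auto simp: list_eq_iff_nth_eq)
  then have ne: "Suc i \<in> ?S" by auto
  have "l < wedge k \<alpha> \<beta> \<longleftrightarrow> (\<forall>s\<in>?S. l < s)"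
  proof -
    have w: "wedge k \<alpha> \<beta> = Min ?S" using False by (simp add: wedge_def)
    have "?S \<noteq> {}" "finite ?S" using ne by (blast, simp)
    then show ?thesis unfolding w by (intro Min_gr_iff)
  qed
  also have "\<dots> \<longleftrightarrow> (\<forall>j<l. \<alpha> ! j = \<beta> ! j)"
  proof
    assume a: "\<forall>s\<in>?S. l < s"
    show "\<forall>j<l. \<alpha> ! j = \<beta> ! j"
    proof (intro allI impI, rule ccontr)
      fix j assume "j < l" "\<alpha> ! j \<noteq> \<beta> ! j"
      then show False using bspec[OF a, of "Suc j"] assms(3) by auto
    qed
  next
    assume a: "\<forall>j<l. \<alpha> ! j = \<beta> ! j"
    show "\<forall>s\<in>?S. l < s"
    proof (intro ballI, rule ccontr)
      fix s assume "s \<in> ?S" "\<not> l < s"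
      moreover from this have "s - 1 < l" by auto
      ultimately show False using a[rule_format, of "s - 1"] by auto
    qed
  qed
  also have "\<dots> \<longleftrightarrow> take l \<alpha> = take l \<beta>"
    using len assms(3) by (auto simp: list_eq_iff_nth_eq)
  finally show ?thesis ..
qed

lemma wedge_bounds:
  assumes "\<alpha> \<in> leaves k" "\<beta> \<in> leaves k"
  shows "wedge k \<alpha> \<beta> \<le> k + 1"
proof (cases "\<alpha> = \<beta>")
  case False
  then have "\<not> k < wedge k \<alpha> \<beta>"
    using take_eq_iff_wedge[OF assms, of k] assms by (simp add: leaves_def)
  then show ?thesis by simp
qed (simp add: wedge_def)

lemma finite_spins: "finite (spins N)"
  unfolding spins_def by (intro finite_PiE) auto

lemma spins_values: "\<sigma> \<in> spins N \<Longrightarrow> i \<in> {1..N} \<Longrightarrow> \<sigma> i \<in> {-1, 1}"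
  unfolding spins_def by (rule PiE_mem)

lemma overlap_self:
  assumes "\<sigma> \<in> spins N" "N \<ge> 1" shows "overlap N \<sigma> \<sigma> = 1"
proof -
  have "(\<Sum>i\<in>{1..N}. \<sigma> i * \<sigma> i) = (\<Sum>i\<in>{1..N}. 1)"
    using spins_values[OF assms(1)] by (intro sum.cong refl) fastforce
  then show ?thesis using assms(2) unfolding overlap_def by simp
qed

context interpolation_model
begin

definition gauss_sources :: "source set" where
  "gauss_sources = {Disorder} \<union> {Entry p i | p i. length p \<le> k \<and> i \<in> {1..N}}"

definition point_sources :: "source set" where
  "point_sources = {Points p | p. length p < k}"

lemma sources_subsets: "gauss_sources \<subseteq> sources N k" "point_sources \<subseteq> sources N k"
  "gauss_sources \<inter> point_sources = {}"
  by (auto simp: gauss_sources_def point_sources_def sources_def)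

lemma integral_indep:
  fixes f g :: "'a \<Rightarrow> 'b :: {real_normed_field, banach, second_countable_topology}"
  assumes "P \<subseteq> sources N k" "Q \<subseteq> sources N k" "P \<inter> Q = {}"
    and f: "f \<in> borel_measurable (alg P)" and g: "g \<in> borel_measurable (alg Q)"
    and int: "integrable M f" "integrable M g"
  shows "(\<integral>\<omega>. f \<omega> * g \<omega> \<partial>M) = (\<integral>\<omega>. f \<omega> \<partial>M) * (\<integral>\<omega>. g \<omega> \<partial>M)"
proof -
  have "indep_vars (\<lambda>_. borel) (\<lambda>b. if b then f else g) (UNIV :: bool set)"
    by (rule indep_vars_model[where P="\<lambda>b. if b then P else Q"])
       (use assms in \<open>auto simp: disjoint_family_on_def\<close>)
  from indep_vars_lebesgue_integral[OF _ this] show ?thesis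
    using int by (simp add: UNIV_bool mult.commute)
qed

definition GI :: "((nat \<Rightarrow> real) + (nat list \<times> nat)) set" where
  "GI = spins N <+> ({p. length p \<le> k} \<times> {1..N})"

definition gen :: "(nat \<Rightarrow> real) + (nat list \<times> nat) \<Rightarrow> 'a \<Rightarrow> real" where
  "gen = case_sum H (\<lambda>(p, i). z p i)"

text \<open>The linear span of all Gaussian inputs. It serves as the Gaussian space of the
  interpolation, since the Hamiltonian at every time and at every truncation belongs to it.\<close>

definition GS :: "('a \<Rightarrow> real) set" where
  "GS = {L. \<exists>F c. finite F \<and> F \<subseteq> GI \<and> L = (\<lambda>\<omega>. \<Sum>j\<in>F. c j * gen j \<omega>)}"

lemma GS_lin:
  assumes "L1 \<in> GS" "L2 \<in> GS" shows "(\<lambda>\<omega>. c * L1 \<omega> + L2 \<omega>) \<in> GS"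
proof -
  obtain F1 c1 where 1: "finite F1" "F1 \<subseteq> GI" "L1 = (\<lambda>\<omega>. \<Sum>j\<in>F1. c1 j * gen j \<omega>)"
    using assms(1) unfolding GS_def by auto
  obtain F2 c2 where 2: "finite F2" "F2 \<subseteq> GI" "L2 = (\<lambda>\<omega>. \<Sum>j\<in>F2. c2 j * gen j \<omega>)"
    using assms(2) unfolding GS_def by auto
  define d where "d j = c * (if j \<in> F1 then c1 j else 0) + (if j \<in> F2 then c2 j else 0)" for j
  have "c * L1 \<omega> + L2 \<omega> = (\<Sum>j\<in>F1 \<union> F2. d j * gen j \<omega>)" for \<omega>
  proof -
    have "L1 \<omega> = (\<Sum>j\<in>F1 \<union> F2. (if j \<in> F1 then c1 j else 0) * gen j \<omega>)"
      unfolding 1 using 1(1) 2(1) by (intro sum.mono_neutral_cong_left) auto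
    moreover have "L2 \<omega> = (\<Sum>j\<in>F1 \<union> F2. (if j \<in> F2 then c2 j else 0) * gen j \<omega>)"
      unfolding 2 using 1(1) 2(1) by (intro sum.mono_neutral_cong_left) auto
    ultimately show ?thesis
      by (simp only: d_def sum_distrib_left sum.distrib distrib_right mult.assoc)
  qed
  then show ?thesis unfolding GS_def using 1 2 by (auto intro!: exI[of _ "F1 \<union> F2"] exI[of _ d])
qed

lemma GS_zero: "(\<lambda>\<omega>. 0) \<in> GS"
  unfolding GS_def by (auto intro!: exI[of _ "{}"])

lemma GS_gen: "j \<in> GI \<Longrightarrow> gen j \<in> GS"
  unfolding GS_def by (auto intro!: exI[of _ "{j}"] exI[of _ "\<lambda>_. 1"])

text \<open>Joint Gaussianity follows from independence of the sources: the part in \<open>H\<close>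
  is Gaussian because \<open>H\<close> is a Gaussian process, every entry of \<open>z\<close> is a
  source of its own, and independent Gaussian summands have a Gaussian sum.\<close>

lemma GS_gaussian:
  assumes "L \<in> GS" shows "\<exists>v. centered_gaussian M v L"
proof -
  obtain F c where F: "finite F" "F \<subseteq> GI" and L: "L = (\<lambda>\<omega>. \<Sum>j\<in>F. c j * gen j \<omega>)"
    using assms unfolding GS_def by auto
  define Fl where "Fl = {\<sigma>. Inl \<sigma> \<in> F}"
  define Fr where "Fr = {x. Inr x \<in> F}"
  have FP: "F = Fl <+> Fr"
    unfolding Fl_def Fr_def 
  proof (rule set_eqI)
    fix x show "x \<in> F \<longleftrightarrow> x \<in> {\<sigma>. Inl \<sigma> \<in> F} <+> {x. Inr x \<in> F}" by (cases x) auto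
  qed
  have fin: "finite Fl" "finite Fr" using F(1) unfolding FP by (auto simp: finite_Plus_iff)
  have sub: "Fl \<subseteq> spins N" "Fr \<subseteq> {p. length p \<le> k} \<times> {1..N}"
    using F(2) unfolding Fl_def Fr_def GI_def by auto
  \<comment> \<open>The terms are grouped by source: all values of \<open>H\<close> form one
    summand, since they are not independent of each other.\<close>
  define T where "T s = (case s of Disorder \<Rightarrow> (\<lambda>\<omega>. \<Sum>\<sigma>\<in>Fl. c (Inl \<sigma>) * H \<sigma> \<omega>)
     | Entry p i \<Rightarrow> (\<lambda>\<omega>. c (Inr (p, i)) * z p i \<omega>) | Points p \<Rightarrow> (\<lambda>_. 0))" for s
  define J where "J = insert Disorder ((\<lambda>(p, i). Entry p i) ` Fr)"
  have inj: "inj_on (\<lambda>(p, i). Entry p i) Fr" by (auto simp: inj_on_def)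
  have LT: "L = (\<lambda>\<omega>. \<Sum>s\<in>J. T s \<omega>)"
  proof
    fix \<omega>
    have "(\<Sum>s\<in>J. T s \<omega>) = T Disorder \<omega> + (\<Sum>s\<in>(\<lambda>(p, i). Entry p i) ` Fr. T s \<omega>)"
      unfolding J_def using fin by (subst sum.insert) auto
    also have "(\<Sum>s\<in>(\<lambda>(p, i). Entry p i) ` Fr. T s \<omega>) = (\<Sum>x\<in>Fr. c (Inr x) * gen (Inr x) \<omega>)"
      unfolding sum.reindex[OF inj] by (intro sum.cong) (auto simp: T_def gen_def)
    also have "T Disorder \<omega> = (\<Sum>\<sigma>\<in>Fl. c (Inl \<sigma>) * gen (Inl \<sigma>) \<omega>)" by (simp add: T_def gen_def)
    finally show "L \<omega> = (\<Sum>s\<in>J. T s \<omega>)" unfolding L FP using fin by (simp add: sum.Plus)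
  qed
  have Tg: "\<exists>v. centered_gaussian M v (T s)" if "s \<in> J" for s
  proof (cases s)
    case Disorder
    have "centered_gaussian_process M (spins N) H" by (rule H_gaussian)
    then have "\<exists>v. centered_gaussian M v (\<lambda>\<omega>. \<Sum>\<sigma>\<in>Fl. c (Inl \<sigma>) * H \<sigma> \<omega>)"
      using fin(1) sub(1) unfolding centered_gaussian_process_def by (elim allE[of _ Fl] allE[of _ "\<lambda>\<sigma>. c (Inl \<sigma>)"]) auto
    then show ?thesis using Disorder by (simp add: T_def)
  next
    case (Entry p i)
    then have "(p, i) \<in> Fr" using that by (auto simp: J_def)
    then have "length p \<le> k" "i \<in> {1..N}" using sub(2) by auto
    from centered_gaussian_cmult[OF z_gaussian[OF this]] show ?thesis using Entry by (auto simp: T_def)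
  next
    case (Points p)
    then show ?thesis using that by (auto simp: J_def)
  qed
  then obtain v where v: "\<And>s. s \<in> J \<Longrightarrow> centered_gaussian M (v s) (T s)" by metis
  have "indep_vars (\<lambda>_. borel) T J"
  proof (rule indep_vars_model[where P="\<lambda>s. {s}"])
    show "{s} \<subseteq> sources N k" if "s \<in> J" for s
      using that sub(2) by (auto simp: J_def sources_def)
    show "disjoint_family_on (\<lambda>s. {s}) J" by (auto simp: disjoint_family_on_def)
    show "T s \<in> borel_measurable (alg {s})" if "s \<in> J" for s
    proof (cases s)
      case Disorder
      have "H \<sigma> \<in> borel_measurable (alg {Disorder})" if "\<sigma> \<in> Fl" for \<sigma>
        using that sub(1) by (intro measurable_source(1)) auto
      then show ?thesis unfolding Disorder T_def by simp
    next
      case (Entry p i)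
      have "z p i \<in> borel_measurable (alg {Entry p i})" by (intro measurable_source(2)) auto
      then show ?thesis unfolding Entry T_def by simp
    next
      case (Points p)
      then show ?thesis by (simp add: T_def)
    qed
  qed
  then have "centered_gaussian M (\<Sum>s\<in>J. v s) L"
    unfolding LT using fin v by (intro centered_gaussian_indep_sum) (auto simp: J_def)
  then show ?thesis ..
qed

sublocale gaussian_space M GS
  by unfold_locales (auto intro: GS_zero GS_lin GS_gaussian)

lemma GS_alg:
  assumes "L \<in> GS" shows "L \<in> borel_measurable (alg gauss_sources)"
proof -
  obtain F c where F: "finite F" "F \<subseteq> GI" and L: "L = (\<lambda>\<omega>. \<Sum>j\<in>F. c j * gen j \<omega>)"
    using assms unfolding GS_def by auto
  have "gen j \<in> borel_measurable (alg gauss_sources)" if "j \<in> F" for j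
  proof -
    have "j \<in> GI" using that F by auto
    then show ?thesis unfolding GI_def gen_def gauss_sources_def
      by (auto intro!: measurable_source simp: Plus_def)
  qed
  then show ?thesis unfolding L by (intro borel_measurable_sum borel_measurable_times) auto
qed

text \<open>Supplies the independence condition of \<open>gaussian_weights\<close> for any function
  of the point processes.\<close>

lemma GS_indep_char:
  assumes L: "L \<in> GS" and T: "T \<in> borel_measurable (alg point_sources)"
  shows "(CLINT \<omega>|M. iexp (L \<omega> + T \<omega>)) = (CLINT \<omega>|M. iexp (L \<omega>)) * (CLINT \<omega>|M. iexp (T \<omega>))"
proof -
  have [measurable]: "L \<in> borel_measurable M" "T \<in> borel_measurable M"
    using measurable_algD[OF sources_subsets(1) GS_alg[OF L]] measurable_algD[OF sources_subsets(2) T] by auto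
  have "(CLINT \<omega>|M. iexp (L \<omega>) * iexp (T \<omega>)) = (CLINT \<omega>|M. iexp (L \<omega>)) * (CLINT \<omega>|M. iexp (T \<omega>))"
  proof (rule integral_indep[OF sources_subsets])
    show "(\<lambda>\<omega>. iexp (L \<omega>)) \<in> borel_measurable (alg gauss_sources)" using GS_alg[OF L] by measurable
    show "(\<lambda>\<omega>. iexp (T \<omega>)) \<in> borel_measurable (alg point_sources)" using T by measurable
    show "complex_integrable M (\<lambda>\<omega>. iexp (L \<omega>))" "complex_integrable M (\<lambda>\<omega>. iexp (T \<omega>))"
      by (rule integrable_bounded[where B=1]; simp)+
  qed
  then show ?thesis by (simp add: distrib_left exp_add)
qed

definition cavity :: "nat list \<Rightarrow> (nat \<Rightarrow> real) \<Rightarrow> 'a \<Rightarrow> real" where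
  "cavity \<alpha> \<sigma> \<omega> = (\<Sum>i\<in>{1..N}. tree_field k z \<omega> \<alpha> i * \<sigma> i)"

lemma cavity_eq: "cavity \<alpha> \<sigma> \<omega> = (\<Sum>(i, l)\<in>{1..N} \<times> {0..k}. \<sigma> i * z (take l \<alpha>) i \<omega>)"
  unfolding cavity_def tree_field_def sum_distrib_right sum.cartesian_product
  by (simp add: mult.commute)

lemma z_GS: "length p \<le> k \<Longrightarrow> i \<in> {1..N} \<Longrightarrow> z p i \<in> GS"
  using GS_gen[of "Inr (p, i)"] by (simp add: GI_def gen_def InrI)

lemma H_GS: "\<sigma> \<in> spins N \<Longrightarrow> H \<sigma> \<in> GS"
  using GS_gen[of "Inl \<sigma>"] by (simp add: GI_def gen_def InlI)

lemma cavity_GS: "cavity \<alpha> \<sigma> \<in> GS"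
  unfolding cavity_eq[abs_def] case_prod_beta'
  by (rule G_sum) (auto intro!: z_GS)

lemma cov_z:
  assumes "length p \<le> k" "length r \<le> k" "i \<in> {1..N}" "j \<in> {1..N}"
  shows "(\<integral>\<omega>. z p i \<omega> * z r j \<omega> \<partial>M) =
     (if p = r \<and> i = j then deriv \<xi> (q (length p + 1)) - deriv \<xi> (q (length p)) else 0)"
proof (cases "p = r \<and> i = j")
  case True
  then show ?thesis
    using centered_gaussian_square(2)[OF z_gaussian[OF assms(1,3)]] by (auto simp: power2_eq_square)
next
  case False
  have "(\<integral>\<omega>. z p i \<omega> * z r j \<omega> \<partial>M) = (\<integral>\<omega>. z p i \<omega> \<partial>M) * (\<integral>\<omega>. z r j \<omega> \<partial>M)"
    by (rule integral_indep[where P="{Entry p i}" and Q="{Entry r j}"])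
       (use assms False in \<open>auto simp: sources_def intro!: measurable_source G_integrable z_GS\<close>)
  then show ?thesis
    using centered_gaussian_mean(2)[OF z_gaussian[OF assms(1,3)]] False by auto
qed

lemma cov_H_cavity:
  assumes "\<sigma>' \<in> spins N"
  shows "(\<integral>\<omega>. H \<sigma>' \<omega> * cavity \<alpha> \<sigma> \<omega> \<partial>M) = 0"
proof -
  have HG: "H \<sigma>' \<in> GS" using assms by (rule H_GS)
  let ?E = "{Entry p i | p i. length p \<le> k \<and> i \<in> {1..N}}"
  have "(\<integral>\<omega>. H \<sigma>' \<omega> * cavity \<alpha> \<sigma> \<omega> \<partial>M) = (\<integral>\<omega>. H \<sigma>' \<omega> \<partial>M) * (\<integral>\<omega>. cavity \<alpha> \<sigma> \<omega> \<partial>M)"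
  proof (rule integral_indep[where P="{Disorder}" and Q="?E"])
    show "cavity \<alpha> \<sigma> \<in> borel_measurable (alg ?E)"
      unfolding cavity_eq[abs_def] case_prod_beta'
      by (intro borel_measurable_sum borel_measurable_times measurable_source) auto
  qed (use assms in \<open>auto simp: sources_def intro!: measurable_source G_integrable HG cavity_GS\<close>)
  then show ?thesis using centered_gaussian_mean(2)[OF centered[OF HG]] by simp
qed

text \<open>The levels with equal prefixes are those below \<open>wedge\<close>, so the variances
  telescope. The lower end \<open>deriv \<xi> (q 0)\<close> is 0 because \<open>q 0 = 0\<close> and
  \<open>deriv \<xi> 0 = 0\<close>.\<close>

lemma sum_increments:
  assumes "\<alpha> \<in> leaves k" "\<beta> \<in> leaves k"
  shows "(\<Sum>l\<in>{0..k}. if take l \<alpha> = take l \<beta> then deriv \<xi> (q (l + 1)) - deriv \<xi> (q l) else 0) =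
    deriv \<xi> (q (wedge k \<alpha> \<beta>))"
proof -
  have "(\<Sum>l\<in>{0..k}. if take l \<alpha> = take l \<beta> then deriv \<xi> (q (l + 1)) - deriv \<xi> (q l) else 0) =
    (\<Sum>l\<in>{0..k}. if l < wedge k \<alpha> \<beta> then deriv \<xi> (q (l + 1)) - deriv \<xi> (q l) else 0)"
    using take_eq_iff_wedge[OF assms] by (intro sum.cong) auto
  also have "\<dots> = (\<Sum>l\<in>{..<wedge k \<alpha> \<beta>}. deriv \<xi> (q (Suc l)) - deriv \<xi> (q l))"
    using wedge_bounds[OF assms] by (intro sum.mono_neutral_cong_right) auto
  also have "\<dots> = deriv \<xi> (q (wedge k \<alpha> \<beta>))"
    by (subst sum_lessThan_telescope) (simp add: q0 \<xi>'0)
  finally show ?thesis .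
qed

text \<open>Only pairs with the same site and the same node of the tree are correlated. The site sum
  produces the overlap, the level sum the telescoped variance.\<close>

lemma cov_cavity:
  assumes \<alpha>: "\<alpha> \<in> leaves k" and \<beta>: "\<beta> \<in> leaves k"
  shows "(\<integral>\<omega>. cavity \<alpha> \<sigma>1 \<omega> * cavity \<beta> \<sigma>2 \<omega> \<partial>M) =
    real N * overlap N \<sigma>1 \<sigma>2 * deriv \<xi> (q (wedge k \<alpha> \<beta>))"
proof -
  let ?I = "{1..N} \<times> {0..k}"
  let ?v = "\<lambda>l. deriv \<xi> (q (l + 1)) - deriv \<xi> (q l)"
  have len: "length \<alpha> = k" "length \<beta> = k" using assms by (auto simp: leaves_def)
  have int: "integrable M (\<lambda>\<omega>. z (take (snd x) \<alpha>) (fst x) \<omega> * z (take (snd y) \<beta>) (fst y) \<omega>)"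
    if "x \<in> ?I" "y \<in> ?I" for x y
    using that by (intro G_prod_integrable z_GS) auto
  have c: "(\<integral>\<omega>. z (take (snd x) \<alpha>) (fst x) \<omega> * z (take (snd y) \<beta>) (fst y) \<omega> \<partial>M) =
     (if x = y then (if take (snd x) \<alpha> = take (snd x) \<beta> then ?v (snd x) else 0) else 0)"
    if "x \<in> ?I" "y \<in> ?I" for x y
  proof -
    \<comment> \<open>Prefixes of different length are different nodes, so equal nodes force equal
      levels and the double sum becomes diagonal.\<close>
    have e: "snd x = snd y" if "take (snd x) \<alpha> = take (snd y) \<beta>"
      using arg_cong[OF that, of length] \<open>x \<in> ?I\<close> \<open>y \<in> ?I\<close> len by auto
    show ?thesis
      using that len by (subst cov_z) (auto dest: e simp: prod_eq_iff min_def)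
  qed
  have "(\<integral>\<omega>. cavity \<alpha> \<sigma>1 \<omega> * cavity \<beta> \<sigma>2 \<omega> \<partial>M) =
    (\<integral>\<omega>. (\<Sum>x\<in>?I. \<Sum>y\<in>?I. (\<sigma>1 (fst x) * \<sigma>2 (fst y)) * (z (take (snd x) \<alpha>) (fst x) \<omega> * z (take (snd y) \<beta>) (fst y) \<omega>)) \<partial>M)"
    unfolding cavity_eq sum_product case_prod_beta' by (simp add: mult_ac)
  also have "\<dots> = (\<Sum>x\<in>?I. \<Sum>y\<in>?I. (\<sigma>1 (fst x) * \<sigma>2 (fst y)) *
      (\<integral>\<omega>. z (take (snd x) \<alpha>) (fst x) \<omega> * z (take (snd y) \<beta>) (fst y) \<omega> \<partial>M))"
    using int by (simp add: Bochner_Integration.integral_sum Bochner_Integration.integrable_sum)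
  also have "\<dots> = (\<Sum>x\<in>?I. \<sigma>1 (fst x) * \<sigma>2 (fst x) * (if take (snd x) \<alpha> = take (snd x) \<beta> then ?v (snd x) else 0))"
  proof (intro sum.cong refl)
    fix x assume x: "x \<in> ?I"
    have "(\<Sum>y\<in>?I. (\<sigma>1 (fst x) * \<sigma>2 (fst y)) *
      (\<integral>\<omega>. z (take (snd x) \<alpha>) (fst x) \<omega> * z (take (snd y) \<beta>) (fst y) \<omega> \<partial>M)) =
      (\<Sum>y\<in>?I. if x = y then (\<sigma>1 (fst x) * \<sigma>2 (fst x)) * (if take (snd x) \<alpha> = take (snd x) \<beta> then ?v (snd x) else 0) else 0)"
      using c[OF x] by (intro sum.cong) auto
    also have "\<dots> = (\<sigma>1 (fst x) * \<sigma>2 (fst x)) * (if take (snd x) \<alpha> = take (snd x) \<beta> then ?v (snd x) else 0)"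
      using x by (subst sum.delta') auto
    finally show "(\<Sum>y\<in>?I. (\<sigma>1 (fst x) * \<sigma>2 (fst y)) *
      (\<integral>\<omega>. z (take (snd x) \<alpha>) (fst x) \<omega> * z (take (snd y) \<beta>) (fst y) \<omega> \<partial>M)) =
      \<sigma>1 (fst x) * \<sigma>2 (fst x) * (if take (snd x) \<alpha> = take (snd x) \<beta> then ?v (snd x) else 0)" .
  qed
  also have "\<dots> = (\<Sum>i\<in>{1..N}. \<Sum>l\<in>{0..k}. \<sigma>1 i * \<sigma>2 i * (if take l \<alpha> = take l \<beta> then ?v l else 0))"
    by (subst sum.cartesian_product) (simp add: case_prod_beta')
  also have "\<dots> = (\<Sum>i\<in>{1..N}. \<sigma>1 i * \<sigma>2 i) * (\<Sum>l\<in>{0..k}. if take l \<alpha> = take l \<beta> then ?v l else 0)"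
    by (simp only: sum_distrib_left[symmetric] sum_distrib_right)
  also have "\<dots> = real N * overlap N \<sigma>1 \<sigma>2 * deriv \<xi> (q (wedge k \<alpha> \<beta>))"
    unfolding sum_increments[OF assms] using N by (simp add: overlap_def)
  finally show ?thesis .
qed

end

subsection \<open>Averages with respect to countably many weights\<close>

definition partition_sum :: "'b set \<Rightarrow> ('b \<Rightarrow> real) \<Rightarrow> ('b \<Rightarrow> real) \<Rightarrow> real" where
  "partition_sum A v h = (\<integral>a. v a * exp (h a) \<partial>count_space A)"

text \<open>The average of \<open>Q\<close> over two independent replicas. Numerator and normaliser
  are kept apart so that dominated convergence can treat each one separately.\<close>

definition pair_average :: "'b set \<Rightarrow> ('b \<Rightarrow> real) \<Rightarrow> ('b \<Rightarrow> real) \<Rightarrow> ('b \<Rightarrow> 'b \<Rightarrow> real) \<Rightarrow> real" where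
  "pair_average A v h Q =
     (\<integral>a. v a * exp (h a) * (\<integral>b. v b * exp (h b) * Q a b \<partial>count_space A) \<partial>count_space A) / (partition_sum A v h)\<^sup>2"

lemma integrable_weights:
  assumes "integrable (count_space A) (\<lambda>a. v a * exp (B a))" "\<And>a. a \<in> A \<Longrightarrow> 0 \<le> v a"
    "\<And>a. a \<in> A \<Longrightarrow> h a \<le> B a"
  shows "integrable (count_space A) (\<lambda>a. v a * exp (h a) :: real)"
  by (rule Bochner_Integration.integrable_bound[OF assms(1)])
     (use assms in \<open>auto simp: AE_count_space abs_mult intro!: mult_left_mono\<close>)

lemma integrable_weights_bounded:
  assumes "integrable (count_space A) (\<lambda>a. v a * exp (h a))" "\<And>a. a \<in> A \<Longrightarrow> 0 \<le> v a"
    "\<And>a. a \<in> A \<Longrightarrow> \<bar>f a\<bar> \<le> c"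
  shows "integrable (count_space A) (\<lambda>a. v a * exp (h a) * f a :: real)"
proof (rule Bochner_Integration.integrable_bound)
  show "integrable (count_space A) (\<lambda>a. c * (v a * exp (h a)))" using assms(1) by simp
  have "\<bar>v a * exp (h a) * f a\<bar> \<le> \<bar>c * (v a * exp (h a))\<bar>" if "a \<in> A" for a
  proof -
    have "\<bar>v a * exp (h a) * f a\<bar> = (v a * exp (h a)) * \<bar>f a\<bar>" using assms(2)[OF that] by (simp add: abs_mult)
    also have "\<dots> \<le> (v a * exp (h a)) * c" using assms(2,3)[OF that] by (intro mult_left_mono) auto
    finally show ?thesis by (simp add: mult.commute)
  qed
  then show "AE a in count_space A. norm (v a * exp (h a) * f a) \<le> norm (c * (v a * exp (h a)))"
    by (auto simp: AE_count_space)
qed simp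

lemma inner_bound:
  assumes "integrable (count_space A) (\<lambda>a. v a * exp (h a))" "\<And>a. a \<in> A \<Longrightarrow> 0 \<le> v a"
    "\<And>a. a \<in> A \<Longrightarrow> \<bar>f a\<bar> \<le> c"
  shows "\<bar>\<integral>a. v a * exp (h a) * f a \<partial>count_space A\<bar> \<le> c * partition_sum A v h"
proof -
  have i: "integrable (count_space A) (\<lambda>a. v a * exp (h a) * f a)"
    using assms by (rule integrable_weights_bounded)
  have "\<bar>\<integral>a. v a * exp (h a) * f a \<partial>count_space A\<bar> \<le> (\<integral>a. \<bar>v a * exp (h a) * f a\<bar> \<partial>count_space A)"
    by (rule integral_abs_bound)
  also have "\<dots> \<le> (\<integral>a. c * (v a * exp (h a)) \<partial>count_space A)"
  proof (rule integral_mono)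
    show "\<bar>v a * exp (h a) * f a\<bar> \<le> c * (v a * exp (h a))" if "a \<in> space (count_space A)" for a
    proof -
      have "v a * exp (h a) * \<bar>f a\<bar> \<le> v a * exp (h a) * c" using assms(2,3)[of a] that by (intro mult_left_mono) auto
      then show ?thesis using assms(2)[of a] that by (simp add: abs_mult mult.commute)
    qed
  qed (use i assms(1) in auto)
  finally show ?thesis by (simp add: partition_sum_def)
qed

lemma pair_average_bound:
  assumes "integrable (count_space A) (\<lambda>a. v a * exp (h a))" "\<And>a. a \<in> A \<Longrightarrow> 0 \<le> v a"
    and Q: "\<And>a b. a \<in> A \<Longrightarrow> b \<in> A \<Longrightarrow> \<bar>Q a b\<bar> \<le> c" and c: "0 \<le> c"
  shows "\<bar>pair_average A v h Q\<bar> \<le> c"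
proof -
  have "\<bar>\<integral>a. v a * exp (h a) * (\<integral>b. v b * exp (h b) * Q a b \<partial>count_space A) \<partial>count_space A\<bar>
      \<le> c * partition_sum A v h * partition_sum A v h"
    using assms by (intro inner_bound) auto
  then show ?thesis unfolding pair_average_def
    using c by (cases "partition_sum A v h = 0") (simp_all add: divide_le_eq power2_eq_square mult.assoc zero_less_mult_iff)
qed

lemma pair_average_lin:
  assumes "integrable (count_space A) (\<lambda>a. v a * exp (h a))" "\<And>a. a \<in> A \<Longrightarrow> 0 \<le> v a"
    and Q: "\<And>a b. a \<in> A \<Longrightarrow> b \<in> A \<Longrightarrow> \<bar>Q a b\<bar> \<le> c" "\<And>a b. a \<in> A \<Longrightarrow> b \<in> A \<Longrightarrow> \<bar>R a b\<bar> \<le> d"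
  shows "pair_average A v h (\<lambda>a b. x * Q a b + R a b) = x * pair_average A v h Q + pair_average A v h R"
proof -
  let ?ca = "count_space A"
  let ?iQ = "\<lambda>a. \<integral>b. v b * exp (h b) * Q a b \<partial>?ca" and ?iR = "\<lambda>a. \<integral>b. v b * exp (h b) * R a b \<partial>?ca"
  have iQ: "integrable ?ca (\<lambda>b. v b * exp (h b) * Q a b)" if "a \<in> A" for a
    using assms that by (intro integrable_weights_bounded[where c=c]) auto
  have iR: "integrable ?ca (\<lambda>b. v b * exp (h b) * R a b)" if "a \<in> A" for a
    using assms that by (intro integrable_weights_bounded[where c=d]) auto
  have IQ: "integrable ?ca (\<lambda>a. v a * exp (h a) * ?iQ a)"
    using assms by (intro integrable_weights_bounded[where c="c * partition_sum A v h"] inner_bound) auto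
  have IR: "integrable ?ca (\<lambda>a. v a * exp (h a) * ?iR a)"
    using assms by (intro integrable_weights_bounded[where c="d * partition_sum A v h"] inner_bound) auto
  have "(\<integral>a. v a * exp (h a) * (\<integral>b. v b * exp (h b) * (x * Q a b + R a b) \<partial>?ca) \<partial>?ca) =
    (\<integral>a. x * (v a * exp (h a) * ?iQ a) + v a * exp (h a) * ?iR a \<partial>?ca)"
  proof (intro Bochner_Integration.integral_cong refl)
    fix a assume "a \<in> space ?ca"
    then have a: "a \<in> A" by simp
    have "(\<integral>b. v b * exp (h b) * (x * Q a b + R a b) \<partial>?ca) = (\<integral>b. x * (v b * exp (h b) * Q a b) + v b * exp (h b) * R a b \<partial>?ca)"
      by (intro Bochner_Integration.integral_cong refl) (simp add: algebra_simps)
    also have "\<dots> = x * ?iQ a + ?iR a" using iQ[OF a] iR[OF a] by simp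
    finally show "v a * exp (h a) * (\<integral>b. v b * exp (h b) * (x * Q a b + R a b) \<partial>?ca) =
        x * (v a * exp (h a) * ?iQ a) + v a * exp (h a) * ?iR a" by (simp add: algebra_simps)
  qed
  also have "\<dots> = x * (\<integral>a. v a * exp (h a) * ?iQ a \<partial>?ca) + (\<integral>a. v a * exp (h a) * ?iR a \<partial>?ca)"
    using IQ IR by simp
  finally show ?thesis unfolding pair_average_def by (simp add: add_divide_distrib)
qed

lemma pair_average_const:
  assumes "partition_sum A v h \<noteq> 0"
  shows "pair_average A v h (\<lambda>_ _. c) = c"
  using assms unfolding pair_average_def partition_sum_def power2_eq_square by simp

lemma pair_average_cong:
  "(\<And>a. a \<in> A \<Longrightarrow> v a = v' a) \<Longrightarrow> (\<And>a. a \<in> A \<Longrightarrow> h a = h' a) \<Longrightarrow> (\<And>a b. a \<in> A \<Longrightarrow> b \<in> A \<Longrightarrow> Q a b = Q' a b) \<Longrightarrow>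
   pair_average A v h Q = pair_average A v' h' Q'"
  unfolding pair_average_def partition_sum_def
  by (intro arg_cong2[where f="(/)"] arg_cong2[where f="(^)"] Bochner_Integration.integral_cong arg_cong2[where f="(*)"]) auto

lemma partition_sum_tendsto:
  assumes i: "integrable (count_space A) (\<lambda>a. v a * exp (B a))" and v: "\<And>a. a \<in> A \<Longrightarrow> 0 \<le> v a"
    and B: "\<And>n a. a \<in> A \<Longrightarrow> h n a \<le> B a" and lim: "\<And>a. a \<in> A \<Longrightarrow> (\<lambda>n. h n a) \<longlonglongrightarrow> h0 a"
  shows "(\<lambda>n. partition_sum A v (h n)) \<longlonglongrightarrow> partition_sum A v h0"
  unfolding partition_sum_def
proof (rule integral_dominated_convergence[where w="\<lambda>a. v a * exp (B a)"])
  show "AE a in count_space A. (\<lambda>n. v a * exp (h n a)) \<longlonglongrightarrow> v a * exp (h0 a)"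
    using lim by (auto simp: AE_count_space intro!: tendsto_intros)
  show "AE a in count_space A. norm (v a * exp (h n a)) \<le> v a * exp (B a)" for n
    using B v by (auto simp: AE_count_space abs_mult intro!: mult_left_mono)
qed (use i in auto)

lemma weighted_sum_tendsto:
  fixes v :: "'b \<Rightarrow> real" and f :: "nat \<Rightarrow> 'b \<Rightarrow> real"
  assumes i: "integrable (count_space A) (\<lambda>a. v a * exp (B a))" and v: "\<And>a. a \<in> A \<Longrightarrow> 0 \<le> v a"
    and B: "\<And>n a. a \<in> A \<Longrightarrow> h n a \<le> B a" and lim: "\<And>a. a \<in> A \<Longrightarrow> (\<lambda>n. h n a) \<longlonglongrightarrow> h0 a"
    and f: "\<And>a n. a \<in> A \<Longrightarrow> \<bar>f n a\<bar> \<le> c" "\<And>a. a \<in> A \<Longrightarrow> (\<lambda>n. f n a) \<longlonglongrightarrow> f0 a"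
  shows "(\<lambda>n. \<integral>a. v a * exp (h n a) * f n a \<partial>count_space A) \<longlonglongrightarrow> (\<integral>a. v a * exp (h0 a) * f0 a \<partial>count_space A)"
proof (rule integral_dominated_convergence[where w="\<lambda>a. c * (v a * exp (B a))"])
  show "AE a in count_space A. (\<lambda>n. v a * exp (h n a) * f n a) \<longlonglongrightarrow> v a * exp (h0 a) * f0 a"
    using lim f(2) by (auto simp: AE_count_space intro!: tendsto_intros)
  have "\<bar>v a * exp (h n a) * f n a\<bar> \<le> c * (v a * exp (B a))" if "a \<in> A" for a n
  proof -
    have "\<bar>v a * exp (h n a) * f n a\<bar> = (v a * exp (h n a)) * \<bar>f n a\<bar>" using v[OF that] by (simp add: abs_mult)
    also have "\<dots> \<le> (v a * exp (B a)) * c"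
      using v[OF that] B[OF that] f(1)[OF that] by (intro mult_mono mult_left_mono) auto
    finally show ?thesis by (simp add: mult.commute)
  qed
  then show "AE a in count_space A. norm (v a * exp (h n a) * f n a) \<le> c * (v a * exp (B a))" for n
    by (auto simp: AE_count_space)
qed (use i in auto)

text \<open>Dominated convergence is used twice: the inner integrals converge for each
  \<open>a\<close> and are bounded uniformly by \<open>c * partition_sum A v B\<close>, so the outer
  integral converges too. The quotient is safe because the limiting normaliser is nonzero.\<close>

lemma pair_average_tendsto:
  assumes i: "integrable (count_space A) (\<lambda>a. v a * exp (B a))" and v: "\<And>a. a \<in> A \<Longrightarrow> 0 \<le> v a"
    and B: "\<And>n a. a \<in> A \<Longrightarrow> h n a \<le> B a" and lim: "\<And>a. a \<in> A \<Longrightarrow> (\<lambda>n. h n a) \<longlonglongrightarrow> h0 a"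
    and Q: "\<And>a b n. a \<in> A \<Longrightarrow> b \<in> A \<Longrightarrow> \<bar>Q n a b\<bar> \<le> c"
      "\<And>a b. a \<in> A \<Longrightarrow> b \<in> A \<Longrightarrow> (\<lambda>n. Q n a b) \<longlonglongrightarrow> Q0 a b" and c: "0 \<le> c"
    and Z: "partition_sum A v h0 \<noteq> 0"
  shows "(\<lambda>n. pair_average A v (h n) (Q n)) \<longlonglongrightarrow> pair_average A v h0 Q0"
  unfolding pair_average_def
proof (intro tendsto_divide tendsto_power)
  have ih: "integrable (count_space A) (\<lambda>a. v a * exp (h n a))" for n
    using integrable_weights[OF i v B] .
  have le: "partition_sum A v (h n) \<le> partition_sum A v B" for n
    unfolding partition_sum_def using ih i B v by (intro integral_mono) (auto intro!: mult_left_mono)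
  show "(\<lambda>n. partition_sum A v (h n)) \<longlonglongrightarrow> partition_sum A v h0"
    using assms by (intro partition_sum_tendsto) auto
  show "(\<lambda>n. \<integral>a. v a * exp (h n a) * (\<integral>b. v b * exp (h n b) * Q n a b \<partial>count_space A) \<partial>count_space A)
     \<longlonglongrightarrow> (\<integral>a. v a * exp (h0 a) * (\<integral>b. v b * exp (h0 b) * Q0 a b \<partial>count_space A) \<partial>count_space A)"
  proof (rule weighted_sum_tendsto[OF i v B lim, where c="c * partition_sum A v B"])
    fix a assume a: "a \<in> A"
    show "\<bar>\<integral>b. v b * exp (h n b) * Q n a b \<partial>count_space A\<bar> \<le> c * partition_sum A v B" for n
      using inner_bound[OF ih v Q(1)[OF a]] mult_left_mono[OF le c] by (meson order_trans)
    show "(\<lambda>n. \<integral>b. v b * exp (h n b) * Q n a b \<partial>count_space A) \<longlonglongrightarrow> (\<integral>b. v b * exp (h0 b) * Q0 a b \<partial>count_space A)"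
      by (rule weighted_sum_tendsto[OF i v B lim Q(1)[OF a] Q(2)[OF a]])
  qed
qed (use Z in simp)

text \<open>Both signs rest on \<open>ln x \<le> x - 1\<close>. For the upper bound \<open>x\<close>
  is the partition sum \<open>Z\<close>; for the lower bound it is \<open>1 / Z\<close>, which is at
  most the partition sum of \<open>- h\<close> by an inequality of Cauchy-Schwarz type in which the
  total weight of at least 1 enters.\<close>

lemma abs_ln_partition_sum_le:
  assumes i: "integrable (count_space A) (\<lambda>a. v a * exp (B a))" and v: "\<And>a. a \<in> A \<Longrightarrow> 0 \<le> v a"
    and h: "\<And>a. a \<in> A \<Longrightarrow> \<bar>h a\<bar> \<le> B a" and one: "1 \<le> (\<integral>a. v a \<partial>count_space A)"
    and Z: "0 < partition_sum A v h"
  shows "\<bar>ln (partition_sum A v h)\<bar> \<le> partition_sum A v B"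
proof -
  have ih: "integrable (count_space A) (\<lambda>a. v a * exp (h a))" "integrable (count_space A) (\<lambda>a. v a * exp (- h a))"
    using integrable_weights[OF i v, of h] integrable_weights[OF i v, of "\<lambda>a. - h a"] h by (auto simp: abs_le_iff)
  have iv: "integrable (count_space A) v"
    using integrable_weights[OF i v, of "\<lambda>_. 0"] order_trans[OF abs_ge_zero h] by simp
  let ?Z = "partition_sum A v h" and ?D = "partition_sum A v B"
  have le: "?Z \<le> ?D" "partition_sum A v (\<lambda>a. - h a) \<le> ?D"
    unfolding partition_sum_def using ih i h v by (intro integral_mono; fastforce intro!: mult_left_mono simp: abs_le_iff)+
  \<comment> \<open>\<open>exp (- x) \<ge> 2 l - l\<^sup>2 exp x\<close> with \<open>l = 1 / Z\<close> bounds \<open>1 / Z\<close> by the partition sum of \<open>- h\<close>\<close>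
  have "1 / ?Z \<le> (2 / ?Z) * (\<integral>a. v a \<partial>count_space A) - (1 / ?Z)\<^sup>2 * ?Z"
    using mult_left_mono[OF one, of "2 / ?Z"] Z by (simp add: power2_eq_square)
  also have "\<dots> = (\<integral>a. (2 / ?Z) * v a - (1 / ?Z)\<^sup>2 * (v a * exp (h a)) \<partial>count_space A)"
    using iv ih unfolding partition_sum_def by simp
  also have "\<dots> \<le> partition_sum A v (\<lambda>a. - h a)"
    unfolding partition_sum_def[of A v "\<lambda>a. - h a"]
  proof (rule integral_mono)
    fix a assume "a \<in> space (count_space A)"
    then have a: "a \<in> A" by simp
    define l where "l = 1 / ?Z"
    have "0 \<le> (1 - l * exp (h a))\<^sup>2 * exp (- h a)" by simp
    also have "\<dots> = exp (- h a) - 2 * l * (exp (h a) * exp (- h a)) + l\<^sup>2 * exp (h a) * (exp (h a) * exp (- h a))"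
      by (simp add: power2_eq_square algebra_simps)
    also have "exp (h a) * exp (- h a) = 1" by (simp add: exp_minus)
    finally have "2 * l - l\<^sup>2 * exp (h a) \<le> exp (- h a)" by simp
    then have "v a * (2 * l - l\<^sup>2 * exp (h a)) \<le> v a * exp (- h a)" using v[OF a] by (rule mult_left_mono)
    then show "(2 / ?Z) * v a - (1 / ?Z)\<^sup>2 * (v a * exp (h a)) \<le> v a * exp (- h a)"
      by (simp add: l_def algebra_simps)
  qed (use iv ih in auto)
  also have "\<dots> \<le> ?D" by (rule le)
  finally have "1 / ?Z \<le> ?D" .
  moreover have "ln ?Z \<le> ?Z - 1" using ln_le_minus_one[OF Z] .
  moreover have "ln (1 / ?Z) \<le> 1 / ?Z - 1" using Z by (intro ln_le_minus_one) simp
  moreover have "ln (1 / ?Z) = - ln ?Z" using Z by (simp add: ln_div)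
  ultimately show ?thesis using le by (simp add: abs_le_iff)
qed

section \<open>Infinite sums as integrals over counting measures\<close>

lemma integrable_count_space_iff_summable:
  fixes f :: "'b \<Rightarrow> real"
  shows "integrable (count_space A) f \<longleftrightarrow> f summable_on A"
  using summable_on_iff_abs_summable_on_real[of f A] abs_summable_equivalent[of f A]
    Infinite_Set_Sum.abs_summable_on_def[of f A] by blast

text \<open>Without summability both sides are 0 by convention, so the definitions of the model may
  be rewritten at every \<omega>.\<close>

lemma infsum_eq_lebesgue_integral:
  fixes f :: "'b \<Rightarrow> real"
  shows "(\<Sum>\<^sub>\<infinity>x\<in>A. f x) = (\<integral>x. f x \<partial>count_space A)"
proof (cases "integrable (count_space A) f")
  case True
  then show ?thesis using infsetsum_infsum[of f A]
    by (simp add: infsetsum_def Infinite_Set_Sum.abs_summable_on_def)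
next
  case False
  then have "\<not> f summable_on A"
    by (simp add: integrable_count_space_iff_summable)
  then show ?thesis using False
    by (simp add: infsum_not_exists not_integrable_integral_eq)
qed

lemma measurable_count_space_integral:
  fixes f :: "'b \<Rightarrow> 'a \<Rightarrow> real"
  assumes A: "countable A" and f: "\<And>a. a \<in> A \<Longrightarrow> f a \<in> borel_measurable M"
  shows "(\<lambda>\<omega>. \<integral>a. f a \<omega> \<partial>count_space A) \<in> borel_measurable M"
proof -
  interpret sigma_finite_measure "count_space A" using A by (rule sigma_finite_measure_count_space_countable)
  have 1: "(\<lambda>x. f (fst x) (snd x)) \<in> borel_measurable (count_space A \<Otimes>\<^sub>M M)"
    by (rule measurable_pair_measure_countable1[OF A]) (use f in simp)
  have "(\<lambda>x. f (snd x) (fst x)) \<in> borel_measurable (M \<Otimes>\<^sub>M count_space A)"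
    using measurable_compose[OF measurable_pair_swap' 1] by (simp add: case_prod_beta')
  then show ?thesis by (intro borel_measurable_lebesgue_integral) (simp add: case_prod_beta')
qed

text \<open>The \<open>max 0\<close> records that \<open>ennreal\<close> cuts off negative values.
  The formula therefore holds for every realisation of the Gibbs weights and can serve for
  measurability before any almost sure property.\<close>

lemma integral_point_measure_pair:
  fixes p :: "'b \<Rightarrow> real" and f :: "'b \<times> 'b \<Rightarrow> real"
  assumes A: "countable A"
  shows "(\<integral>x. f x \<partial>(point_measure A (\<lambda>a. ennreal (p a)) \<Otimes>\<^sub>M point_measure A (\<lambda>a. ennreal (p a)))) =
     (\<integral>x. max 0 (p (fst x)) * max 0 (p (snd x)) * f x \<partial>count_space (A \<times> A))"
proof -
  have sf: "sigma_finite_measure (density (count_space A) (\<lambda>a. ennreal (p a)))"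
    using A sigma_finite_measure.sigma_finite_iff_density_finite[OF sigma_finite_measure_count_space_countable[OF A], of "\<lambda>a. ennreal (p a)"]
    by (simp add: AE_count_space)
  have "point_measure A (\<lambda>a. ennreal (p a)) \<Otimes>\<^sub>M point_measure A (\<lambda>a. ennreal (p a)) =
      density (count_space (A \<times> A)) (\<lambda>(x, y). ennreal (p x) * ennreal (p y))"
    unfolding point_measure_def pair_measure_countable[OF A A, symmetric]
    by (rule pair_measure_density) (use sf A in \<open>auto intro: sigma_finite_measure_count_space_countable\<close>)
  also have "\<dots> = density (count_space (A \<times> A)) (\<lambda>x. ennreal (max 0 (p (fst x)) * max 0 (p (snd x))))"
    by (intro density_cong) (auto simp: AE_count_space ennreal_mult' max_def ennreal_neg)
  finally show ?thesis
    by (simp add: integral_density)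
qed

lemma integral_count_space_product:
  fixes p :: "'b \<Rightarrow> real" and f :: "'b \<times> 'b \<Rightarrow> real"
  assumes A: "countable A" and p: "integrable (count_space A) p" "\<And>a. a \<in> A \<Longrightarrow> 0 \<le> p a"
    and f: "\<And>a b. a \<in> A \<Longrightarrow> b \<in> A \<Longrightarrow> \<bar>f (a, b)\<bar> \<le> c"
  shows "(\<integral>x. max 0 (p (fst x)) * max 0 (p (snd x)) * f x \<partial>count_space (A \<times> A)) =
    (\<integral>a. p a * (\<integral>b. p b * f (a, b) \<partial>count_space A) \<partial>count_space A)"
proof -
  interpret sigma_finite_measure "count_space A" using A by (rule sigma_finite_measure_count_space_countable)
  interpret P: pair_sigma_finite "count_space A" "count_space A" ..
  have i: "integrable (count_space A \<Otimes>\<^sub>M count_space A) (\<lambda>(a, b). p a * p b)"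
  proof (rule P.Fubini_integrable)
    show "(\<lambda>(a, b). p a * p b) \<in> borel_measurable (count_space A \<Otimes>\<^sub>M count_space A)"
      unfolding pair_measure_countable[OF A A] by simp
    have "(\<integral>b. norm (p a * p b) \<partial>count_space A) = \<bar>p a\<bar> * (\<integral>b. \<bar>p b\<bar> \<partial>count_space A)" for a
      by (simp add: abs_mult)
    then show "integrable (count_space A) (\<lambda>x. \<integral>y. norm (case (x, y) of (a, b) \<Rightarrow> p a * p b) \<partial>count_space A)"
      using p(1) by simp
    show "AE x in count_space A. integrable (count_space A) (\<lambda>y. case (x, y) of (a, b) \<Rightarrow> p a * p b)"
      using p(1) by (auto simp: AE_count_space)
  qed
  have i2: "integrable (count_space A \<Otimes>\<^sub>M count_space A) (\<lambda>(a, b). p a * p b * f (a, b))"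
  proof (rule Bochner_Integration.integrable_bound)
    show "integrable (count_space A \<Otimes>\<^sub>M count_space A) (\<lambda>x. c * (case x of (a, b) \<Rightarrow> p a * p b))" using i by simp
    have "\<bar>p a * p b * f (a, b)\<bar> \<le> \<bar>c * (p a * p b)\<bar>" if "a \<in> A" "b \<in> A" for a b
    proof -
      have "(p a * p b) * \<bar>f (a, b)\<bar> \<le> (p a * p b) * \<bar>c\<bar>"
        using p(2) that order_trans[OF f[OF that] abs_ge_self] by (intro mult_left_mono) auto
      then show ?thesis using p(2) that by (simp add: abs_mult mult_ac)
    qed
    then show "AE x in count_space A \<Otimes>\<^sub>M count_space A. norm (case x of (a, b) \<Rightarrow> p a * p b * f (a, b)) \<le>
        norm (c * (case x of (a, b) \<Rightarrow> p a * p b))"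
      unfolding pair_measure_countable[OF A A] by (auto simp: AE_count_space)
  qed (simp add: pair_measure_countable[OF A A])
  have "(\<integral>x. max 0 (p (fst x)) * max 0 (p (snd x)) * f x \<partial>count_space (A \<times> A)) =
      (\<integral>x. (case x of (a, b) \<Rightarrow> p a * p b * f (a, b)) \<partial>(count_space A \<Otimes>\<^sub>M count_space A))"
    unfolding pair_measure_countable[OF A A]
    by (intro Bochner_Integration.integral_cong refl) (use p(2) in \<open>auto simp: max_def\<close>)
  also have "\<dots> = (\<integral>a. (\<integral>b. p a * p b * f (a, b) \<partial>count_space A) \<partial>count_space A)"
    using P.integral_fst'[OF i2] by simp
  finally show ?thesis by (simp add: mult.assoc)
qed

subsection \<open>Truncation of the cavity fields\<close>

context interpolation_model
begin

abbreviation pairs :: "((nat \<Rightarrow> real) \<times> nat list) set" where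
  "pairs \<equiv> spins N \<times> leaves k"

abbreviation w :: "'a \<Rightarrow> (nat \<Rightarrow> real) \<times> nat list \<Rightarrow> real" where
  "w \<omega> a \<equiv> cascade_w k u \<omega> (snd a)"

text \<open>The cavity fields are switched off at the leaves outside \<open>S\<close>, so that for finite \<open>S\<close>
  only finitely many Gaussian variables remain while the cascade keeps its total mass.\<close>

definition cut_field :: "nat list set \<Rightarrow> 'a \<Rightarrow> (nat \<Rightarrow> real) \<times> nat list \<Rightarrow> real" where
  "cut_field S \<omega> a = (if snd a \<in> S then cavity (snd a) (fst a) \<omega> else 0)"

definition cut_H :: "nat list set \<Rightarrow> real \<Rightarrow> 'a \<Rightarrow> (nat \<Rightarrow> real) \<times> nat list \<Rightarrow> real" where
  "cut_H S t \<omega> a = sqrt t * H (fst a) \<omega> + sqrt (1 - t) * cut_field S \<omega> a"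

text \<open>The covariance of \<open>H\<close> minus that of the truncated cavity field: the
  function \<open>D\<close> of \<open>has_derivative_expectation_ln\<close>.\<close>

definition cut_cov :: "nat list set \<Rightarrow> (nat \<Rightarrow> real) \<times> nat list \<Rightarrow> (nat \<Rightarrow> real) \<times> nat list \<Rightarrow> real" where
  "cut_cov S a b = real N * \<xi> (overlap N (fst a) (fst b)) -
     (if snd a \<in> S \<and> snd b \<in> S
      then real N * overlap N (fst a) (fst b) * deriv \<xi> (q (wedge k (snd a) (snd b))) else 0)"

text \<open>The two-replica integrand left by integration by parts: half the self-term of the first
  replica minus half the cross term.\<close>

definition cut_slope :: "nat list set \<Rightarrow> (nat \<Rightarrow> real) \<times> nat list \<Rightarrow> (nat \<Rightarrow> real) \<times> nat list \<Rightarrow> real" where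
  "cut_slope S a b = (cut_cov S a a - cut_cov S a b) / 2"

text \<open>One majorant of the Hamiltonian for all truncations and all times in the unit interval
  at once, as both square roots are at most 1.\<close>

definition envelope :: "'a \<Rightarrow> (nat \<Rightarrow> real) \<times> nat list \<Rightarrow> real" where
  "envelope \<omega> a = \<bar>H (fst a) \<omega>\<bar> + \<bar>cavity (snd a) (fst a) \<omega>\<bar>"

definition free_energy :: "nat list set \<Rightarrow> real \<Rightarrow> real" where
  "free_energy S t = (\<integral>\<omega>. ln (partition_sum pairs (w \<omega>) (cut_H S t \<omega>)) \<partial>M)"

definition slope :: "nat list set \<Rightarrow> real \<Rightarrow> real" where
  "slope S t = (\<integral>\<omega>. pair_average pairs (w \<omega>) (cut_H S t \<omega>) (cut_slope S) \<partial>M)"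

lemma countable_pairs: "countable pairs"
  using countable_finite[OF finite_spins] countable_leaves by (rule countable_SIGMA)

lemma cascade_w_measurable:
  assumes "\<And>p n. length p < k \<Longrightarrow> u (p @ [n]) \<in> borel_measurable L" and \<alpha>: "\<alpha> \<in> leaves k"
  shows "(\<lambda>\<omega>. cascade_w k u \<omega> \<alpha>) \<in> borel_measurable L"
proof -
  have v: "(\<lambda>\<omega>. cascade_v k u \<omega> \<beta>) \<in> borel_measurable L" if "\<beta> \<in> leaves k" for \<beta>
    unfolding cascade_v_def
  proof (intro borel_measurable_prod)
    fix l assume l: "l \<in> {1..k}"
    then have "take l \<beta> = take (l - 1) \<beta> @ [\<beta> ! (l - 1)]"
      using that take_Suc_conv_app_nth[of "l - 1" \<beta>] by (auto simp: leaves_def)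
    moreover have "length (take (l - 1) \<beta>) < k" using l that by (auto simp: leaves_def)
    ultimately show "u (take l \<beta>) \<in> borel_measurable L" using assms(1) by metis
  qed
  show ?thesis unfolding cascade_w_def infsum_eq_lebesgue_integral
    by (intro borel_measurable_divide v \<alpha> measurable_count_space_integral countable_leaves)
qed

lemma cascade_w_alg: "\<alpha> \<in> leaves k \<Longrightarrow> (\<lambda>\<omega>. cascade_w k u \<omega> \<alpha>) \<in> borel_measurable (alg point_sources)"
  by (rule cascade_w_measurable) (auto intro!: measurable_source(3) simp: point_sources_def)

lemma cascade_w_measurable_M[measurable]: "\<alpha> \<in> leaves k \<Longrightarrow> (\<lambda>\<omega>. cascade_w k u \<omega> \<alpha>) \<in> borel_measurable M"
  using measurable_algD[OF sources_subsets(2) cascade_w_alg] .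

lemma cavity_measurable[measurable]: "cavity \<alpha> \<sigma> \<in> borel_measurable M"
  using cavity_GS by (rule G_measurable)

lemma H_measurable[measurable]: "\<sigma> \<in> spins N \<Longrightarrow> H \<sigma> \<in> borel_measurable M"
  using H_GS G_measurable by blast

lemma cut_H_measurable[measurable]: "a \<in> pairs \<Longrightarrow> (\<lambda>\<omega>. cut_H S t \<omega> a) \<in> borel_measurable M"
  unfolding cut_H_def cut_field_def by (cases "snd a \<in> S") auto

lemma weight_measurable:
  assumes "a \<in> pairs"
  shows "(\<lambda>\<omega>. w \<omega> a * exp (cut_H S t \<omega> a)) \<in> borel_measurable M"
proof -
  have [measurable]: "(\<lambda>\<omega>. w \<omega> a) \<in> borel_measurable M" using assms by auto
  show ?thesis using assms by measurable
qed

lemma partition_sum_measurable[measurable]: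
  "(\<lambda>\<omega>. partition_sum pairs (w \<omega>) (cut_H S t \<omega>)) \<in> borel_measurable M"
  unfolding partition_sum_def
  by (intro measurable_count_space_integral countable_pairs weight_measurable)

lemma pair_average_measurable[measurable]:
  "(\<lambda>\<omega>. pair_average pairs (w \<omega>) (cut_H S t \<omega>) Q) \<in> borel_measurable M"
  unfolding pair_average_def
  by (intro borel_measurable_divide borel_measurable_power partition_sum_measurable measurable_count_space_integral
      countable_pairs borel_measurable_times[OF weight_measurable] weight_measurable borel_measurable_const)

text \<open>The exponential of a sum of absolute values is at most the sum over the four sign
  patterns, whence the factor 4. Each pattern is Gaussian with variance
  \<open>N * (\<xi> 1 + deriv \<xi> 1)\<close>, the same at every leaf, and is independent of the
  weight.\<close>

lemma envelope_moment:
  assumes a: "a \<in> pairs"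
  shows "(\<integral>\<^sup>+\<omega>. ennreal \<bar>w \<omega> a\<bar> * ennreal (exp (envelope \<omega> a)) \<partial>M) \<le>
    ennreal (4 * exp (real N * (\<xi> 1 + deriv \<xi> 1) / 2)) * (\<integral>\<^sup>+\<omega>. ennreal \<bar>w \<omega> a\<bar> \<partial>M)"
proof -
  obtain \<sigma> \<alpha> where aa: "a = (\<sigma>, \<alpha>)" "\<sigma> \<in> spins N" "\<alpha> \<in> leaves k" using a by auto
  let ?X = "H \<sigma>" and ?Y = "cavity \<alpha> \<sigma>"
  let ?V = "real N * (\<xi> 1 + deriv \<xi> 1)"
  have X: "?X \<in> GS" and Y: "?Y \<in> GS" using aa H_GS cavity_GS by auto
  have [measurable]: "(\<lambda>\<omega>. w \<omega> a) \<in> borel_measurable M" using a by auto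
  have [measurable]: "?X \<in> borel_measurable M" using aa by measurable
  have var: "(\<integral>\<omega>. (c * ?X \<omega> + d * ?Y \<omega>)\<^sup>2 \<partial>M) = ?V" if "c\<^sup>2 = 1" "d\<^sup>2 = 1" for c d
  proof -
    have "(\<integral>\<omega>. (c * ?X \<omega> + d * ?Y \<omega>)\<^sup>2 \<partial>M) =
        (\<integral>\<omega>. ?X \<omega> * ?X \<omega> + ?Y \<omega> * ?Y \<omega> + (2 * c * d) * (?X \<omega> * ?Y \<omega>) \<partial>M)"
    proof (intro Bochner_Integration.integral_cong refl)
      fix \<omega>
      have "(c * ?X \<omega> + d * ?Y \<omega>)\<^sup>2 = c\<^sup>2 * (?X \<omega> * ?X \<omega>) + d\<^sup>2 * (?Y \<omega> * ?Y \<omega>) + (2 * c * d) * (?X \<omega> * ?Y \<omega>)"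
        by (simp add: power2_eq_square algebra_simps)
      then show "(c * ?X \<omega> + d * ?Y \<omega>)\<^sup>2 = ?X \<omega> * ?X \<omega> + ?Y \<omega> * ?Y \<omega> + (2 * c * d) * (?X \<omega> * ?Y \<omega>)"
        using that by simp
    qed
    also have "\<dots> = (\<integral>\<omega>. ?X \<omega> * ?X \<omega> \<partial>M) + (\<integral>\<omega>. ?Y \<omega> * ?Y \<omega> \<partial>M) + (2 * c * d) * (\<integral>\<omega>. ?X \<omega> * ?Y \<omega> \<partial>M)"
      using G_prod_integrable[OF X X] G_prod_integrable[OF Y Y] G_prod_integrable[OF X Y] by simp
    also have "\<dots> = ?V"
      using aa H_cov[OF aa(2) aa(2)] cov_cavity[OF aa(3) aa(3)] cov_H_cavity[OF aa(2)] overlap_self[OF aa(2) N] q1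
      by (simp add: wedge_def distrib_left)
    finally show ?thesis .
  qed
  have E: "(\<integral>\<^sup>+\<omega>. ennreal \<bar>w \<omega> a\<bar> * ennreal (exp (c * ?X \<omega> + d * ?Y \<omega>)) \<partial>M) =
      ennreal (exp (?V / 2)) * (\<integral>\<^sup>+\<omega>. ennreal \<bar>w \<omega> a\<bar> \<partial>M)" if cd: "c\<^sup>2 = 1" "d\<^sup>2 = 1" for c d
  proof -
    have L: "(\<lambda>\<omega>. c * ?X \<omega> + d * ?Y \<omega>) \<in> GS" using lin[OF X G_mult[OF Y]] .
    have "(\<integral>\<^sup>+\<omega>. ennreal (exp (c * ?X \<omega> + d * ?Y \<omega>)) * ennreal \<bar>w \<omega> a\<bar> \<partial>M) =
       (\<integral>\<^sup>+\<omega>. ennreal (exp (c * ?X \<omega> + d * ?Y \<omega>)) \<partial>M) * (\<integral>\<^sup>+\<omega>. ennreal \<bar>w \<omega> a\<bar> \<partial>M)"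
    proof (rule nn_integral_indep[OF sources_subsets])
      show "(\<lambda>\<omega>. ennreal (exp (c * ?X \<omega> + d * ?Y \<omega>))) \<in> borel_measurable (alg gauss_sources)"
        using measurable_compose[OF GS_alg[OF L], of "\<lambda>x. ennreal (exp x)" borel] by simp
      show "(\<lambda>\<omega>. ennreal \<bar>w \<omega> a\<bar>) \<in> borel_measurable (alg point_sources)"
        using cascade_w_alg[of "snd a"] a by auto
    qed
    also have "(\<integral>\<^sup>+\<omega>. ennreal (exp (c * ?X \<omega> + d * ?Y \<omega>)) \<partial>M) = ennreal (exp (?V / 2))"
    proof -
      have cg: "centered_gaussian M ?V (\<lambda>\<omega>. c * ?X \<omega> + d * ?Y \<omega>)" using centered[OF L] var[OF cd] by simp
      show ?thesis
        using centered_gaussian_nn_integral[OF cg, of "\<lambda>x. ennreal (exp x)"] nn_integral_exp_std_normal[of "sqrt ?V"]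
          centered_gaussianD(1)[OF cg] by simp
    qed
    finally show ?thesis by (simp add: mult.commute)
  qed
  let ?I = "{1, -1 :: real} \<times> {1, -1 :: real}"
  have pt: "exp (\<bar>x\<bar> + \<bar>y\<bar>) \<le> (\<Sum>(c, d)\<in>?I. exp (c * x + d * y))" for x y :: real
  proof -
    define c d where "c = (if 0 \<le> x then 1 else - 1 :: real)" and "d = (if 0 \<le> y then 1 else - 1 :: real)"
    have "\<bar>x\<bar> + \<bar>y\<bar> = c * x + d * y" by (simp add: c_def d_def)
    moreover have "(c, d) \<in> ?I" by (simp add: c_def d_def)
    ultimately show ?thesis
      using member_le_sum[of "(c, d)" ?I "\<lambda>(c, d). exp (c * x + d * y)"] by (simp only: finite.intros finite_cartesian_product split_beta fst_conv snd_conv exp_ge_zero simp_thms)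
  qed
  have "(\<integral>\<^sup>+\<omega>. ennreal \<bar>w \<omega> a\<bar> * ennreal (exp (envelope \<omega> a)) \<partial>M) \<le>
    (\<integral>\<^sup>+\<omega>. (\<Sum>(c, d)\<in>?I. ennreal \<bar>w \<omega> a\<bar> * ennreal (exp (c * ?X \<omega> + d * ?Y \<omega>))) \<partial>M)"
  proof (intro nn_integral_mono)
    fix \<omega>
    have "ennreal (exp (envelope \<omega> a)) \<le> ennreal (\<Sum>(c, d)\<in>?I. exp (c * ?X \<omega> + d * ?Y \<omega>))"
      unfolding envelope_def aa(1) fst_conv snd_conv by (intro ennreal_leI pt)
    also have "\<dots> = (\<Sum>(c, d)\<in>?I. ennreal (exp (c * ?X \<omega> + d * ?Y \<omega>)))"
      unfolding split_beta by (intro sum_ennreal[symmetric]) (rule exp_ge_zero)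
    finally have "ennreal \<bar>w \<omega> a\<bar> * ennreal (exp (envelope \<omega> a)) \<le>
        ennreal \<bar>w \<omega> a\<bar> * (\<Sum>(c, d)\<in>?I. ennreal (exp (c * ?X \<omega> + d * ?Y \<omega>)))"
      by (rule mult_left_mono) (rule zero_le)
    then show "ennreal \<bar>w \<omega> a\<bar> * ennreal (exp (envelope \<omega> a)) \<le>
        (\<Sum>(c, d)\<in>?I. ennreal \<bar>w \<omega> a\<bar> * ennreal (exp (c * ?X \<omega> + d * ?Y \<omega>)))"
      unfolding split_beta sum_distrib_left .
  qed
  also have "\<dots> = (\<Sum>(c, d)\<in>?I. \<integral>\<^sup>+\<omega>. ennreal \<bar>w \<omega> a\<bar> * ennreal (exp (c * ?X \<omega> + d * ?Y \<omega>)) \<partial>M)"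
    unfolding split_beta by (rule nn_integral_sum) measurable
  also have "\<dots> = (\<Sum>(c, d)\<in>?I. ennreal (exp (?V / 2)) * (\<integral>\<^sup>+\<omega>. ennreal \<bar>w \<omega> a\<bar> \<partial>M))"
  proof (rule sum.cong[OF refl])
    fix x assume "x \<in> ?I"
    then have "(fst x)\<^sup>2 = 1" "(snd x)\<^sup>2 = 1" by auto
    then show "(case x of (c, d) \<Rightarrow> \<integral>\<^sup>+\<omega>. ennreal \<bar>w \<omega> a\<bar> * ennreal (exp (c * ?X \<omega> + d * ?Y \<omega>)) \<partial>M) =
       (case x of (c, d) \<Rightarrow> ennreal (exp (?V / 2)) * (\<integral>\<^sup>+\<omega>. ennreal \<bar>w \<omega> a\<bar> \<partial>M))"
      unfolding split_beta by (rule E)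
  qed
  also have "\<dots> = of_nat (card ?I) * (ennreal (exp (?V / 2)) * (\<integral>\<^sup>+\<omega>. ennreal \<bar>w \<omega> a\<bar> \<partial>M))"
    unfolding split_beta by (rule sum_constant)
  also have "card ?I = 4" by simp
  also have "of_nat 4 * (ennreal (exp (?V / 2)) * (\<integral>\<^sup>+\<omega>. ennreal \<bar>w \<omega> a\<bar> \<partial>M)) =
      ennreal (4 * exp (?V / 2)) * (\<integral>\<^sup>+\<omega>. ennreal \<bar>w \<omega> a\<bar> \<partial>M)"
    by (simp add: ennreal_mult mult.assoc)
  finally show ?thesis .
qed

lemma sum_w_eq_1: "AE \<omega> in M. (\<integral>\<^sup>+\<alpha>. ennreal \<bar>cascade_w k u \<omega> \<alpha>\<bar> \<partial>count_space (leaves k)) = 1"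
  using cascade_w
proof eventually_elim
  case (elim \<omega>)
  have "cascade_w k u \<omega> summable_on leaves k" using elim has_sum_imp_summable by blast
  then have i: "integrable (count_space (leaves k)) (cascade_w k u \<omega>)"
    by (simp add: integrable_count_space_iff_summable)
  have "(\<integral>\<^sup>+\<alpha>. ennreal \<bar>cascade_w k u \<omega> \<alpha>\<bar> \<partial>count_space (leaves k)) = (\<integral>\<^sup>+\<alpha>. ennreal (cascade_w k u \<omega> \<alpha>) \<partial>count_space (leaves k))"
    using elim by (intro nn_integral_cong) (auto simp: abs_of_pos)
  also have "\<dots> = ennreal (\<integral>\<alpha>. cascade_w k u \<omega> \<alpha> \<partial>count_space (leaves k))"
    using i elim by (intro nn_integral_eq_integral) (auto simp: AE_count_space intro: less_imp_le)
  also have "\<dots> = 1" unfolding infsum_eq_lebesgue_integral[symmetric] using elim infsumI by fastforce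
  finally show ?case .
qed

lemma nn_integral_count_space_swap:
  fixes f :: "'b \<Rightarrow> 'a \<Rightarrow> ennreal"
  assumes A: "countable A" and f: "\<And>a. a \<in> A \<Longrightarrow> f a \<in> borel_measurable M"
  shows "(\<integral>\<^sup>+\<omega>. (\<integral>\<^sup>+a. f a \<omega> \<partial>count_space A) \<partial>M) = (\<integral>\<^sup>+a. (\<integral>\<^sup>+\<omega>. f a \<omega> \<partial>M) \<partial>count_space A)"
proof -
  interpret C: sigma_finite_measure "count_space A" using A by (rule sigma_finite_measure_count_space_countable)
  interpret P: pair_sigma_finite "count_space A" M ..
  have "(\<lambda>x. f (fst x) (snd x)) \<in> borel_measurable (count_space A \<Otimes>\<^sub>M M)"
    by (rule measurable_pair_measure_countable1[OF A]) (use f in simp)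
  then show ?thesis by (intro P.Fubini') (simp add: case_prod_beta')
qed

text \<open>Because the Gaussian factor does not depend on the leaf, the mean weights can be summed
  over the leaves to 1; only the finite number of spin configurations remains.\<close>

lemma nn_integral_envelope_finite:
  "(\<integral>\<^sup>+\<omega>. (\<integral>\<^sup>+a. ennreal \<bar>w \<omega> a\<bar> * ennreal (exp (envelope \<omega> a)) \<partial>count_space pairs) \<partial>M) < \<infinity>"
proof -
  let ?C = "ennreal (4 * exp (real N * (\<xi> 1 + deriv \<xi> 1) / 2))"
  have wm[measurable]: "(\<lambda>\<omega>. w \<omega> a) \<in> borel_measurable M" if "a \<in> pairs" for a using that by auto
  have em[measurable]: "(\<lambda>\<omega>. envelope \<omega> a) \<in> borel_measurable M" if "a \<in> pairs" for a
    using that unfolding envelope_def by (intro borel_measurable_add borel_measurable_abs) auto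
  have "(\<integral>\<^sup>+\<omega>. (\<integral>\<^sup>+a. ennreal \<bar>w \<omega> a\<bar> * ennreal (exp (envelope \<omega> a)) \<partial>count_space pairs) \<partial>M) =
    (\<integral>\<^sup>+a. (\<integral>\<^sup>+\<omega>. ennreal \<bar>w \<omega> a\<bar> * ennreal (exp (envelope \<omega> a)) \<partial>M) \<partial>count_space pairs)"
    by (rule nn_integral_count_space_swap[OF countable_pairs]) measurable
  also have "\<dots> \<le> (\<integral>\<^sup>+a. ?C * (\<integral>\<^sup>+\<omega>. ennreal \<bar>w \<omega> a\<bar> \<partial>M) \<partial>count_space pairs)"
    by (intro nn_integral_mono envelope_moment) simp
  also have "\<dots> = ?C * (\<integral>\<^sup>+a. (\<integral>\<^sup>+\<omega>. ennreal \<bar>w \<omega> a\<bar> \<partial>M) \<partial>count_space pairs)"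
    by (rule nn_integral_cmult) simp
  also have "(\<integral>\<^sup>+a. (\<integral>\<^sup>+\<omega>. ennreal \<bar>w \<omega> a\<bar> \<partial>M) \<partial>count_space pairs) =
      (\<integral>\<^sup>+\<sigma>. (\<integral>\<^sup>+\<alpha>. (\<integral>\<^sup>+\<omega>. ennreal \<bar>cascade_w k u \<omega> \<alpha>\<bar> \<partial>M) \<partial>count_space (leaves k)) \<partial>count_space (spins N))"
  proof -
    interpret L: sigma_finite_measure "count_space (leaves k)"
      by (rule sigma_finite_measure_count_space_countable[OF countable_leaves])
    show ?thesis
      unfolding pair_measure_countable[OF countable_finite[OF finite_spins] countable_leaves, symmetric]
      by (subst L.nn_integral_fst[symmetric])
         (auto simp: pair_measure_countable[OF countable_finite[OF finite_spins] countable_leaves])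
  qed
  also have "(\<integral>\<^sup>+\<alpha>. (\<integral>\<^sup>+\<omega>. ennreal \<bar>cascade_w k u \<omega> \<alpha>\<bar> \<partial>M) \<partial>count_space (leaves k)) =
      (\<integral>\<^sup>+\<omega>. (\<integral>\<^sup>+\<alpha>. ennreal \<bar>cascade_w k u \<omega> \<alpha>\<bar> \<partial>count_space (leaves k)) \<partial>M)"
    by (rule nn_integral_count_space_swap[OF countable_leaves, symmetric]) measurable
  also have "\<dots> = (\<integral>\<^sup>+\<omega>. 1 \<partial>M)" using sum_w_eq_1 by (rule nn_integral_cong_AE)
  also have "(\<integral>\<^sup>+\<omega>. 1 \<partial>M) = (1 :: ennreal)" by (simp add: emeasure_space_1)
  also have "(\<integral>\<^sup>+\<sigma>. 1 \<partial>count_space (spins N)) = ennreal (real (card (spins N)))"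
    using finite_spins by (simp add: nn_integral_count_space_finite ennreal_of_nat_eq_real_of_nat)
  finally show ?thesis by (rule le_less_trans) (simp add: ennreal_mult[symmetric])
qed

text \<open>The almost sure event on which the deterministic lemmas about countable weights apply at
  a fixed \<omega>, for all truncations and all times simultaneously.\<close>

definition regular :: "'a \<Rightarrow> bool" where
  "regular \<omega> \<longleftrightarrow> (\<forall>\<alpha>\<in>leaves k. 0 < cascade_w k u \<omega> \<alpha>) \<and> (cascade_w k u \<omega> has_sum 1) (leaves k) \<and>
     integrable (count_space pairs) (\<lambda>a. w \<omega> a * exp (envelope \<omega> a))"

lemma AE_regular: "AE \<omega> in M. regular \<omega>"
proof -
  have wm[measurable]: "(\<lambda>\<omega>. w \<omega> a) \<in> borel_measurable M" if "a \<in> pairs" for a using that by auto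
  have em[measurable]: "(\<lambda>\<omega>. envelope \<omega> a) \<in> borel_measurable M" if "a \<in> pairs" for a
    using that unfolding envelope_def by (intro borel_measurable_add borel_measurable_abs) auto
  interpret C: sigma_finite_measure "count_space pairs"
    by (rule sigma_finite_measure_count_space_countable[OF countable_pairs])
  have "(\<lambda>x. ennreal \<bar>w (snd x) (fst x)\<bar> * ennreal (exp (envelope (snd x) (fst x)))) \<in> borel_measurable (count_space pairs \<Otimes>\<^sub>M M)"
    by (rule measurable_pair_measure_countable1[OF countable_pairs]) (simp, measurable)
  from measurable_compose[OF measurable_pair_swap' this]
  have m: "(\<lambda>(\<omega>, a). ennreal \<bar>w \<omega> a\<bar> * ennreal (exp (envelope \<omega> a))) \<in> borel_measurable (M \<Otimes>\<^sub>M count_space pairs)"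
    by (simp add: case_prod_beta')
  have "(\<lambda>\<omega>. \<integral>\<^sup>+a. ennreal \<bar>w \<omega> a\<bar> * ennreal (exp (envelope \<omega> a)) \<partial>count_space pairs) \<in> borel_measurable M"
    by (rule C.borel_measurable_nn_integral[OF m])
  then have "AE \<omega> in M. (\<integral>\<^sup>+a. ennreal \<bar>w \<omega> a\<bar> * ennreal (exp (envelope \<omega> a)) \<partial>count_space pairs) \<noteq> \<infinity>"
    using nn_integral_envelope_finite by (intro nn_integral_PInf_AE) auto
  with cascade_w show ?thesis
  proof eventually_elim
    case (elim \<omega>)
    have "integrable (count_space pairs) (\<lambda>a. w \<omega> a * exp (envelope \<omega> a))"
      by (rule integrableI_bounded) (use elim in \<open>auto simp: abs_mult ennreal_mult less_top\<close>)
    then show ?case using elim by (simp add: regular_def)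
  qed
qed

end

section \<open>Pathwise bounds and reduction to finitely many weights\<close>

context interpolation_model
begin

lemma cut_H_le_envelope:
  assumes "0 \<le> t" "t \<le> 1" shows "\<bar>cut_H S t \<omega> a\<bar> \<le> envelope \<omega> a"
proof -
  have s: "sqrt t \<le> 1" "sqrt (1 - t) \<le> 1" "0 \<le> sqrt t" "0 \<le> sqrt (1 - t)" using assms by auto
  have "\<bar>cut_H S t \<omega> a\<bar> \<le> sqrt t * \<bar>H (fst a) \<omega>\<bar> + sqrt (1 - t) * \<bar>cut_field S \<omega> a\<bar>"
    unfolding cut_H_def using s by (intro order_trans[OF abs_triangle_ineq]) (simp add: abs_mult)
  also have "\<dots> \<le> 1 * \<bar>H (fst a) \<omega>\<bar> + 1 * \<bar>cavity (snd a) (fst a) \<omega>\<bar>"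
    using s by (intro add_mono mult_mono) (auto simp: cut_field_def)
  finally show ?thesis by (simp add: envelope_def)
qed

lemma spins_nonempty: "(\<lambda>i\<in>{1..N}. 1) \<in> spins N"
  unfolding spins_def by auto

context
  fixes \<omega> assumes reg: "regular \<omega>"
begin

lemma reg_w_pos: "a \<in> pairs \<Longrightarrow> 0 < w \<omega> a"
  using reg unfolding regular_def by auto

lemma reg_w_nonneg: "a \<in> pairs \<Longrightarrow> 0 \<le> w \<omega> a"
  using reg_w_pos by (auto intro: less_imp_le)

lemma reg_integrable_envelope: "integrable (count_space pairs) (\<lambda>a. w \<omega> a * exp (envelope \<omega> a))"
  using reg unfolding regular_def by auto

lemma reg_integrable_w: "integrable (count_space pairs) (w \<omega>)"
  using integrable_weights[OF reg_integrable_envelope reg_w_nonneg, of "\<lambda>_. 0"]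
  by (simp add: envelope_def)

lemma reg_integrable_cut:
  "0 \<le> t \<Longrightarrow> t \<le> 1 \<Longrightarrow> integrable (count_space pairs) (\<lambda>a. w \<omega> a * exp (cut_H S t \<omega> a))"
  using integrable_weights[OF reg_integrable_envelope reg_w_nonneg, of "cut_H S t \<omega>"]
    cut_H_le_envelope[of t S \<omega>] by (auto simp: abs_le_iff)

lemma reg_sum_w: "1 \<le> (\<integral>a. w \<omega> a \<partial>count_space pairs)"
proof -
  \<comment> \<open>The leaves paired with the constant configuration alone already carry mass
    1.\<close>
  let ?s = "(\<lambda>i\<in>{1..N}. 1) :: nat \<Rightarrow> real"
  have inj: "inj_on (Pair ?s) (leaves k)" by (auto simp: inj_on_def)
  have sp: "w \<omega> summable_on pairs"
    using reg_integrable_w by (simp add: integrable_count_space_iff_summable)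
  have sub: "Pair ?s ` leaves k \<subseteq> pairs" using spins_nonempty by auto
  have "1 = (\<Sum>\<^sub>\<infinity>\<alpha>\<in>leaves k. cascade_w k u \<omega> \<alpha>)"
    using reg infsumI unfolding regular_def by fastforce
  also have "\<dots> = (\<Sum>\<^sub>\<infinity>a\<in>Pair ?s ` leaves k. w \<omega> a)"
    by (subst infsum_reindex[OF inj]) (simp add: o_def)
  also have "\<dots> \<le> (\<Sum>\<^sub>\<infinity>a\<in>pairs. w \<omega> a)"
    using sp sub summable_on_subset_banach[OF sp sub] reg_w_nonneg by (intro infsum_mono2) auto
  finally show ?thesis by (simp add: infsum_eq_lebesgue_integral)
qed

lemma reg_partition_pos:
  assumes "0 \<le> t" "t \<le> 1" shows "0 < partition_sum pairs (w \<omega>) (cut_H S t \<omega>)"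
proof -
  let ?f = "\<lambda>a. w \<omega> a * exp (cut_H S t \<omega> a)"
  define a0 :: "(nat \<Rightarrow> real) \<times> nat list" where "a0 = (\<lambda>i\<in>{1..N}. 1, replicate k 0)"
  have a0: "a0 \<in> pairs" using spins_nonempty by (simp add: a0_def leaves_def)
  have sp: "?f summable_on pairs"
    using reg_integrable_cut[OF assms] by (simp add: integrable_count_space_iff_summable)
  have "0 < ?f a0" using reg_w_pos[OF a0] by simp
  also have "?f a0 = (\<Sum>\<^sub>\<infinity>a\<in>{a0}. ?f a)" by simp
  also have "\<dots> \<le> (\<Sum>\<^sub>\<infinity>a\<in>pairs. ?f a)"
    using sp a0 reg_w_nonneg by (intro infsum_mono2) (auto simp: less_imp_le)
  finally show ?thesis by (simp add: infsum_eq_lebesgue_integral partition_sum_def)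
qed

end

text \<open>All leaves outside \<open>S\<close> are merged into the extra index \<open>[]\<close>, which is not a leaf.\<close>

definition merge :: "nat list set \<Rightarrow> (nat \<Rightarrow> real) \<times> nat list \<Rightarrow> (nat \<Rightarrow> real) \<times> nat list" where
  "merge S a = (fst a, if snd a \<in> S then snd a else [])"

definition merged :: "nat list set \<Rightarrow> ((nat \<Rightarrow> real) \<times> nat list) set" where
  "merged S = spins N \<times> insert [] S"

text \<open>The index \<open>[]\<close> receives the mass left over by \<open>S\<close>. Absolute
  values ensure nonnegativity at every \<omega>, as \<open>gaussian_weights\<close> demands; at
  regular points they have no effect on the indices in use.\<close>

definition merged_w :: "nat list set \<Rightarrow> (nat \<Rightarrow> real) \<times> nat list \<Rightarrow> 'a \<Rightarrow> real" where
  "merged_w S a \<omega> = (if snd a = [] then \<bar>1 - (\<Sum>\<alpha>\<in>S. cascade_w k u \<omega> \<alpha>)\<bar> else \<bar>cascade_w k u \<omega> (snd a)\<bar>)"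

lemma nil_not_leaf: "[] \<notin> leaves k"
  using k by (auto simp: leaves_def)

text \<open>\<open>[]\<close> is not in \<open>S\<close>, so the cavity field is off there exactly
  as at the leaves outside \<open>S\<close>; the truncated Hamiltonian and slope thus factor through
  \<open>merge\<close>.\<close>

lemma cut_merge:
  assumes "S \<subseteq> leaves k"
  shows "cut_H S t \<omega> (merge S a) = cut_H S t \<omega> a"
    and "cut_slope S (merge S a) (merge S b) = cut_slope S a b"
  using assms nil_not_leaf unfolding cut_H_def cut_field_def cut_slope_def cut_cov_def merge_def by auto

text \<open>For a fixed spin configuration all leaves outside \<open>S\<close> share one value of
  \<open>f\<close>, and their total weight is 1 minus that of \<open>S\<close>. Integrability holds
  because \<open>f\<close> takes finitely many values on the merged set.\<close>

lemma integral_merge: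
  assumes reg: "regular \<omega>" and S: "finite S" "S \<subseteq> leaves k"
  shows "(\<integral>a. w \<omega> a * f (merge S a) \<partial>count_space pairs) = (\<Sum>a\<in>merged S. merged_w S a \<omega> * f a)"
proof -
  let ?w = "cascade_w k u \<omega>"
  have pos: "\<And>\<alpha>. \<alpha> \<in> leaves k \<Longrightarrow> 0 < ?w \<alpha>" and one: "(?w has_sum 1) (leaves k)"
    using reg unfolding regular_def by auto
  have nS: "[] \<notin> S" using S nil_not_leaf by auto
  have compl: "(?w has_sum (1 - (\<Sum>\<alpha>\<in>S. ?w \<alpha>))) (leaves k - S)"
    by (rule has_sum_Diff[OF one has_sum_finite[OF S(1)] S(2)])
  have r0: "0 \<le> 1 - (\<Sum>\<alpha>\<in>S. ?w \<alpha>)"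
    using compl by (rule has_sum_nonneg) (use pos in \<open>auto simp: less_imp_le\<close>)
  have fib: "((\<lambda>\<alpha>. ?w \<alpha> * f (merge S (\<sigma>, \<alpha>))) has_sum (\<Sum>\<kappa>\<in>insert [] S. merged_w S (\<sigma>, \<kappa>) \<omega> * f (\<sigma>, \<kappa>))) (leaves k)" for \<sigma>
  proof -
    have "((\<lambda>\<alpha>. ?w \<alpha> * f (\<sigma>, [])) has_sum ((1 - (\<Sum>\<alpha>\<in>S. ?w \<alpha>)) * f (\<sigma>, []))) (leaves k - S)"
      using compl by (rule has_sum_cmult_left)
    then have 1: "((\<lambda>\<alpha>. ?w \<alpha> * f (merge S (\<sigma>, \<alpha>))) has_sum (merged_w S (\<sigma>, []) \<omega> * f (\<sigma>, []))) (leaves k - S)"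
      using r0 by (subst has_sum_cong[where g="\<lambda>\<alpha>. ?w \<alpha> * f (\<sigma>, [])"]) (auto simp: merge_def merged_w_def)
    have "((\<lambda>\<alpha>. ?w \<alpha> * f (merge S (\<sigma>, \<alpha>))) has_sum (\<Sum>\<alpha>\<in>S. ?w \<alpha> * f (merge S (\<sigma>, \<alpha>)))) S"
      using S(1) by (rule has_sum_finite)
    also have "(\<Sum>\<alpha>\<in>S. ?w \<alpha> * f (merge S (\<sigma>, \<alpha>))) = (\<Sum>\<alpha>\<in>S. merged_w S (\<sigma>, \<alpha>) \<omega> * f (\<sigma>, \<alpha>))"
      using nS S(2) pos by (intro sum.cong) (auto simp: merge_def merged_w_def abs_of_pos subset_iff)
    finally have "((\<lambda>\<alpha>. ?w \<alpha> * f (merge S (\<sigma>, \<alpha>))) has_sum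
        (merged_w S (\<sigma>, []) \<omega> * f (\<sigma>, []) + (\<Sum>\<alpha>\<in>S. merged_w S (\<sigma>, \<alpha>) \<omega> * f (\<sigma>, \<alpha>)))) ((leaves k - S) \<union> S)"
      using 1 by (intro has_sum_Un_disjoint) auto
    moreover have "(leaves k - S) \<union> S = leaves k" using S(2) by auto
    ultimately show ?thesis using S(1) nS by simp
  qed
  have fin: "finite (merged S)" unfolding merged_def using finite_spins S(1) by auto
  have "integrable (count_space pairs) (\<lambda>a. w \<omega> a * exp 0 * f (merge S a))"
  proof (rule integrable_weights_bounded)
    show "integrable (count_space pairs) (\<lambda>a. w \<omega> a * exp 0)" using reg_integrable_w[OF reg] by simp
    show "\<bar>f (merge S a)\<bar> \<le> (\<Sum>a\<in>merged S. \<bar>f a\<bar>)" if "a \<in> pairs" for a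
    proof -
      have "merge S a \<in> merged S" using that by (auto simp: merge_def merged_def)
      then show ?thesis using member_le_sum[of "merge S a" "merged S" "\<lambda>a. \<bar>f a\<bar>"] fin by simp
    qed
  qed (use reg_w_nonneg[OF reg] in auto)
  then have sm: "(\<lambda>a. w \<omega> a * f (merge S a)) summable_on pairs"
    by (simp add: integrable_count_space_iff_summable)
  have "((\<lambda>a. w \<omega> a * f (merge S a)) has_sum
      (\<Sum>\<sigma>\<in>spins N. \<Sum>\<kappa>\<in>insert [] S. merged_w S (\<sigma>, \<kappa>) \<omega> * f (\<sigma>, \<kappa>))) pairs"
    by (rule has_sum_SigmaI[OF _ has_sum_finite[OF finite_spins] sm]) (use fib in simp)
  then have "(\<Sum>\<^sub>\<infinity>a\<in>pairs. w \<omega> a * f (merge S a)) = (\<Sum>\<sigma>\<in>spins N. \<Sum>\<kappa>\<in>insert [] S. merged_w S (\<sigma>, \<kappa>) \<omega> * f (\<sigma>, \<kappa>))"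
    by (rule infsumI)
  also have "\<dots> = (\<Sum>a\<in>merged S. merged_w S a \<omega> * f a)"
    unfolding merged_def sum.cartesian_product by (simp add: case_prod_beta')
  finally show ?thesis by (simp add: infsum_eq_lebesgue_integral)
qed

lemma partition_sum_merge:
  assumes "regular \<omega>" "finite S" "S \<subseteq> leaves k"
  shows "partition_sum pairs (w \<omega>) (cut_H S t \<omega>) = (\<Sum>a\<in>merged S. merged_w S a \<omega> * exp (cut_H S t \<omega> a))"
  using integral_merge[OF assms, of "\<lambda>a. exp (cut_H S t \<omega> a)"]
  by (simp add: partition_sum_def cut_merge assms)

lemma pair_average_merge:
  assumes reg: "regular \<omega>" and S: "finite S" "S \<subseteq> leaves k" and t: "0 \<le> t" "t \<le> 1"
  defines "p \<equiv> \<lambda>a. gibbs_weight (merged S) (\<lambda>a. merged_w S a \<omega>) (\<lambda>a. cut_H S t \<omega> a) a"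
  shows "pair_average pairs (w \<omega>) (cut_H S t \<omega>) (cut_slope S) =
    (1 / 2) * (\<Sum>a\<in>merged S. p a * (cut_cov S a a - (\<Sum>b\<in>merged S. cut_cov S a b * p b)))"
proof -
  let ?Z = "partition_sum pairs (w \<omega>) (cut_H S t \<omega>)"
  let ?e = "\<lambda>a. exp (cut_H S t \<omega> a)" and ?W = "\<lambda>a. merged_w S a \<omega>"
  have Z: "0 < ?Z" by (rule reg_partition_pos[OF reg t])
  have ZA: "?Z = (\<Sum>a\<in>merged S. ?W a * ?e a)" by (rule partition_sum_merge[OF reg S])
  have pZ: "p a = ?W a * ?e a / ?Z" for a unfolding p_def gibbs_weight_def ZA ..
  \<comment> \<open>The normaliser is positive here, so the Gibbs weights add up to 1 and the
    self-term may be averaged over the second replica as well.\<close>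
  have p1: "(\<Sum>a\<in>merged S. p a) = 1" unfolding pZ sum_divide_distrib[symmetric] using Z by (simp add: ZA)
  have inner: "(\<integral>b. w \<omega> b * ?e b * cut_slope S a b \<partial>count_space pairs) = (\<Sum>b\<in>merged S. ?W b * (?e b * cut_slope S (merge S a) b))" for a
  proof -
    have "(\<integral>b. w \<omega> b * ?e b * cut_slope S a b \<partial>count_space pairs) =
       (\<integral>b. w \<omega> b * (?e (merge S b) * cut_slope S (merge S a) (merge S b)) \<partial>count_space pairs)"
      by (simp add: cut_merge S mult.assoc)
    also have "\<dots> = (\<Sum>b\<in>merged S. ?W b * (?e b * cut_slope S (merge S a) b))"
      by (rule integral_merge[OF reg S])
    finally show ?thesis .
  qed
  have "(\<integral>a. w \<omega> a * ?e a * (\<integral>b. w \<omega> b * ?e b * cut_slope S a b \<partial>count_space pairs) \<partial>count_space pairs) =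
    (\<integral>a. w \<omega> a * (?e (merge S a) * (\<Sum>b\<in>merged S. ?W b * (?e b * cut_slope S (merge S a) b))) \<partial>count_space pairs)"
    unfolding inner by (simp add: cut_merge S mult.assoc)
  also have "\<dots> = (\<Sum>a\<in>merged S. ?W a * (?e a * (\<Sum>b\<in>merged S. ?W b * (?e b * cut_slope S a b))))"
    by (rule integral_merge[OF reg S])
  finally have "pair_average pairs (w \<omega>) (cut_H S t \<omega>) (cut_slope S) =
      (\<Sum>a\<in>merged S. ?W a * (?e a * (\<Sum>b\<in>merged S. ?W b * (?e b * cut_slope S a b)))) / ?Z\<^sup>2"
    unfolding pair_average_def by simp
  also have "\<dots> = (\<Sum>a\<in>merged S. p a * (\<Sum>b\<in>merged S. p b * cut_slope S a b))"
    unfolding pZ by (simp add: sum_divide_distrib sum_distrib_left power2_eq_square mult_ac)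
  also have "\<dots> = (\<Sum>a\<in>merged S. p a * ((cut_cov S a a - (\<Sum>b\<in>merged S. cut_cov S a b * p b)) / 2))"
  proof (intro sum.cong refl arg_cong2[where f="(*)"])
    fix a
    have "(\<Sum>b\<in>merged S. p b * cut_slope S a b) = (\<Sum>b\<in>merged S. p b * cut_cov S a a - cut_cov S a b * p b) / 2"
      unfolding cut_slope_def sum_divide_distrib by (intro sum.cong) (auto simp: field_simps)
    also have "(\<Sum>b\<in>merged S. p b * cut_cov S a a - cut_cov S a b * p b) = cut_cov S a a - (\<Sum>b\<in>merged S. cut_cov S a b * p b)"
      unfolding sum_subtractf sum_distrib_right[symmetric] p1 by simp
    finally show "(\<Sum>b\<in>merged S. p b * cut_slope S a b) = (cut_cov S a a - (\<Sum>b\<in>merged S. cut_cov S a b * p b)) / 2" .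
  qed
  also have "\<dots> = (1 / 2) * (\<Sum>a\<in>merged S. p a * (cut_cov S a a - (\<Sum>b\<in>merged S. cut_cov S a b * p b)))"
    by (simp add: sum_divide_distrib)
  finally show ?thesis .
qed

lemma integrable_envelope_sum: "integrable M (\<lambda>\<omega>. partition_sum pairs (w \<omega>) (envelope \<omega>))"
proof (rule integrableI_bounded)
  have em: "(\<lambda>\<omega>. envelope \<omega> a) \<in> borel_measurable M" if "a \<in> pairs" for a
    using that unfolding envelope_def by (intro borel_measurable_add borel_measurable_abs) auto
  have "(\<lambda>\<omega>. w \<omega> a * exp (envelope \<omega> a)) \<in> borel_measurable M" if "a \<in> pairs" for a
    using that em[OF that] cascade_w_measurable_M[of "snd a"] by auto
  then show "(\<lambda>\<omega>. partition_sum pairs (w \<omega>) (envelope \<omega>)) \<in> borel_measurable M"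
    unfolding partition_sum_def by (intro measurable_count_space_integral countable_pairs)
  have "(\<integral>\<^sup>+\<omega>. ennreal (norm (partition_sum pairs (w \<omega>) (envelope \<omega>))) \<partial>M) =
      (\<integral>\<^sup>+\<omega>. (\<integral>\<^sup>+a. ennreal \<bar>w \<omega> a\<bar> * ennreal (exp (envelope \<omega> a)) \<partial>count_space pairs) \<partial>M)"
  proof (rule nn_integral_cong_AE, use AE_regular in eventually_elim)
    fix \<omega> assume elim: "regular \<omega>"
    have "(\<integral>\<^sup>+a. ennreal \<bar>w \<omega> a\<bar> * ennreal (exp (envelope \<omega> a)) \<partial>count_space pairs) =
        (\<integral>\<^sup>+a. ennreal (w \<omega> a * exp (envelope \<omega> a)) \<partial>count_space pairs)"
      using reg_w_nonneg[OF elim] by (intro nn_integral_cong) (auto simp: ennreal_mult)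
    also have "\<dots> = ennreal (partition_sum pairs (w \<omega>) (envelope \<omega>))"
      unfolding partition_sum_def using reg_integrable_envelope[OF elim] reg_w_nonneg[OF elim]
      by (intro nn_integral_eq_integral) (auto simp: AE_count_space)
    moreover have "0 \<le> partition_sum pairs (w \<omega>) (envelope \<omega>)"
      unfolding partition_sum_def using reg_w_nonneg[OF elim] by (intro Bochner_Integration.integral_nonneg) auto
    ultimately show "ennreal (norm (partition_sum pairs (w \<omega>) (envelope \<omega>))) =
        (\<integral>\<^sup>+a. ennreal \<bar>w \<omega> a\<bar> * ennreal (exp (envelope \<omega> a)) \<partial>count_space pairs)" by simp
  qed
  then show "(\<integral>\<^sup>+\<omega>. ennreal (norm (partition_sum pairs (w \<omega>) (envelope \<omega>))) \<partial>M) < \<infinity>"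
    using nn_integral_envelope_finite by simp
qed

lemma abs_ln_partition_le:
  assumes "regular \<omega>" "0 \<le> t" "t \<le> 1"
  shows "\<bar>ln (partition_sum pairs (w \<omega>) (cut_H S t \<omega>))\<bar> \<le> partition_sum pairs (w \<omega>) (envelope \<omega>)"
  using assms reg_integrable_envelope reg_w_nonneg cut_H_le_envelope reg_sum_w reg_partition_pos
  by (intro abs_ln_partition_sum_le) auto

lemma finite_merged: "finite S \<Longrightarrow> finite (merged S)"
  unfolding merged_def using finite_spins by auto

text \<open>For finite \<open>S\<close> the partition sum almost surely equals one over the finite
  index set \<open>merged S\<close>, whose weights depend on the point processes only. The Gaussian
  interpolation with finitely many weights therefore applies.\<close>

lemma free_energy_derivative:
  assumes S: "finite S" "S \<subseteq> leaves k" and t: "0 < t" "t < 1"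
  shows "(free_energy S has_real_derivative slope S t) (at t)"
proof -
  have wa: "merged_w S a \<in> borel_measurable (alg point_sources)" if "a \<in> merged S" for a
  proof -
    have "(\<lambda>\<omega>. cascade_w k u \<omega> \<alpha>) \<in> borel_measurable (alg point_sources)" if "\<alpha> \<in> S" for \<alpha>
      using that S by (intro cascade_w_alg) auto
    then show ?thesis
      using that unfolding merged_w_def[abs_def] merged_def by (cases "snd a = []") auto
  qed
  interpret gaussian_weights M GS "merged S" "merged_w S"
  proof unfold_locales
    show "finite (merged S)" using S(1) by (rule finite_merged)
    show "merged_w S a \<in> borel_measurable M" if "a \<in> merged S" for a
      using measurable_algD[OF sources_subsets(2) wa[OF that]] .
    show "0 \<le> merged_w S a \<omega>" for a \<omega> by (simp add: merged_w_def)
    show "(CLINT \<omega>|M. iexp (L \<omega> + (\<Sum>a\<in>merged S. l a * merged_w S a \<omega>))) =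
        (CLINT \<omega>|M. iexp (L \<omega>)) * (CLINT \<omega>|M. iexp (\<Sum>a\<in>merged S. l a * merged_w S a \<omega>))"
      if "L \<in> GS" for L l
      using that by (intro GS_indep_char borel_measurable_sum borel_measurable_times wa) auto
  qed
  \<comment> \<open>\<open>X\<close> is the field carried by \<open>sqrt t\<close> and
    \<open>Y\<close> the one carried by \<open>sqrt (1 - t)\<close>. At the merged index
    \<open>Y\<close> is 0, which also belongs to the Gaussian space.\<close>
  define X where "X a = H (fst a)" for a :: "(nat \<Rightarrow> real) \<times> nat list"
  define Y where "Y a \<omega> = cut_field S \<omega> a" for a \<omega>
  have XG: "X a \<in> GS" if "a \<in> merged S" for a using that H_GS by (auto simp: X_def merged_def)
  have YG: "Y a \<in> GS" for a
    using cavity_GS zero by (cases "snd a \<in> S") (auto simp: Y_def[abs_def] cut_field_def)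
  have hXY: "sqrt t * X a \<omega> + sqrt (1 - t) * Y a \<omega> = cut_H S t \<omega> a" for t a \<omega>
    by (simp add: cut_H_def X_def Y_def)
  have F: "free_energy S = (\<lambda>t. \<integral>\<omega>. ln (\<Sum>a\<in>merged S. merged_w S a \<omega> * exp (cut_H S t \<omega> a)) \<partial>M)"
    and m: "(\<lambda>\<omega>. ln (\<Sum>a\<in>merged S. merged_w S a \<omega> * exp (cut_H S t \<omega> a))) \<in> borel_measurable M" for t
  proof -
    have hm: "(\<lambda>\<omega>. cut_H S t \<omega> a) \<in> borel_measurable M" if "a \<in> merged S" for a t
      unfolding hXY[symmetric] using G_measurable[OF XG[OF that]] G_measurable[OF YG[of a]] by measurable
    show m: "(\<lambda>\<omega>. ln (\<Sum>a\<in>merged S. merged_w S a \<omega> * exp (cut_H S t \<omega> a))) \<in> borel_measurable M" for t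
      using hm W by (intro borel_measurable_ln borel_measurable_sum borel_measurable_times) auto
    show "free_energy S = (\<lambda>t. \<integral>\<omega>. ln (\<Sum>a\<in>merged S. merged_w S a \<omega> * exp (cut_H S t \<omega> a)) \<partial>M)"
    proof
      fix t
      show "free_energy S t = (\<integral>\<omega>. ln (\<Sum>a\<in>merged S. merged_w S a \<omega> * exp (cut_H S t \<omega> a)) \<partial>M)"
        unfolding free_energy_def
        by (intro integral_cong_AE m) (use AE_regular partition_sum_merge[OF _ S] in auto)
    qed
  qed
  have "((\<lambda>t. \<integral>\<omega>. ln (\<Sum>a\<in>merged S. merged_w S a \<omega> * exp (sqrt t * X a \<omega> + sqrt (1 - t) * Y a \<omega>)) \<partial>M) has_real_derivative
    (\<integral>\<omega>. (1 / 2) * (\<Sum>a\<in>merged S. gibbs_weight (merged S) (\<lambda>b. merged_w S b \<omega>) (\<lambda>b. sqrt t * X b \<omega> + sqrt (1 - t) * Y b \<omega>) a *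
      (cut_cov S a a - (\<Sum>b\<in>merged S. cut_cov S a b *
         gibbs_weight (merged S) (\<lambda>b. merged_w S b \<omega>) (\<lambda>b. sqrt t * X b \<omega> + sqrt (1 - t) * Y b \<omega>) b))) \<partial>M)) (at t)"
  proof (rule has_derivative_expectation_ln[OF XG YG _ _ t])
    show "(\<integral>\<omega>. X a \<omega> * Y b \<omega> \<partial>M) = 0" if "a \<in> merged S" "b \<in> merged S" for a b
      using that cov_H_cavity by (cases "snd b \<in> S") (auto simp: X_def Y_def cut_field_def merged_def)
    show "cut_cov S a b = (\<integral>\<omega>. X a \<omega> * X b \<omega> \<partial>M) - (\<integral>\<omega>. Y a \<omega> * Y b \<omega> \<partial>M)"
      if "a \<in> merged S" "b \<in> merged S" for a b
    proof (cases "snd a \<in> S \<and> snd b \<in> S")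
      case True
      then show ?thesis using that S(2) H_cov cov_cavity[of "snd a" "snd b" "fst a" "fst b"]
        by (auto simp: X_def Y_def cut_field_def cut_cov_def merged_def subset_iff)
    next
      case False
      then have "(\<integral>\<omega>. Y a \<omega> * Y b \<omega> \<partial>M) = (\<integral>\<omega>. 0 \<partial>M)"
        by (intro Bochner_Integration.integral_cong refl) (auto simp: Y_def cut_field_def)
      then show ?thesis using that False H_cov by (auto simp: X_def cut_cov_def merged_def)
    qed
    show "integrable M (\<lambda>\<omega>. ln (\<Sum>a\<in>merged S. merged_w S a \<omega> * exp (sqrt t * X a \<omega> + sqrt (1 - t) * Y a \<omega>)))"
      if "0 < t" "t < 1" for t
      unfolding hXY
    proof (rule Bochner_Integration.integrable_bound[OF integrable_envelope_sum m])
      show "AE \<omega> in M. norm (ln (\<Sum>a\<in>merged S. merged_w S a \<omega> * exp (cut_H S t \<omega> a))) \<le>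
          norm (partition_sum pairs (w \<omega>) (envelope \<omega>))"
        using AE_regular
      proof eventually_elim
        case (elim \<omega>)
        show ?case using abs_ln_partition_le[OF elim, of t S] that
          unfolding partition_sum_merge[OF elim S] by (simp add: order_trans[OF _ abs_ge_self])
      qed
    qed
  qed
  also have "(\<integral>\<omega>. (1 / 2) * (\<Sum>a\<in>merged S. gibbs_weight (merged S) (\<lambda>b. merged_w S b \<omega>) (\<lambda>b. sqrt t * X b \<omega> + sqrt (1 - t) * Y b \<omega>) a *
      (cut_cov S a a - (\<Sum>b\<in>merged S. cut_cov S a b *
         gibbs_weight (merged S) (\<lambda>b. merged_w S b \<omega>) (\<lambda>b. sqrt t * X b \<omega> + sqrt (1 - t) * Y b \<omega>) b))) \<partial>M) = slope S t"
    unfolding slope_def hXY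
  proof (intro integral_cong_AE)
    have gm: "(\<lambda>\<omega>. gibbs_weight (merged S) (\<lambda>b. merged_w S b \<omega>) (\<lambda>b. cut_H S t \<omega> b) a) \<in> borel_measurable M"
      if "a \<in> merged S" for a
      unfolding gibbs_weight_def hXY[symmetric]
      using that W G_measurable[OF XG] G_measurable[OF YG]
      by (intro borel_measurable_divide borel_measurable_sum borel_measurable_times
          measurable_compose[OF _ borel_measurable_exp] borel_measurable_add borel_measurable_const) auto
    show "(\<lambda>\<omega>. (1 / 2) * (\<Sum>a\<in>merged S. gibbs_weight (merged S) (\<lambda>b. merged_w S b \<omega>) (\<lambda>b. cut_H S t \<omega> b) a *
      (cut_cov S a a - (\<Sum>b\<in>merged S. cut_cov S a b *
         gibbs_weight (merged S) (\<lambda>b. merged_w S b \<omega>) (\<lambda>b. cut_H S t \<omega> b) b)))) \<in> borel_measurable M"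
      by (intro borel_measurable_sum borel_measurable_times borel_measurable_diff borel_measurable_const gm)
    show "AE \<omega> in M. (1 / 2) * (\<Sum>a\<in>merged S. gibbs_weight (merged S) (\<lambda>b. merged_w S b \<omega>) (\<lambda>b. cut_H S t \<omega> b) a *
      (cut_cov S a a - (\<Sum>b\<in>merged S. cut_cov S a b *
         gibbs_weight (merged S) (\<lambda>b. merged_w S b \<omega>) (\<lambda>b. cut_H S t \<omega> b) b))) =
       pair_average pairs (w \<omega>) (cut_H S t \<omega>) (cut_slope S)"
      using AE_regular by eventually_elim (use pair_average_merge[OF _ S] t in simp)
  qed measurable
  finally show ?thesis unfolding F hXY .
qed

end

subsection \<open>Removal of the truncation\<close>

context interpolation_model
begin

text \<open>The arguments range over a finite set: there are finitely many spin configurations, and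
  \<open>wedge\<close> is at most \<open>k + 1\<close>.\<close>

lemma pair_function_bounded:
  "\<exists>c\<ge>0. \<forall>a\<in>pairs. \<forall>b\<in>pairs. \<bar>f (fst a) (fst b) (wedge k (snd a) (snd b)) :: real\<bar> \<le> c"
proof -
  let ?I = "spins N \<times> spins N \<times> {..k + 1}"
  let ?f = "\<lambda>(x, y, l). \<bar>f x y l\<bar>"
  have fin: "finite ?I" using finite_spins by auto
  have "\<bar>f (fst a) (fst b) (wedge k (snd a) (snd b))\<bar> \<le> sum ?f ?I" if "a \<in> pairs" "b \<in> pairs" for a b
    using member_le_sum[of "(fst a, fst b, wedge k (snd a) (snd b))" ?I ?f] fin that wedge_bounds[of "snd a" k "snd b"]
    by (auto simp: case_prod_beta' mem_Times_iff)
  then show ?thesis by (intro exI[of _ "sum ?f ?I"]) (auto intro!: sum_nonneg)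
qed

lemma cut_slope_bounded: "\<exists>c\<ge>0. \<forall>S. \<forall>a\<in>pairs. \<forall>b\<in>pairs. \<bar>cut_slope S a b\<bar> \<le> c"
proof -
  obtain c1 where c1: "c1 \<ge> 0" "\<forall>a\<in>pairs. \<forall>b\<in>pairs. \<bar>real N * \<xi> (overlap N (fst a) (fst b))\<bar> \<le> c1"
    using pair_function_bounded[of "\<lambda>x y l. real N * \<xi> (overlap N x y)"] by auto
  obtain c2 where c2: "c2 \<ge> 0" "\<forall>a\<in>pairs. \<forall>b\<in>pairs. \<bar>real N * overlap N (fst a) (fst b) * deriv \<xi> (q (wedge k (snd a) (snd b)))\<bar> \<le> c2"
    using pair_function_bounded[of "\<lambda>x y l. real N * overlap N x y * deriv \<xi> (q l)"] by auto
  have cc: "\<bar>cut_cov S a b\<bar> \<le> c1 + c2" if "a \<in> pairs" "b \<in> pairs" for S a b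
  proof -
    have "\<bar>real N * \<xi> (overlap N (fst a) (fst b))\<bar> \<le> c1"
      "\<bar>real N * overlap N (fst a) (fst b) * deriv \<xi> (q (wedge k (snd a) (snd b)))\<bar> \<le> c2"
      using c1(2) c2(2) that by blast+
    then show ?thesis unfolding cut_cov_def using c2(1) by (auto simp: abs_le_iff)
  qed
  have "\<bar>cut_slope S a b\<bar> \<le> c1 + c2" if "a \<in> pairs" "b \<in> pairs" for S a b
    using cc[OF that(1) that(1), of S] cc[OF that, of S] unfolding cut_slope_def by (simp add: abs_le_iff)
  then show ?thesis using c1(1) c2(1) by (intro exI[of _ "c1 + c2"]) auto
qed

text \<open>Serves two purposes: with a constant truncation it gives continuity in time, and with a
  constant time it removes the truncation. The latter asks only that each single leaf is eventually
  treated as in the limit.\<close>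

lemma cut_limits:
  assumes T: "\<And>n. T n \<in> {0..1}" and Tt: "T \<longlonglongrightarrow> t"
    and S: "\<And>\<alpha>. \<alpha> \<in> leaves k \<Longrightarrow> \<forall>\<^sub>F n in sequentially. \<alpha> \<in> S n \<longleftrightarrow> \<alpha> \<in> S0"
  shows "(\<lambda>n. free_energy (S n) (T n)) \<longlonglongrightarrow> free_energy S0 t"
    and "(\<lambda>n. slope (S n) (T n)) \<longlonglongrightarrow> slope S0 t"
proof -
  have T01: "0 \<le> T n" "T n \<le> 1" for n using T[of n] by auto
  have t01: "0 \<le> t" "t \<le> 1"
    using LIMSEQ_le_const[OF Tt, of 0] LIMSEQ_le_const2[OF Tt, of 1] T01 by auto
  have hlim: "(\<lambda>n. cut_H (S n) (T n) \<omega> a) \<longlonglongrightarrow> cut_H S0 t \<omega> a" if "a \<in> pairs" for a \<omega>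
    unfolding cut_H_def
  proof (intro tendsto_intros Tt)
    have "\<forall>\<^sub>F n in sequentially. cut_field (S n) \<omega> a = cut_field S0 \<omega> a"
    proof -
      have "\<forall>\<^sub>F n in sequentially. snd a \<in> S n \<longleftrightarrow> snd a \<in> S0" by (rule S) (use that in auto)
      then show ?thesis by eventually_elim (simp add: cut_field_def)
    qed
    then show "(\<lambda>n. cut_field (S n) \<omega> a) \<longlonglongrightarrow> cut_field S0 \<omega> a" by (rule tendsto_eventually)
  qed
  have Qlim: "(\<lambda>n. cut_slope (S n) a b) \<longlonglongrightarrow> cut_slope S0 a b" if "a \<in> pairs" "b \<in> pairs" for a b
  proof (rule tendsto_eventually)
    have "\<forall>\<^sub>F n in sequentially. snd a \<in> S n \<longleftrightarrow> snd a \<in> S0" "\<forall>\<^sub>F n in sequentially. snd b \<in> S n \<longleftrightarrow> snd b \<in> S0"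
      by (rule S; use that in auto)+
    then show "\<forall>\<^sub>F n in sequentially. cut_slope (S n) a b = cut_slope S0 a b"
      by eventually_elim (simp add: cut_slope_def cut_cov_def)
  qed
  have le: "cut_H (S n) (T n) \<omega> a \<le> envelope \<omega> a" for n \<omega> a
    using cut_H_le_envelope[OF T01[of n], of "S n" \<omega> a] by (simp add: abs_le_iff)
  have Z: "(\<lambda>n. partition_sum pairs (w \<omega>) (cut_H (S n) (T n) \<omega>)) \<longlonglongrightarrow> partition_sum pairs (w \<omega>) (cut_H S0 t \<omega>)"
    if "regular \<omega>" for \<omega>
    using reg_integrable_envelope[OF that] reg_w_nonneg[OF that] le hlim by (intro partition_sum_tendsto) auto
  show "(\<lambda>n. free_energy (S n) (T n)) \<longlonglongrightarrow> free_energy S0 t"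
    unfolding free_energy_def
  proof (rule integral_dominated_convergence[where w="\<lambda>\<omega>. partition_sum pairs (w \<omega>) (envelope \<omega>)"])
    show "AE \<omega> in M. (\<lambda>n. ln (partition_sum pairs (w \<omega>) (cut_H (S n) (T n) \<omega>))) \<longlonglongrightarrow> ln (partition_sum pairs (w \<omega>) (cut_H S0 t \<omega>))"
      using AE_regular
    proof eventually_elim
      case (elim \<omega>)
      show ?case using reg_partition_pos[OF elim t01, of S0] by (intro tendsto_ln Z elim) simp
    qed
    show "AE \<omega> in M. norm (ln (partition_sum pairs (w \<omega>) (cut_H (S n) (T n) \<omega>))) \<le> partition_sum pairs (w \<omega>) (envelope \<omega>)" for n
      using AE_regular by eventually_elim (use abs_ln_partition_le T01 in auto)
  qed (use integrable_envelope_sum in measurable)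
  obtain c where c: "c \<ge> 0" "\<And>S a b. a \<in> pairs \<Longrightarrow> b \<in> pairs \<Longrightarrow> \<bar>cut_slope S a b\<bar> \<le> c"
    using cut_slope_bounded by blast
  show "(\<lambda>n. slope (S n) (T n)) \<longlonglongrightarrow> slope S0 t"
    unfolding slope_def
  proof (rule integral_dominated_convergence[where w="\<lambda>\<omega>. c"])
    show "AE \<omega> in M. (\<lambda>n. pair_average pairs (w \<omega>) (cut_H (S n) (T n) \<omega>) (cut_slope (S n))) \<longlonglongrightarrow>
        pair_average pairs (w \<omega>) (cut_H S0 t \<omega>) (cut_slope S0)"
      using AE_regular
    proof eventually_elim
      case (elim \<omega>)
      show ?case
        by (rule pair_average_tendsto[OF reg_integrable_envelope[OF elim] reg_w_nonneg[OF elim] le hlim c(2) Qlim c(1)])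
           (use reg_partition_pos[OF elim t01, of S0] in auto)
    qed
    show "AE \<omega> in M. norm (pair_average pairs (w \<omega>) (cut_H (S n) (T n) \<omega>) (cut_slope (S n))) \<le> c" for n
      using AE_regular
    proof eventually_elim
      case (elim \<omega>)
      show ?case unfolding real_norm_def
        by (rule pair_average_bound[OF reg_integrable_cut[OF elim T01] reg_w_nonneg[OF elim] c(2) c(1)])
    qed
  qed auto
qed

text \<open>Derivatives need not survive a pointwise limit, but their integrals do, as the slopes
  are bounded by one constant. The limiting identity is then differentiated again.\<close>

lemma free_energy_has_derivative:
  assumes t: "t \<in> {0..1}"
  shows "(free_energy (leaves k) has_real_derivative slope (leaves k) t) (at t within {0..1})"
proof -
  \<comment> \<open>Finite sets that exhaust the leaves along the enumeration
    \<open>to_nat\<close>.\<close>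
  define F where "F n = {\<alpha> \<in> leaves k. to_nat \<alpha> < n}" for n
  have F: "finite (F n)" "F n \<subseteq> leaves k" for n
  proof -
    have "finite (to_nat -` {..<n} :: nat list set)" by (intro finite_vimageI) auto
    then show "finite (F n)" by (rule rev_finite_subset) (auto simp: F_def)
  qed (auto simp: F_def)
  have Fev: "\<forall>\<^sub>F n in sequentially. \<alpha> \<in> F n \<longleftrightarrow> \<alpha> \<in> leaves k" for \<alpha>
    using eventually_gt_at_top[of "to_nat \<alpha>"] by eventually_elim (simp add: F_def)
  obtain c where c: "c \<ge> 0" "\<And>S a b. a \<in> pairs \<Longrightarrow> b \<in> pairs \<Longrightarrow> \<bar>cut_slope S a b\<bar> \<le> c"
    using cut_slope_bounded by blast
  have sb: "\<bar>slope S s\<bar> \<le> c" if "0 \<le> s" "s \<le> 1" for S s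
  proof -
    have b: "AE \<omega> in M. \<bar>pair_average pairs (w \<omega>) (cut_H S s \<omega>) (cut_slope S)\<bar> \<le> c"
      using AE_regular
    proof eventually_elim
      case (elim \<omega>)
      show ?case by (rule pair_average_bound[OF reg_integrable_cut[OF elim that] reg_w_nonneg[OF elim] c(2) c(1)])
    qed
    have "\<bar>slope S s\<bar> \<le> (\<integral>\<omega>. \<bar>pair_average pairs (w \<omega>) (cut_H S s \<omega>) (cut_slope S)\<bar> \<partial>M)"
      unfolding slope_def by (rule integral_abs_bound)
    also have "\<dots> \<le> (\<integral>\<omega>. c \<partial>M)"
    proof (rule integral_mono_AE)
      show "integrable M (\<lambda>\<omega>. \<bar>pair_average pairs (w \<omega>) (cut_H S s \<omega>) (cut_slope S)\<bar>)"
        by (intro integrable_abs integrable_const_bound[where B=c]) (use b in auto)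
    qed (use b in auto)
    finally show ?thesis by (simp add: prob_space)
  qed
  have cont: "continuous_on {0..1} (free_energy S)" "continuous_on {0..1} (slope S)" for S
    unfolding continuous_on_sequentially o_def
    by (intro allI ballI impI cut_limits; simp)+
  have int: "(slope (F n) has_integral free_energy (F n) s - free_energy (F n) 0) {0..s}" if s: "s \<in> {0..1}" for n s
  \<comment> \<open>This version asks for the derivative only inside the interval and for continuity
    up to its ends; the square roots are not differentiable at 0 and 1.\<close>
  proof (rule fundamental_theorem_of_calculus_interior)
    show "0 \<le> s" using s by simp
    show "continuous_on {0..s} (free_energy (F n))" using s by (intro continuous_on_subset[OF cont(1)]) auto
    show "(free_energy (F n) has_vector_derivative slope (F n) x) (at x)" if "x \<in> {0<..<s}" for x
      using free_energy_derivative[OF F, of x n] that s by (auto simp: has_real_derivative_iff_has_vector_derivative)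
  qed
  have rep: "free_energy (leaves k) s - free_energy (leaves k) 0 = integral {0..s} (slope (leaves k))" if s: "s \<in> {0..1}" for s
  proof -
    have "(\<lambda>n. integral {0..s} (slope (F n))) \<longlonglongrightarrow> integral {0..s} (slope (leaves k))"
    proof (rule dominated_convergence(2)[where h="\<lambda>_. c"])
      show "slope (F n) integrable_on {0..s}" for n using int[OF s] by blast
      show "norm (slope (F n) x) \<le> c" if "x \<in> {0..s}" for n x using sb[of x "F n"] that s by auto
      show "(\<lambda>n. slope (F n) x) \<longlonglongrightarrow> slope (leaves k) x" if "x \<in> {0..s}" for x
        using that s by (intro cut_limits(2) Fev) auto
    qed auto
    moreover have "integral {0..s} (slope (F n)) = free_energy (F n) s - free_energy (F n) 0" for n
      using int[OF s] by (rule integral_unique)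
    moreover have "(\<lambda>n. free_energy (F n) s - free_energy (F n) 0) \<longlonglongrightarrow> free_energy (leaves k) s - free_energy (leaves k) 0"
      using s by (intro tendsto_diff cut_limits(1) Fev) auto
    ultimately show ?thesis using LIMSEQ_unique by auto
  qed
  \<comment> \<open>The limiting slope is continuous on the closed interval, so its integral is
    differentiable at every point, one-sidedly at 0 and 1.\<close>
  have "((\<lambda>s. integral {0..s} (slope (leaves k))) has_real_derivative slope (leaves k) t) (at t within {0..1})"
    using integral_has_vector_derivative[OF cont(2) t] by (simp add: has_real_derivative_iff_has_vector_derivative)
  from DERIV_add[OF DERIV_const[of "free_energy (leaves k) 0"] this]
  have "((\<lambda>s. free_energy (leaves k) 0 + integral {0..s} (slope (leaves k))) has_real_derivative slope (leaves k) t) (at t within {0..1})"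
    by simp
  then show ?thesis
  proof (rule has_field_derivative_transform_within[OF _ zero_less_one t])
    show "free_energy (leaves k) 0 + integral {0..s} (slope (leaves k)) = free_energy (leaves k) s" if "s \<in> {0..1}" for s
      using rep[OF that] by simp
  qed
qed

section \<open>Translation into the Gibbs measure of the model\<close>

lemma interp_H_eq: "a \<in> pairs \<Longrightarrow> interp_H N k H z t \<omega> (fst a) (snd a) = cut_H (leaves k) t \<omega> a"
  by (auto simp: interp_H_def cut_H_def cut_field_def cavity_def)

lemma partition_fun_eq: "partition_fun N k H z u t \<omega> = partition_sum pairs (w \<omega>) (cut_H (leaves k) t \<omega>)"
  unfolding partition_fun_def infsum_eq_lebesgue_integral partition_sum_def
  by (intro Bochner_Integration.integral_cong refl) (auto simp: interp_H_eq[of "(_, _)", simplified])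

text \<open>Holds at every \<omega>, which yields measurability of the average; the simpler
  \<open>pair_average\<close> form is available at regular points only.\<close>

lemma gibbs_average_eq:
  "gibbs_average N k H z u t \<omega> f =
    (\<integral>x. max 0 (w \<omega> (fst x) * exp (cut_H (leaves k) t \<omega> (fst x)) / partition_sum pairs (w \<omega>) (cut_H (leaves k) t \<omega>)) *
         max 0 (w \<omega> (snd x) * exp (cut_H (leaves k) t \<omega> (snd x)) / partition_sum pairs (w \<omega>) (cut_H (leaves k) t \<omega>)) * f x
       \<partial>count_space (pairs \<times> pairs))"
proof -
  have "gibbs_measure N k H z u t \<omega> =
     point_measure pairs (\<lambda>a. ennreal (w \<omega> a * exp (cut_H (leaves k) t \<omega> a) / partition_sum pairs (w \<omega>) (cut_H (leaves k) t \<omega>)))"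
    unfolding gibbs_measure_def point_measure_def partition_fun_eq
    by (intro density_cong) (auto simp: AE_count_space interp_H_eq[of "(_, _)", simplified])
  then show ?thesis
    unfolding gibbs_average_def by (simp only: integral_point_measure_pair[OF countable_pairs])
qed

lemma gibbs_average_measurable: "(\<lambda>\<omega>. gibbs_average N k H z u t \<omega> f) \<in> borel_measurable M"
  unfolding gibbs_average_eq
proof (rule measurable_count_space_integral)
  show "countable (pairs \<times> pairs)" using countable_pairs by auto
  fix x assume "x \<in> pairs \<times> pairs"
  then have x: "fst x \<in> pairs" "snd x \<in> pairs" by auto
  note [measurable] = weight_measurable[OF x(1)] weight_measurable[OF x(2)]
  show "(\<lambda>\<omega>. max 0 (w \<omega> (fst x) * exp (cut_H (leaves k) t \<omega> (fst x)) / partition_sum pairs (w \<omega>) (cut_H (leaves k) t \<omega>)) *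
         max 0 (w \<omega> (snd x) * exp (cut_H (leaves k) t \<omega> (snd x)) / partition_sum pairs (w \<omega>) (cut_H (leaves k) t \<omega>)) * f x) \<in> borel_measurable M"
    by measurable
qed

lemma gibbs_average_regular:
  assumes reg: "regular \<omega>" and t: "0 \<le> t" "t \<le> 1"
    and f: "\<And>a b. a \<in> pairs \<Longrightarrow> b \<in> pairs \<Longrightarrow> \<bar>f (a, b)\<bar> \<le> c"
  shows "gibbs_average N k H z u t \<omega> f = pair_average pairs (w \<omega>) (cut_H (leaves k) t \<omega>) (\<lambda>a b. f (a, b))"
proof -
  let ?Z = "partition_sum pairs (w \<omega>) (cut_H (leaves k) t \<omega>)"
  let ?e = "\<lambda>a. w \<omega> a * exp (cut_H (leaves k) t \<omega> a)"
  have Z: "0 < ?Z" using reg_partition_pos[OF reg t] .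
  have "gibbs_average N k H z u t \<omega> f = (\<integral>a. ?e a / ?Z * (\<integral>b. ?e b / ?Z * f (a, b) \<partial>count_space pairs) \<partial>count_space pairs)"
    unfolding gibbs_average_eq
    by (rule integral_count_space_product[OF countable_pairs, where c=c])
       (use reg_integrable_cut[OF reg t] reg_w_nonneg[OF reg] Z f in auto)
  also have "\<dots> = (\<integral>a. (?e a * (\<integral>b. ?e b * f (a, b) \<partial>count_space pairs)) / ?Z\<^sup>2 \<partial>count_space pairs)"
  proof (intro Bochner_Integration.integral_cong refl)
    fix a
    have "(\<integral>b. ?e b / ?Z * f (a, b) \<partial>count_space pairs) = (\<integral>b. ?e b * f (a, b) / ?Z \<partial>count_space pairs)"
      by (intro Bochner_Integration.integral_cong refl) simp
    also have "\<dots> = (\<integral>b. ?e b * f (a, b) \<partial>count_space pairs) / ?Z" by simp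
    finally show "?e a / ?Z * (\<integral>b. ?e b / ?Z * f (a, b) \<partial>count_space pairs) =
        (?e a * (\<integral>b. ?e b * f (a, b) \<partial>count_space pairs)) / ?Z\<^sup>2"
      by (simp add: power2_eq_square)
  qed
  finally show ?thesis unfolding pair_average_def by simp
qed

lemma gibbs_average_integrable:
  assumes t: "0 \<le> t" "t \<le> 1" and f: "\<And>a b. a \<in> pairs \<Longrightarrow> b \<in> pairs \<Longrightarrow> \<bar>f (a, b)\<bar> \<le> c" and c: "0 \<le> c"
  shows "integrable M (\<lambda>\<omega>. gibbs_average N k H z u t \<omega> f)"
proof (rule integrable_const_bound[where B=c])
  show "AE \<omega> in M. norm (gibbs_average N k H z u t \<omega> f) \<le> c"
    using AE_regular
  proof eventually_elim
    case (elim \<omega>)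
    show ?case unfolding gibbs_average_regular[where f=f and c=c, OF elim t f, simplified] real_norm_def
      by (rule pair_average_bound[OF reg_integrable_cut[OF elim t] reg_w_nonneg[OF elim] f c])
  qed
qed (rule gibbs_average_measurable)

lemma slope_leaves:
  assumes t: "0 \<le> t" "t \<le> 1"
  shows "slope (leaves k) t = real N *
     (- (1 / 2) * theta \<xi> 1
      + (1 / 2) * (\<integral>\<omega>. gibbs_average N k H z u t \<omega> (\<lambda>((\<sigma>1, \<alpha>), (\<sigma>2, \<beta>)). theta \<xi> (q (wedge k \<alpha> \<beta>))) \<partial>M)
      - (1 / 2) * (\<integral>\<omega>. gibbs_average N k H z u t \<omega>
          (\<lambda>((\<sigma>1, \<alpha>), (\<sigma>2, \<beta>)). Delta \<xi> (overlap N \<sigma>1 \<sigma>2) (q (wedge k \<alpha> \<beta>))) \<partial>M))"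
proof -
  let ?f = "\<lambda>((\<sigma>1 :: nat \<Rightarrow> real, \<alpha>), (\<sigma>2 :: nat \<Rightarrow> real, \<beta>)). theta \<xi> (q (wedge k \<alpha> \<beta>))"
  let ?g = "\<lambda>((\<sigma>1, \<alpha>), (\<sigma>2, \<beta>)). Delta \<xi> (overlap N \<sigma>1 \<sigma>2) (q (wedge k \<alpha> \<beta>))"
  obtain cf where cf: "cf \<ge> 0" "\<And>a b. a \<in> pairs \<Longrightarrow> b \<in> pairs \<Longrightarrow> \<bar>?f (a, b)\<bar> \<le> cf"
    using pair_function_bounded[of "\<lambda>x y l. theta \<xi> (q l)"] by (auto simp: case_prod_beta')
  obtain cg where cg: "cg \<ge> 0" "\<And>a b. a \<in> pairs \<Longrightarrow> b \<in> pairs \<Longrightarrow> \<bar>?g (a, b)\<bar> \<le> cg"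
    using pair_function_bounded[of "\<lambda>x y l. Delta \<xi> (overlap N x y) (q l)"] by (auto simp: case_prod_beta')
  \<comment> \<open>Since \<open>overlap\<close> and \<open>q\<close> equal 1 in the self-term, that
    term contributes \<open>\<xi> 1 - deriv \<xi> 1\<close>, which is
    \<open>- theta \<xi> 1\<close>. In the cross term, \<open>theta\<close> minus
    \<open>Delta\<close> leaves \<open>R * deriv \<xi> q - \<xi> R\<close>, because the summand
    \<open>theta\<close> inside \<open>Delta\<close> cancels.\<close>
  have cs: "cut_slope (leaves k) a b = (real N / 2) * ?f (a, b) + ((- real N / 2) * ?g (a, b) + (- real N / 2) * theta \<xi> 1)"
    if "a \<in> pairs" "b \<in> pairs" for a b
  proof -
    obtain x \<alpha> y \<beta> where ab: "a = (x, \<alpha>)" "b = (y, \<beta>)" by (metis surj_pair)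
    have 1: "overlap N x x = 1" using that ab N by (intro overlap_self) auto
    have 2: "wedge k \<alpha> \<alpha> = k + 1" by (simp add: wedge_def)
    have 3: "\<alpha> \<in> leaves k" "\<beta> \<in> leaves k" using that ab by auto
    show ?thesis
      unfolding ab cut_slope_def cut_cov_def theta_def Delta_def fst_conv snd_conv prod.case 1 2 q1
      by (simp only: 3 simp_thms if_True) (simp add: algebra_simps diff_divide_distrib add_divide_distrib)
  qed
  have "slope (leaves k) t = (\<integral>\<omega>. (real N / 2) * gibbs_average N k H z u t \<omega> ?f +
      ((- real N / 2) * gibbs_average N k H z u t \<omega> ?g + (- real N / 2) * theta \<xi> 1) \<partial>M)"
    unfolding slope_def
  proof (rule integral_cong_AE)
    show "(\<lambda>\<omega>. (real N / 2) * gibbs_average N k H z u t \<omega> ?f +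
      ((- real N / 2) * gibbs_average N k H z u t \<omega> ?g + (- real N / 2) * theta \<xi> 1)) \<in> borel_measurable M"
      by (intro borel_measurable_add borel_measurable_times borel_measurable_const gibbs_average_measurable)
    show "AE \<omega> in M. pair_average pairs (w \<omega>) (cut_H (leaves k) t \<omega>) (cut_slope (leaves k)) =
      (real N / 2) * gibbs_average N k H z u t \<omega> ?f +
      ((- real N / 2) * gibbs_average N k H z u t \<omega> ?g + (- real N / 2) * theta \<xi> 1)"
      using AE_regular
    proof eventually_elim
      case (elim \<omega>)
      let ?J = "pair_average pairs (w \<omega>) (cut_H (leaves k) t \<omega>)"
      note i = reg_integrable_cut[OF elim t, of "leaves k"] reg_w_nonneg[OF elim]
      have "?J (cut_slope (leaves k)) =
          ?J (\<lambda>a b. (real N / 2) * ?f (a, b) + ((- real N / 2) * ?g (a, b) + (- real N / 2) * theta \<xi> 1))"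
        by (intro pair_average_cong refl cs)
      also have "\<dots> = (real N / 2) * ?J (\<lambda>a b. ?f (a, b)) + ?J (\<lambda>a b. (- real N / 2) * ?g (a, b) + (- real N / 2) * theta \<xi> 1)"
      proof (rule pair_average_lin[OF i cf(2)])
        show "\<bar>(- real N / 2) * ?g (a, b) + (- real N / 2) * theta \<xi> 1\<bar> \<le> (real N / 2) * cg + \<bar>(- real N / 2) * theta \<xi> 1\<bar>"
          if "a \<in> pairs" "b \<in> pairs" for a b
        proof -
          have "\<bar>(- real N / 2) * ?g (a, b)\<bar> \<le> (real N / 2) * cg"
            unfolding abs_mult using cg(2)[OF that] by (intro mult_mono) auto
          then show ?thesis by linarith
        qed
      qed
      also have "?J (\<lambda>a b. (- real N / 2) * ?g (a, b) + (- real N / 2) * theta \<xi> 1) =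
          (- real N / 2) * ?J (\<lambda>a b. ?g (a, b)) + ?J (\<lambda>a b. (- real N / 2) * theta \<xi> 1)"
        by (rule pair_average_lin[OF i cg(2) order_refl])
      also have "?J (\<lambda>a b. (- real N / 2) * theta \<xi> 1) = (- real N / 2) * theta \<xi> 1"
        using reg_partition_pos[OF elim t, of "leaves k"] by (intro pair_average_const) simp
      finally show ?case
        using gibbs_average_regular[where f="?f", OF elim t cf(2)] gibbs_average_regular[where f="?g", OF elim t cg(2)]
        by simp
    qed
  qed measurable
  also have "\<dots> = (real N / 2) * (\<integral>\<omega>. gibbs_average N k H z u t \<omega> ?f \<partial>M) +
      ((- real N / 2) * (\<integral>\<omega>. gibbs_average N k H z u t \<omega> ?g \<partial>M) + (- real N / 2) * theta \<xi> 1)"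
    using gibbs_average_integrable[where f="?f", OF t cf(2) cf(1)] gibbs_average_integrable[where f="?g", OF t cg(2) cg(1)]
    by (simp add: prob_space)
  finally show ?thesis by (simp add: algebra_simps)
qed

lemma phi_derivative:
  assumes t: "t \<in> {0..1}"
  shows "(phi M N k H z u has_real_derivative
     (- (1 / 2) * theta \<xi> 1
      + (1 / 2) * (\<integral>\<omega>. gibbs_average N k H z u t \<omega> (\<lambda>((\<sigma>1, \<alpha>), (\<sigma>2, \<beta>)). theta \<xi> (q (wedge k \<alpha> \<beta>))) \<partial>M)
      - (1 / 2) * (\<integral>\<omega>. gibbs_average N k H z u t \<omega>
          (\<lambda>((\<sigma>1, \<alpha>), (\<sigma>2, \<beta>)). Delta \<xi> (overlap N \<sigma>1 \<sigma>2) (q (wedge k \<alpha> \<beta>))) \<partial>M))) (at t within {0..1})"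
proof -
  have "phi M N k H z u = (\<lambda>t. (1 / real N) * free_energy (leaves k) t)"
    by (simp add: phi_def[abs_def] free_energy_def partition_fun_eq)
  moreover have "((\<lambda>t. (1 / real N) * free_energy (leaves k) t) has_real_derivative (1 / real N) * slope (leaves k) t) (at t within {0..1})"
    by (rule DERIV_cmult[OF free_energy_has_derivative[OF t]])
  ultimately show ?thesis
    using slope_leaves[of t] t N by simp
qed

end

theorem theorem2:
  fixes M :: "'a measure"
    and N k :: nat
    and \<xi> :: "real \<Rightarrow> real"
    and m q :: "nat \<Rightarrow> real"
    and H :: "(nat \<Rightarrow> real) \<Rightarrow> 'a \<Rightarrow> real"
    and z :: "nat list \<Rightarrow> nat \<Rightarrow> 'a \<Rightarrow> real"
    and u :: "nat list \<Rightarrow> 'a \<Rightarrow> real"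
    and t :: real
  assumes "prob_space M"
    and "N \<ge> 1" and "k \<ge> 1"
    and "smooth \<xi>" and "convex_on UNIV \<xi>" and "\<xi> 0 = 0" and "deriv \<xi> 0 = 0"
    and "m 0 = 0" and "\<forall>l<k. m l < m (l + 1)" and "m k < 1"
    and "q 0 = 0" and "\<forall>l\<le>k. q l < q (l + 1)" and "q (k + 1) = 1"
    and "centered_gaussian_process M (spins N) H"
    and "\<forall>\<sigma>1\<in>spins N. \<forall>\<sigma>2\<in>spins N.
           (\<integral>\<omega>. H \<sigma>1 \<omega> * H \<sigma>2 \<omega> \<partial>M) = real N * \<xi> (overlap N \<sigma>1 \<sigma>2)"
    and "\<forall>p i. length p \<le> k \<and> i \<in> {1..N} \<longrightarrow>
           centered_gaussian M (deriv \<xi> (q (length p + 1)) - deriv \<xi> (q (length p))) (z p i)"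
    and "\<forall>p. length p < k \<longrightarrow>
           decreasing_poisson_process M (cascade_intensity (m (length p + 1))) (\<lambda>n. u (p @ [n]))"
    and "independent_sources M N k H z u"
    and "t \<in> {0..1}"
  shows "(phi M N k H z u has_real_derivative
           (- (1 / 2) * theta \<xi> 1
            + (1 / 2) * (\<integral>\<omega>. gibbs_average N k H z u t \<omega>
                (\<lambda>((\<sigma>1, \<alpha>), (\<sigma>2, \<beta>)). theta \<xi> (q (wedge k \<alpha> \<beta>))) \<partial>M)
            - (1 / 2) * (\<integral>\<omega>. gibbs_average N k H z u t \<omega>
                (\<lambda>((\<sigma>1, \<alpha>), (\<sigma>2, \<beta>)). Delta \<xi> (overlap N \<sigma>1 \<sigma>2) (q (wedge k \<alpha> \<beta>))) \<partial>M)))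
         (at t within {0..1})"
proof -
  interpret prob_space M by fact
  interpret interpolation_model M N k \<xi> m q H z u
    using assms by unfold_locales auto
  show ?thesis using assms(19) by (rule phi_derivative)
qed

end
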